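(* Let $R$ be a commutative ring with $1$, and let $L=L_0\oplus L_1$ be a free Lie superalgebra over $R$, freely generated by a totally ordered set $(A,<)$ whose elements are homogeneous (some even and some odd). Let $(C,<)$ be a complete set of basic commutators on $A$. Then $L$ is a free $R$-module with basis $$C\cup\{[w,w]\mid w\in C \text{ is odd}\}.$$
   Context: **Lie superalgebras.** A Lie superalgebra over $R$ is a $\mathbb{Z}_2$-graded $R$-algebra $L=L_0\oplus L_1$ with an $R$-bilinear product $[\,,]$ such that $[L_0,L_0],[L_1,L_1]\le L_0$ and $[L_0,L_1],[L_1,L_0]\le L_1$. Elements of $L_0$ are called even (put $|a|=0$), elements of $L_1$ are called odd (put $|a|=1$), and odd elements and even elements are called homogeneous. For all homogeneous $a,b,c$ the product must satisfy $$[b,a]=-(-1)^{|a||b|}[a,b],$$ $$(-1)^{|a||c|}[a,[b,c]]+(-1)^{|b||a|}[b,[c,a]]+(-1)^{|c||b|}[c,[a,b]]=0.$$ It is also required that $[a,a]=0$ for every even element $a$ and that $[a,a,a]=0$ for every odd element $a$. Products are left-normed: $[a,b,c]$ denotes $[[a,b],c]$, and so on. "Freely generated by $A$" refers to the usual universal property among Lie superalgebras over $R$ in this sense, with respect to parity-preserving maps from $A$, each generator in $A$ having a prescribed parity. **Basic commutators.** Let $(A,<)$ be a totally ordered set of generators. The basic commutators on $A$ are bracketed expressions in elements of $A$ (regarded also as elements of $L$), defined together with a total order $<$ by recursion on weight. - The basic commutators of weight one are the elements of $A$, with their given order. - The basic commutators of weight two are the $[a,b]$ with $a,b\in A$, $a>b$.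 They are ordered arbitrarily among themselves and follow those of weight one. - The basic commutators of weight three are the $[a,b,c]$ with $a,b,c\in A$, $a>b\le c$. They are ordered arbitrarily among themselves and follow those of weight two. - For $k>3$, the basic commutators of weight $k$ are the commutators $[c,d]$ where, for some $m,n$ with $m+n=k$: (1) $c,d$ are basic commutators of weights $m,n$ respectively; (2) $c>d$; (3) if, in the definition of basic commutators of weight $m$, $c$ was defined to be $[e,f]$, then $f\le d$. They are ordered arbitrarily among themselves and follow those of weight $k-1$. A complete set of basic commutators $(C,<)$ on $A$ is the set of all basic commutators of all weights obtained from one such choice of orders. Basic commutators are homogeneous elements of $L$; the parity of a basic commutator is the sum modulo 2 of the parities of its entries. *)

theory Defs
  imports "HOL-Algebra.Algebra"
begin

section \<open>Lie superalgebras over a commutative ring\<close>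

text \<open>
  The fields \<open>mult\<close> and \<open>one\<close> that a \<open>module\<close> record inherits from \<open>ring\<close> are not used,
  as in HOL-Algebra's own treatment of modules.
\<close>

record ('r, 'b) superalgebra = "('r, 'b) module" +
  bracket :: "'b \<Rightarrow> 'b \<Rightarrow> 'b"
  even_part :: "'b set"
  odd_part :: "'b set"

text \<open>Degrees are the natural numbers 0 (even) and 1 (odd).\<close>

definition homog :: "('r, 'b, 'c) superalgebra_scheme \<Rightarrow> nat \<Rightarrow> 'b set" where
  "homog L i = (if i = 0 then even_part L else odd_part L)"

definition sgn_pow :: "('r, 's) ring_scheme \<Rightarrow> nat \<Rightarrow> 'r" where
  "sgn_pow R n = (\<ominus>\<^bsub>R\<^esub> \<one>\<^bsub>R\<^esub>) [^]\<^bsub>R\<^esub> n"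

locale lie_superalgebra = module R L
  for R :: "('r, 's) ring_scheme" (structure)
    and L :: "('r, 'b, 'c) superalgebra_scheme" (structure) +
  assumes even_submodule: "submodule (even_part L) R L"
    and odd_submodule: "submodule (odd_part L) R L"
    and parts_span: "even_part L <+>\<^bsub>L\<^esub> odd_part L = carrier L"
    and parts_disjoint: "even_part L \<inter> odd_part L = {\<zero>\<^bsub>L\<^esub>}"
    and bracket_closed:
      "\<lbrakk>x \<in> carrier L; y \<in> carrier L\<rbrakk> \<Longrightarrow> bracket L x y \<in> carrier L"
    and bracket_add_left:
      "\<lbrakk>x \<in> carrier L; y \<in> carrier L; z \<in> carrier L\<rbrakk> \<Longrightarrow>
        bracket L (x \<oplus>\<^bsub>L\<^esub> y) z = bracket L x z \<oplus>\<^bsub>L\<^esub> bracket L y z"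
    and bracket_add_right:
      "\<lbrakk>x \<in> carrier L; y \<in> carrier L; z \<in> carrier L\<rbrakk> \<Longrightarrow>
        bracket L x (y \<oplus>\<^bsub>L\<^esub> z) = bracket L x y \<oplus>\<^bsub>L\<^esub> bracket L x z"
    and bracket_smult_left:
      "\<lbrakk>r \<in> carrier R; x \<in> carrier L; y \<in> carrier L\<rbrakk> \<Longrightarrow>
        bracket L (r \<odot>\<^bsub>L\<^esub> x) y = r \<odot>\<^bsub>L\<^esub> bracket L x y"
    and bracket_smult_right:
      "\<lbrakk>r \<in> carrier R; x \<in> carrier L; y \<in> carrier L\<rbrakk> \<Longrightarrow>
        bracket L x (r \<odot>\<^bsub>L\<^esub> y) = r \<odot>\<^bsub>L\<^esub> bracket L x y"
    and bracket_homog: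
      "\<lbrakk>i \<in> {0, 1}; j \<in> {0, 1}; a \<in> homog L i; b \<in> homog L j\<rbrakk> \<Longrightarrow>
        bracket L a b \<in> homog L ((i + j) mod 2)"
    and super_antisym:
      "\<lbrakk>i \<in> {0, 1}; j \<in> {0, 1}; a \<in> homog L i; b \<in> homog L j\<rbrakk> \<Longrightarrow>
        bracket L b a = \<ominus>\<^bsub>L\<^esub> (sgn_pow R (i * j) \<odot>\<^bsub>L\<^esub> bracket L a b)"
    and super_jacobi:
      "\<lbrakk>i \<in> {0, 1}; j \<in> {0, 1}; k \<in> {0, 1};
        a \<in> homog L i; b \<in> homog L j; c \<in> homog L k\<rbrakk> \<Longrightarrow>
        sgn_pow R (i * k) \<odot>\<^bsub>L\<^esub> bracket L a (bracket L b c)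
        \<oplus>\<^bsub>L\<^esub> sgn_pow R (j * i) \<odot>\<^bsub>L\<^esub> bracket L b (bracket L c a)
        \<oplus>\<^bsub>L\<^esub> sgn_pow R (k * j) \<odot>\<^bsub>L\<^esub> bracket L c (bracket L a b) = \<zero>\<^bsub>L\<^esub>"
    and even_square: "a \<in> even_part L \<Longrightarrow> bracket L a a = \<zero>\<^bsub>L\<^esub>"
    and odd_cube: "a \<in> odd_part L \<Longrightarrow> bracket L (bracket L a a) a = \<zero>\<^bsub>L\<^esub>"

definition lie_superalgebra_hom ::
  "('r, 's) ring_scheme \<Rightarrow> ('r, 'b, 'c) superalgebra_scheme \<Rightarrow> ('r, 'm, 'd) superalgebra_scheme
    \<Rightarrow> ('b \<Rightarrow> 'm) set" where
  "lie_superalgebra_hom R L M = {\<phi> \<in> carrier L \<rightarrow> carrier M.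
     (\<forall>x\<in>carrier L. \<forall>y\<in>carrier L. \<phi> (x \<oplus>\<^bsub>L\<^esub> y) = \<phi> x \<oplus>\<^bsub>M\<^esub> \<phi> y) \<and>
     (\<forall>r\<in>carrier R. \<forall>x\<in>carrier L. \<phi> (r \<odot>\<^bsub>L\<^esub> x) = r \<odot>\<^bsub>M\<^esub> \<phi> x) \<and>
     (\<forall>x\<in>carrier L. \<forall>y\<in>carrier L. \<phi> (bracket L x y) = bracket M (\<phi> x) (\<phi> y)) \<and>
     \<phi> ` even_part L \<subseteq> even_part M \<and> \<phi> ` odd_part L \<subseteq> odd_part M}"


section \<open>Bracketed expressions and freeness\<close>

datatype 'a brexp = Gen 'a | Br "'a brexp" "'a brexp"

primrec weight :: "'a brexp \<Rightarrow> nat" where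
  "weight (Gen a) = 1"
| "weight (Br s t) = weight s + weight t"

primrec parity :: "('a \<Rightarrow> nat) \<Rightarrow> 'a brexp \<Rightarrow> nat" where
  "parity p (Gen a) = p a"
| "parity p (Br s t) = (parity p s + parity p t) mod 2"

primrec eval_in :: "('r, 'b, 'c) superalgebra_scheme \<Rightarrow> 'b brexp \<Rightarrow> 'b" where
  "eval_in L (Gen a) = a"
| "eval_in L (Br s t) = bracket L (eval_in L s) (eval_in L t)"

text \<open>
  The universal property of \<open>L\<close> on the set \<open>A\<close>, where \<open>p\<close> prescribes the degrees of the
  generators, against all target superalgebras whose carrier is a subset of the type \<open>'m\<close>.
  Homomorphisms are compared on \<open>carrier L\<close> only, hence \<open>extensional\<close>.
\<close>

definition universal_on ::
  "'m itself \<Rightarrow> ('r, 's) ring_scheme \<Rightarrow> ('r, 'b, 'c) superalgebra_scheme \<Rightarrow> 'b set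
    \<Rightarrow> ('b \<Rightarrow> nat) \<Rightarrow> bool" where
  "universal_on _ R L A p \<longleftrightarrow>
     (\<forall>(M :: ('r, 'm) superalgebra) f.
        lie_superalgebra R M \<and> (\<forall>a\<in>A. f a \<in> homog M (p a)) \<longrightarrow>
        (\<exists>!\<phi>. \<phi> \<in> lie_superalgebra_hom R L M \<and> \<phi> \<in> extensional (carrier L) \<and>
              (\<forall>a\<in>A. \<phi> a = f a)))"

text \<open>
  HOL cannot quantify over the types of the targets inside a formula. Testing against the single
  type of functions from bracketed expressions to \<open>'r\<close> is equivalent to testing against every
  type. If \<open>R\<close> is trivial, all modules are singletons. Otherwise:

  \<^item> A Lie superalgebra \<open>M\<close> of any type that is generated by the values of some \<open>f\<close> on \<open>A\<close> is
    isomorphic to one carried by a set of such functions: its elements are linear combinations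
    of evaluated bracketed expressions in \<open>A\<close>, and choosing the coefficients of one such
    combination for each element is injective. A target \<open>M\<close> not so generated can be replaced by
    the subalgebra generated by the values of \<open>f\<close>, which gives existence for every \<open>M\<close>.

  \<^item> \<open>L\<close> itself is isomorphic to one carried by such a set, since \<open>'b\<close> injects into the function
    type via indicator functions of \<open>Gen x\<close>. Uniqueness for the target \<open>L\<close>, with existence for
    the subalgebra generated by \<open>A\<close>, shows that \<open>A\<close> generates \<open>L\<close>, so homomorphisms from \<open>L\<close>
    to any \<open>M\<close> are determined by their values on \<open>A\<close>.
\<close>

definition freely_generated ::
  "('r, 's) ring_scheme \<Rightarrow> ('r, 'b, 'c) superalgebra_scheme \<Rightarrow> 'b set \<Rightarrow> ('b \<Rightarrow> nat) \<Rightarrow> bool"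
  where
  "freely_generated R L A p \<longleftrightarrow>
     lie_superalgebra R L \<and> p \<in> A \<rightarrow> {0, 1} \<and> (\<forall>a\<in>A. a \<in> homog L (p a)) \<and>
     universal_on TYPE('b brexp \<Rightarrow> 'r) R L A p"


section \<open>Basic commutators\<close>

definition strict_total_order_on :: "'a set \<Rightarrow> ('a \<Rightarrow> 'a \<Rightarrow> bool) \<Rightarrow> bool" where
  "strict_total_order_on S lt \<longleftrightarrow> irreflp_on S lt \<and> transp_on S lt \<and> totalp_on S lt"

text \<open>
  The simultaneous recursive choice of the basic commutators of each weight and of their order is
  encoded by taking a relation \<open>lt\<close> on all expressions as a parameter: whether an expression of
  weight \<open>k\<close> is basic depends on \<open>lt\<close> only through basic commutators of weight below \<open>k\<close>.
  The conditions on \<open>lt\<close> are imposed afterwards, in \<open>complete_basic_set\<close>.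
\<close>

inductive_set basic_commutators :: "'a set \<Rightarrow> ('a brexp \<Rightarrow> 'a brexp \<Rightarrow> bool) \<Rightarrow> 'a brexp set"
  for A :: "'a set" and lt :: "'a brexp \<Rightarrow> 'a brexp \<Rightarrow> bool" where
  weight_one: "a \<in> A \<Longrightarrow> Gen a \<in> basic_commutators A lt"
| weight_two: "\<lbrakk>a \<in> A; b \<in> A; lt (Gen b) (Gen a)\<rbrakk> \<Longrightarrow>
    Br (Gen a) (Gen b) \<in> basic_commutators A lt"
| weight_three: "\<lbrakk>a \<in> A; b \<in> A; c \<in> A; lt (Gen b) (Gen a); lt (Gen b) (Gen c) \<or> b = c\<rbrakk> \<Longrightarrow>
    Br (Br (Gen a) (Gen b)) (Gen c) \<in> basic_commutators A lt"
| weight_more: "\<lbrakk>c \<in> basic_commutators A lt; d \<in> basic_commutators A lt;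
    weight c + weight d > 3; lt d c; \<forall>e f. c = Br e f \<longrightarrow> lt f d \<or> f = d\<rbrakk> \<Longrightarrow>
    Br c d \<in> basic_commutators A lt"

definition complete_basic_set ::
  "'a set \<Rightarrow> ('a \<Rightarrow> 'a \<Rightarrow> bool) \<Rightarrow> 'a brexp set \<Rightarrow> ('a brexp \<Rightarrow> 'a brexp \<Rightarrow> bool) \<Rightarrow> bool" where
  "complete_basic_set A ltA C lt \<longleftrightarrow>
     C = basic_commutators A lt \<and> strict_total_order_on C lt \<and>
     (\<forall>a\<in>A. \<forall>b\<in>A. lt (Gen a) (Gen b) \<longleftrightarrow> ltA a b) \<and>
     (\<forall>c\<in>C. \<forall>d\<in>C. weight c < weight d \<longrightarrow> lt c d)"


section \<open>Bases of modules\<close>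

text \<open>
  Bases are indexed families, so distinct indices count as distinct basis elements; over a
  nontrivial ring this forces the family to be injective.
\<close>

definition basis_family ::
  "('r, 's) ring_scheme \<Rightarrow> ('r, 'b, 'c) superalgebra_scheme \<Rightarrow> 'i set \<Rightarrow> ('i \<Rightarrow> 'b) \<Rightarrow> bool" where
  "basis_family R M I v \<longleftrightarrow>
     module R M \<and> v \<in> I \<rightarrow> carrier M \<and>
     (\<forall>F c. finite F \<and> F \<subseteq> I \<and> c \<in> F \<rightarrow> carrier R \<and>
        (\<Oplus>\<^bsub>M\<^esub>i\<in>F. c i \<odot>\<^bsub>M\<^esub> v i) = \<zero>\<^bsub>M\<^esub> \<longrightarrow> (\<forall>i\<in>F. c i = \<zero>\<^bsub>R\<^esub>)) \<and>
     (\<forall>x\<in>carrier M. \<exists>F c. finite F \<and> F \<subseteq> I \<and> c \<in> F \<rightarrow> carrier R \<and>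
        x = (\<Oplus>\<^bsub>M\<^esub>i\<in>F. c i \<odot>\<^bsub>M\<^esub> v i))"

end

theory Submission
  imports Defs
begin

text \<open>
  Write \<open>B\<close> for the family of the theorem: the basic commutators together with the squares
  \<open>[w, w]\<close> of the odd ones.

  \<^emph>\<open>Spanning.\<close> The span of \<open>B\<close> is closed under brackets. Indeed, if \<open>[c, d]\<close> with \<open>c > d\<close> is not
  basic, then \<open>c = [e, f]\<close> with \<open>e > f > d\<close>, and the Jacobi identity rewrites \<open>[c, d]\<close> in terms of
  \<open>[[e, d], f]\<close> and \<open>[e, [f, d]]\<close>. The inner brackets have smaller weight and straighten to elements
  beyond \<open>d\<close>, so the outer brackets have the same weight as before but both factors beyond \<open>d\<close>. As
  only finitely many basic commutators of bounded weight use the letters at hand, this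
  terminates. Squares appear when two factors coincide; since \<open>[u, [w, w]]\<close> is an integer multiple of
  \<open>[[u, w], w]\<close>, they obey the same recursion. This is \<open>bracket_basis\<close>. The span of \<open>B\<close> in \<open>L\<close> is
  therefore a subalgebra containing the generators, hence all of \<open>L\<close> by the uniqueness part of the
  universal property (\<open>free_spanned\<close>).

  \<^emph>\<open>Independence.\<close> The free associative algebra over \<open>R\<close> cannot detect \<open>[w, w] = 2 w\<^sup>2\<close> when 2 is not
  cancellable in \<open>R\<close>, so independence is first shown over the integers. Inside the
  noncommutative power series with real coefficients, products of increasing sequences of basic
  commutators span all words (\<open>straighten_product\<close>), and every such sequence arises by
  factorizing a word (\<open>factorize_incr\<close>). Over finitely many letters and in bounded length there are
  thus no more products than words, so the products are linearly independent
  (\<open>product_notin_span\<close>). Up to the factors 2 the family \<open>B\<close> is a part of them; so \<open>B\<close> is a basis of the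
  Lie superring that it spans (\<open>integral_basis\<close>).

  The structure constants of that ring are integers, and the free \<open>R\<close>-module on \<open>B\<close> with these
  structure constants is again a Lie superalgebra: multilinear identities only have to be checked
  on basis elements, where they hold over the integers already, and the quadratic and the cubic
  identity reduce to multilinear ones by polarization. The universal property maps \<open>L\<close> to this
  algebra, sending each element of \<open>B\<close> to the corresponding basis vector (\<open>free_independent\<close>).

  The universal property only speaks about targets carried by functions from bracketed expressions
  to \<open>R\<close>. The extended algebra is of this form by construction; \<open>L\<close> and its subalgebras are moved
  there along an injection of \<open>L\<close> into these functions.
\<close>

section \<open>Spans in Lie superalgebras\<close>

inductive_set lspan :: "('r, 's) ring_scheme \<Rightarrow> ('r, 'b, 'c) module_scheme \<Rightarrow> 'b set \<Rightarrow> 'b set"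
  for R and M and Y where
  zero: "\<zero>\<^bsub>M\<^esub> \<in> lspan R M Y"
| base: "x \<in> Y \<Longrightarrow> x \<in> lspan R M Y"
| add: "\<lbrakk>x \<in> lspan R M Y; y \<in> lspan R M Y\<rbrakk> \<Longrightarrow> x \<oplus>\<^bsub>M\<^esub> y \<in> lspan R M Y"
| smult: "\<lbrakk>r \<in> carrier R; x \<in> lspan R M Y\<rbrakk> \<Longrightarrow> r \<odot>\<^bsub>M\<^esub> x \<in> lspan R M Y"

lemma lspan_mono: assumes "Y \<subseteq> Z" shows "lspan R M Y \<subseteq> lspan R M Z"
proof
  fix x assume "x \<in> lspan R M Y"
  then show "x \<in> lspan R M Z" using assms by induction (auto intro: lspan.intros)
qed

context module begin

lemma lspan_closed: assumes "Y \<subseteq> carrier M" shows "lspan R M Y \<subseteq> carrier M"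
proof
  fix x assume "x \<in> lspan R M Y"
  then show "x \<in> carrier M" using assms by induction auto
qed

lemma lspan_submodule: assumes "Y \<subseteq> carrier M" shows "submodule (lspan R M Y) R M"
proof (rule submoduleI)
  show "lspan R M Y \<subseteq> carrier M" by (rule lspan_closed[OF assms])
  fix a assume a: "a \<in> lspan R M Y"
  then have "a \<in> carrier M" using lspan_closed[OF assms] by auto
  then have "\<ominus>\<^bsub>M\<^esub> a = (\<ominus> \<one>) \<odot>\<^bsub>M\<^esub> a" by (simp add: smult_l_minus)
  then show "\<ominus>\<^bsub>M\<^esub> a \<in> lspan R M Y" using a by (auto intro: lspan.smult)
qed (auto intro: lspan.intros)

end

context lie_superalgebra begin

lemma sgn_pow_cases: "sgn_pow R n = \<one> \<or> sgn_pow R n = \<ominus> \<one>"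
  by (induction n) (auto simp: sgn_pow_def R.l_minus)

lemma sgn_pow_closed [simp]: "sgn_pow R n \<in> carrier R"
  by (simp add: sgn_pow_def)

lemma sgn_pow_sq: "sgn_pow R n \<otimes> sgn_pow R n = \<one>"
  using sgn_pow_cases[of n] by (auto simp: R.l_minus R.r_minus)

lemma sgn_pow_smult_twice: "x \<in> carrier L \<Longrightarrow> sgn_pow R n \<odot>\<^bsub>L\<^esub> (sgn_pow R n \<odot>\<^bsub>L\<^esub> x) = x"
  by (metis sgn_pow_closed sgn_pow_sq smult_assoc1 smult_one)

lemma homog_submodule: "submodule (homog L i) R L"
  by (simp add: homog_def even_submodule odd_submodule)

lemma homog_carrier: "homog L i \<subseteq> carrier L"
  by (rule submoduleE(1)[OF homog_submodule])

lemma bracket_zero [simp]: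
  assumes "x \<in> carrier L"
  shows "bracket L \<zero>\<^bsub>L\<^esub> x = \<zero>\<^bsub>L\<^esub>" "bracket L x \<zero>\<^bsub>L\<^esub> = \<zero>\<^bsub>L\<^esub>"
  using bracket_smult_left[OF R.zero_closed assms assms] bracket_smult_right[OF R.zero_closed assms assms]
    bracket_closed[OF assms assms] assms by auto

text \<open>
  Brackets of spans land in any submodule that contains the brackets of the spanning elements;
  every closure statement below is reduced to basis elements in this way.
\<close>

lemma bracket_lspan:
  assumes "x \<in> lspan R L Y" "y \<in> lspan R L Z" "Y \<subseteq> carrier L" "Z \<subseteq> carrier L" "submodule T R L"
    and "\<And>x y. \<lbrakk>x \<in> Y; y \<in> Z\<rbrakk> \<Longrightarrow> bracket L x y \<in> T"
  shows "bracket L x y \<in> T"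
proof -
  note T = submoduleE[OF assms(5)]
  have T0: "\<zero>\<^bsub>L\<^esub> \<in> T"
    using subgroup.one_closed[OF submodule.axioms(1)[OF assms(5)]] by simp
  have Y: "lspan R L Y \<subseteq> carrier L" and Z: "lspan R L Z \<subseteq> carrier L"
    using assms(3,4) lspan_closed by auto
  have 1: "bracket L x y \<in> T" if "x \<in> Y" for x
    using assms(2)
  proof (induction y)
    case (base y)
    then show ?case using that assms(6) by blast
  qed (use T T0 that assms(3) Z in
      \<open>auto simp: bracket_add_right bracket_smult_right subset_iff\<close>)
  show ?thesis using assms(1)
  proof (induction x)
    case (base x)
    then show ?case using 1 by blast
  qed (use T T0 Y Z assms(2) in \<open>auto simp: bracket_add_left bracket_smult_left subset_iff\<close>)
qed

lemma bracket_swap_mem: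
  assumes "submodule T R L" "i \<in> {0, 1}" "j \<in> {0, 1}" "a \<in> homog L i" "b \<in> homog L j"
    and "bracket L a b \<in> T"
  shows "bracket L b a \<in> T"
  unfolding super_antisym[OF assms(2-5)]
  using submoduleE[OF assms(1)] assms(6) by auto

text \<open>
  The coefficients of the Jacobi identity are units, so two of its terms control the third. Stating
  this for membership in a submodule makes the signs disappear from the straightening argument.
\<close>

lemma jacobi_mem:
  assumes T: "submodule T R L" and h: "i \<in> {0, 1}" "j \<in> {0, 1}" "k \<in> {0, 1}"
    "a \<in> homog L i" "b \<in> homog L j" "c \<in> homog L k"
    and "bracket L b (bracket L c a) \<in> T" "bracket L c (bracket L a b) \<in> T"
  shows "bracket L a (bracket L b c) \<in> T"
proof -
  note TE = submoduleE[OF T]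
  have car: "a \<in> carrier L" "b \<in> carrier L" "c \<in> carrier L"
    using h homog_carrier by auto
  let ?x = "bracket L a (bracket L b c)"
  let ?y = "sgn_pow R (j * i) \<odot>\<^bsub>L\<^esub> bracket L b (bracket L c a)"
  let ?z = "sgn_pow R (k * j) \<odot>\<^bsub>L\<^esub> bracket L c (bracket L a b)"
  have c: "?x \<in> carrier L" "?y \<in> carrier L" "?z \<in> carrier L"
    using car by (auto intro!: bracket_closed)
  have "sgn_pow R (i * k) \<odot>\<^bsub>L\<^esub> ?x \<oplus>\<^bsub>L\<^esub> ?y \<oplus>\<^bsub>L\<^esub> ?z = \<zero>\<^bsub>L\<^esub>"
    by (rule super_jacobi[OF h])
  then have "sgn_pow R (i * k) \<odot>\<^bsub>L\<^esub> ?x = \<ominus>\<^bsub>L\<^esub> (?y \<oplus>\<^bsub>L\<^esub> ?z)"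
    using c by (simp add: M.a_assoc M.minus_equality)
  moreover have "?y \<in> T" "?z \<in> T" using assms(8,9) TE by auto
  ultimately have "sgn_pow R (i * k) \<odot>\<^bsub>L\<^esub> ?x \<in> T" using TE by auto
  then have "sgn_pow R (i * k) \<odot>\<^bsub>L\<^esub> (sgn_pow R (i * k) \<odot>\<^bsub>L\<^esub> ?x) \<in> T" using TE by auto
  then show ?thesis using c sgn_pow_smult_twice by simp
qed

end

section \<open>Hall sets\<close>

text \<open>
  The properties of a complete set of basic commutators that matter. Weights two and three need no
  separate clauses: for a right factor \<open>f\<close> of \<open>c\<close>, the condition \<open>f \<le> d\<close> specializes to the one in
  weight three, and \<open>lt_weight\<close> supplies the inequality between factors of different weight.
\<close>

locale hall_set =
  fixes A :: "'a set" and C :: "'a brexp set" and lt :: "'a brexp \<Rightarrow> 'a brexp \<Rightarrow> bool"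
  assumes Gen_iff: "Gen a \<in> C \<longleftrightarrow> a \<in> A"
    and Br_iff: "Br c d \<in> C \<longleftrightarrow>
      c \<in> C \<and> d \<in> C \<and> lt d c \<and> (\<forall>e f. c = Br e f \<longrightarrow> lt f d \<or> f = d)"
    and lt_irrefl: "c \<in> C \<Longrightarrow> \<not> lt c c"
    and lt_trans: "\<lbrakk>c \<in> C; d \<in> C; e \<in> C; lt c d; lt d e\<rbrakk> \<Longrightarrow> lt c e"
    and lt_total: "\<lbrakk>c \<in> C; d \<in> C\<rbrakk> \<Longrightarrow> lt c d \<or> c = d \<or> lt d c"
    and lt_weight: "\<lbrakk>c \<in> C; d \<in> C; weight c < weight d\<rbrakk> \<Longrightarrow> lt c d"
begin

text \<open>
  Counting and descending induction both require finitely many letters. Since any finite set of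
  expressions involves only finitely many, it is enough that Hall sets restrict to sub-alphabets.
\<close>

lemma hall_restrict: "hall_set (A \<inter> S) {c \<in> C. set_brexp c \<subseteq> S} lt"
proof unfold_locales
  let ?C = "{c \<in> C. set_brexp c \<subseteq> S}"
  show "Gen a \<in> ?C \<longleftrightarrow> a \<in> A \<inter> S" for a by (auto simp: Gen_iff)
  show "Br c d \<in> ?C \<longleftrightarrow> c \<in> ?C \<and> d \<in> ?C \<and> lt d c \<and> (\<forall>e f. c = Br e f \<longrightarrow> lt f d \<or> f = d)" for c d
    by (auto simp: Br_iff[of c d])
  show "lt c e" if "c \<in> ?C" "d \<in> ?C" "e \<in> ?C" "lt c d" "lt d e" for c d e
    using that lt_trans[of c d e] by blast
qed (use lt_irrefl lt_total lt_weight in auto)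

lemma Br_self_notin: "Br w w \<notin> C"
  using Br_iff lt_irrefl by blast

lemma set_brexp_subset: "c \<in> C \<Longrightarrow> set_brexp c \<subseteq> A"
proof (induction c)
  case (Br c d)
  then show ?case using Br_iff[of c d] by auto
qed (simp add: Gen_iff)

end

definition basis_exps :: "'a brexp set \<Rightarrow> ('a \<Rightarrow> nat) \<Rightarrow> 'a brexp set" where
  "basis_exps C p = C \<union> {Br w w | w. w \<in> C \<and> parity p w = 1}"

lemma basis_exps_mono: "C \<subseteq> D \<Longrightarrow> basis_exps C p \<subseteq> basis_exps D p"
  unfolding basis_exps_def by blast

lemma basis_exps_restrict:
  "\<lbrakk>b \<in> basis_exps C p; set_brexp b \<subseteq> S\<rbrakk> \<Longrightarrow> b \<in> basis_exps {c \<in> C. set_brexp c \<subseteq> S} p"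
  unfolding basis_exps_def by auto

lemma weight_pos: "weight t > 0"
  by (induction t) auto

lemma weight_eq_1_iff: "weight t = 1 \<longleftrightarrow> (\<exists>a. t = Gen a)"
proof (cases t)
  case (Br u v)
  then show ?thesis using weight_pos[of u] weight_pos[of v] by simp
qed simp

lemma finite_bounded_brexps:
  assumes "finite S"
  shows "finite {t. set_brexp t \<subseteq> S \<and> weight t \<le> n}"
proof (induction n)
  case 0
  have "weight t \<noteq> 0" for t :: "'a brexp" using weight_pos[of t] by (rule gr_implies_not0)
  then show ?case by (simp del: neq0_conv)
next
  case (Suc n)
  let ?Y = "{t. set_brexp t \<subseteq> S \<and> weight t \<le> n}"
  have "t \<in> Gen ` S \<union> (\<lambda>(s, t). Br s t) ` (?Y \<times> ?Y)"
    if t: "set_brexp t \<subseteq> S" "weight t \<le> Suc n" for t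
  proof (cases t)
    case (Gen a)
    then show ?thesis using t by simp
  next
    case (Br u v)
    then have "u \<in> ?Y" "v \<in> ?Y"
      using t weight_pos[of u] weight_pos[of v] by simp_all
    then have "(\<lambda>(s, t). Br s t) (u, v) \<in> (\<lambda>(s, t). Br s t) ` (?Y \<times> ?Y)" by blast
    then show ?thesis using Br by simp
  qed
  then have "{t. set_brexp t \<subseteq> S \<and> weight t \<le> Suc n} \<subseteq> Gen ` S \<union> (\<lambda>(s, t). Br s t) ` (?Y \<times> ?Y)"
    by blast
  then show ?case by (rule finite_subset) (simp add: Suc assms)
qed

text \<open>
  A square \<open>[w, w]\<close> is not a basic commutator, so it has no place in the order; in the straightening
  process it takes the place of \<open>w\<close>.
\<close>

fun root :: "'a brexp \<Rightarrow> 'a brexp" where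
  "root (Br s t) = (if s = t then s else Br s t)"
| "root (Gen a) = Gen a"

lemma weight_root: "weight (root t) \<le> weight t"
  by (cases t) auto

lemma complete_basic_set_imp_hall_set:
  assumes "complete_basic_set A ltA C lt"
  shows "hall_set A C lt"
proof -
  have C: "C = basic_commutators A lt"
    and ord: "irreflp_on C lt" "transp_on C lt" "totalp_on C lt"
    and wt: "\<And>c d. \<lbrakk>c \<in> C; d \<in> C; weight c < weight d\<rbrakk> \<Longrightarrow> lt c d"
    using assms unfolding complete_basic_set_def strict_total_order_on_def by blast+
  have irr: "\<not> lt c c" if "c \<in> C" for c
    using ord(1) that by (auto dest: irreflp_onD)
  have tr: "lt c e" if "c \<in> C" "d \<in> C" "e \<in> C" "lt c d" "lt d e" for c d e
    using ord(2) that by (blast dest: transp_onD)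
  have tot: "lt c d \<or> c = d \<or> lt d c" if "c \<in> C" "d \<in> C" for c d
    using ord(3) that by (auto dest: totalp_onD)
  have gen: "Gen a \<in> C \<longleftrightarrow> a \<in> A" for a
  proof
    show "a \<in> A" if "Gen a \<in> C" using that[unfolded C] by cases
  qed (simp add: C basic_commutators.weight_one)
  have br1: "c \<in> C \<and> d \<in> C \<and> lt d c \<and> (\<forall>e f. c = Br e f \<longrightarrow> lt f d \<or> f = d)"
    if "Br c d \<in> C" for c d
    using that[unfolded C]
  proof cases
    case (weight_two a b)
    then show ?thesis using gen by simp
  next
    case (weight_three a b x)
    then have "Br (Gen a) (Gen b) \<in> C" "Gen x \<in> C"
      unfolding C by (simp_all add: basic_commutators.weight_one basic_commutators.weight_two)
    moreover from wt[OF this(2,1)] have "lt (Gen x) (Br (Gen a) (Gen b))" by simp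
    ultimately show ?thesis using weight_three by auto
  next
    case weight_more
    then show ?thesis unfolding C by blast
  qed
  have br2: "Br c d \<in> C"
    if *: "c \<in> C" "d \<in> C" "lt d c" "\<forall>e f. c = Br e f \<longrightarrow> lt f d \<or> f = d" for c d
  proof (cases "weight c + weight d > 3")
    case True
    then show ?thesis using * unfolding C by (auto intro: basic_commutators.weight_more)
  next
    case False
    have le: "weight d \<le> weight c"
      using *(1-3) irr tr wt by (meson leI)
    with False weight_pos[of d] have d1: "weight d = 1" and c2: "weight c \<le> 2" by linarith+
    obtain b where d: "d = Gen b" "b \<in> A"
      using d1 *(2) gen unfolding weight_eq_1_iff by auto
    show ?thesis
    proof (cases c)
      case (Gen a)
      then show ?thesis using * d gen unfolding C by (auto intro: basic_commutators.weight_two)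
    next
      case (Br x y)
      with c2 weight_pos[of x] weight_pos[of y] have "weight x = 1" "weight y = 1" by auto
      then obtain a a' where "x = Gen a" "y = Gen a'"
        unfolding weight_eq_1_iff by auto
      then show ?thesis using * d gen Br br1[of x y] unfolding C
        by (auto intro!: basic_commutators.weight_three)
    qed
  qed
  show ?thesis
  proof unfold_locales
    show "Br c d \<in> C \<longleftrightarrow> c \<in> C \<and> d \<in> C \<and> lt d c \<and> (\<forall>e f. c = Br e f \<longrightarrow> lt f d \<or> f = d)" for c d
      using br1[of c d] br2[of c d] by argo
  qed (fact gen irr tr tot wt)+
qed

text \<open>
  Evaluation with generators as indeterminates, so that the same expression can be evaluated in
  \<open>L\<close>, in power series and in the algebra obtained by extension of scalars.
\<close>

primrec eval_at :: "('r, 'b, 'c) superalgebra_scheme \<Rightarrow> ('a \<Rightarrow> 'b) \<Rightarrow> 'a brexp \<Rightarrow> 'b" where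
  "eval_at L f (Gen a) = f a"
| "eval_at L f (Br s t) = bracket L (eval_at L f s) (eval_at L f t)"

lemma eval_at_id: "eval_at L (\<lambda>a. a) t = eval_in L t"
  by (induction t) auto

locale graded_generators = lie_superalgebra R L
  for R :: "('r, 's) ring_scheme" (structure)
    and L :: "('r, 'b, 'c) superalgebra_scheme" (structure) +
  fixes A :: "'a set" and p :: "'a \<Rightarrow> nat" and f :: "'a \<Rightarrow> 'b"
  assumes p_deg: "p \<in> A \<rightarrow> {0, 1}"
    and f_homog: "a \<in> A \<Longrightarrow> f a \<in> homog L (p a)"
begin

lemma parity_deg: "set_brexp t \<subseteq> A \<Longrightarrow> parity p t \<in> {0, 1}"
proof (cases t)
  case (Gen a)
  assume "set_brexp t \<subseteq> A"
  then show ?thesis using p_deg Gen by auto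
qed auto

lemma eval_homog: "set_brexp t \<subseteq> A \<Longrightarrow> eval_at L f t \<in> homog L (parity p t)"
proof (induction t)
  case (Br s t)
  then show ?case using bracket_homog[OF parity_deg parity_deg, of s t] by simp
qed (auto simp: f_homog)

lemma eval_closed: "set_brexp t \<subseteq> A \<Longrightarrow> eval_at L f t \<in> carrier L"
  using eval_homog homog_carrier by blast

end

section \<open>Straightening brackets of basic commutators\<close>

locale finite_hall_generators = graded_generators R L A p f + hall_set A C lt
  for R :: "('r, 's) ring_scheme" (structure)
    and L :: "('r, 'b, 'c) superalgebra_scheme" (structure)
    and A :: "'a set" and p f C lt +
  assumes finite_A: "finite A"
begin

abbreviation "B \<equiv> basis_exps C p"
abbreviation "ev \<equiv> eval_at L f"

lemma root_id: "c \<in> C \<Longrightarrow> root c = c"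
  using Br_self_notin by (cases c) force+

lemma B_cases:
  assumes "b \<in> B"
  obtains (basic) "b \<in> C" "root b = b" | (square) w where "b = Br w w" "w \<in> C" "parity p w = 1" "root b = w"
  using assms root_id unfolding basis_exps_def by fastforce

lemma B_letters: "b \<in> B \<Longrightarrow> set_brexp b \<subseteq> A"
  by (erule B_cases) (use set_brexp_subset in force)+

lemma C_in_B: "c \<in> C \<Longrightarrow> c \<in> B" by (simp add: basis_exps_def)

lemma root_C: "b \<in> B \<Longrightarrow> root b \<in> C" 
  by (erule B_cases) auto

lemma ev_B_closed: "b \<in> B \<Longrightarrow> ev b \<in> carrier L"
  by (simp add: B_letters eval_closed)

text \<open>
  The index sets record the total weight and a strict or weak lower bound on the roots. The
  strict bound is what drives the descending induction on \<open>d\<close>.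
\<close>

definition above :: "nat \<Rightarrow> 'a brexp \<Rightarrow> 'a brexp set" where
  "above n d = {g \<in> B. weight g = n \<and> lt d (root g)}"

definition above_eq :: "nat \<Rightarrow> 'a brexp \<Rightarrow> 'a brexp set" where
  "above_eq n d = {g \<in> B. weight g = n \<and> (lt d (root g) \<or> root g = d)}"

abbreviation "U n d \<equiv> lspan R L (ev ` above n d)"
abbreviation "V n d \<equiv> lspan R L (ev ` above_eq n d)"

lemma above_sub: "ev ` above n d \<subseteq> carrier L" and above_eq_sub: "ev ` above_eq n d \<subseteq> carrier L"
  using ev_B_closed by (auto simp: above_def above_eq_def)

lemmas U_submodule = lspan_submodule[OF above_sub]
lemmas V_submodule = lspan_submodule[OF above_eq_sub]

lemma U_le_V: "U n d \<subseteq> V n d"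
  by (rule lspan_mono) (auto simp: above_def above_eq_def)

lemma V_le_U: "\<lbrakk>c \<in> C; d \<in> C; lt c d\<rbrakk> \<Longrightarrow> V n d \<subseteq> U n c"
  by (rule lspan_mono) (auto simp: above_def above_eq_def dest: root_C intro: lt_trans)

lemma ev_swap:
  assumes "submodule T R L" "u \<in> B" "v \<in> B" "bracket L (ev u) (ev v) \<in> T"
  shows "bracket L (ev v) (ev u) \<in> T"
  using bracket_swap_mem[OF assms(1) parity_deg parity_deg eval_homog eval_homog assms(4)]
    assms(2,3) B_letters by blast

lemma ev_jacobi:
  assumes "submodule T R L" "a \<in> B" "b \<in> B" "c \<in> B"
    "bracket L (ev b) (bracket L (ev c) (ev a)) \<in> T" "bracket L (ev c) (bracket L (ev a) (ev b)) \<in> T"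
  shows "bracket L (ev a) (bracket L (ev b) (ev c)) \<in> T"
  using jacobi_mem[OF assms(1) parity_deg parity_deg parity_deg eval_homog eval_homog eval_homog assms(5,6)]
    assms(2-4) B_letters by blast

lemma ev_odd: "\<lbrakk>w \<in> C; parity p w = 1\<rbrakk> \<Longrightarrow> ev w \<in> odd_part L"
  using eval_homog[OF set_brexp_subset, of w] by (simp add: homog_def)

lemma ev_square_even: "\<lbrakk>w \<in> C; parity p w = 1\<rbrakk> \<Longrightarrow> ev (Br w w) \<in> even_part L"
  using eval_homog[of "Br w w"] set_brexp_subset[of w] by (simp add: homog_def)

lemma cube_zero:
  assumes "w \<in> C" "parity p w = 1" 
  shows "bracket L (bracket L (ev w) (ev w)) (ev w) = \<zero>\<^bsub>L\<^esub>" 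
  by (rule odd_cube[OF ev_odd[OF assms]])

lemma root_above: "\<lbrakk>g \<in> above n d\<rbrakk> \<Longrightarrow> g \<in> B \<and> weight g = n \<and> lt d (root g) \<and> root g \<in> C"
  using root_C by (simp add: above_def)

text \<open>
  The induction hypothesis. It says more than that the bracket lies in the span of the
  basis: brackets with \<open>d\<close> stay beyond \<open>d\<close>, which allows them to be bracketed again.
\<close>

definition straightens :: "nat \<Rightarrow> 'a brexp \<Rightarrow> bool" where
  "straightens n d \<longleftrightarrow> (\<forall>u\<in>B. weight u + weight d = n \<longrightarrow> lt d (root u) \<longrightarrow>
     bracket L (ev u) (ev d) \<in> U n d)"

lemma straightensD:
  "\<lbrakk>straightens n d; u \<in> B; weight u + weight d = n; lt d (root u)\<rbrakk> \<Longrightarrow>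
    bracket L (ev u) (ev d) \<in> U n d"
  by (simp add: straightens_def)

lemma bracket_U_mem:
  assumes "submodule T R L" "v \<in> B" "x \<in> U m d"
    and "\<And>g. g \<in> above m d \<Longrightarrow> bracket L (ev v) (ev g) \<in> T"
  shows "bracket L (ev v) x \<in> T"
proof (rule bracket_lspan[of _ "{ev v}", OF _ assms(3) _ above_sub assms(1)])
  show "ev v \<in> lspan R L {ev v}" by (simp add: lspan.base)
  show "{ev v} \<subseteq> carrier L" using ev_B_closed[OF assms(2)] by simp
  fix x y assume "x \<in> {ev v}" "y \<in> ev ` above m d"
  then show "bracket L x y \<in> T" using assms(4) by blast
qed

lemma bracket_straightened:
  assumes "straightens n d" "d \<in> C" "m + weight d = n" "x \<in> U m d"
  shows "bracket L (ev d) x \<in> U n d"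
proof (rule bracket_U_mem[OF U_submodule C_in_B[OF assms(2)] assms(4)])
  fix g assume g: "g \<in> above m d"
  then have "bracket L (ev g) (ev d) \<in> U n d"
    by (intro straightensD[OF assms(1)]) (use assms(3) root_above in auto)
  then show "bracket L (ev d) (ev g) \<in> U n d"
    by (rule ev_swap[OF U_submodule _ C_in_B[OF assms(2)], rotated]) (use g root_above in blast)
qed

text \<open>
  Equal roots are the source of the squares: \<open>[w, w]\<close> either vanishes or is an element of the
  family, and all brackets that involve \<open>[w, w]\<close> and \<open>w\<close> only are killed by the axioms on even
  squares and odd cubes.
\<close>

lemma bracket_same_root:
  assumes "u \<in> B" "v \<in> B" "root u = root v"
  shows "bracket L (ev u) (ev v) \<in> V (weight u + weight v) (root v)"
  using assms(1)
proof (cases rule: B_cases)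
  case u: basic
  from assms(2) show ?thesis
  proof (cases rule: B_cases)
    case v: basic
    then have uv: "u = v" using u assms(3) by simp
    show ?thesis
    proof (cases "parity p v = 1")
      case True
      then have "Br v v \<in> above_eq (weight u + weight v) (root v)"
        using v uv by (auto simp: above_eq_def basis_exps_def)
      then have "ev (Br v v) \<in> V (weight u + weight v) (root v)" by (intro lspan.base) (rule imageI)
      then show ?thesis using uv by simp
    next
      case False
      then have "ev v \<in> even_part L"
        using eval_homog[OF B_letters[OF assms(2)]] parity_deg[OF B_letters[OF assms(2)]]
        by (auto simp: homog_def)
      then show ?thesis using even_square uv by (simp add: lspan.zero)
    qed
  next
    case (square w)
    then have "bracket L (ev v) (ev u) = \<zero>\<^bsub>L\<^esub>" using cube_zero u assms(3) by simp
    then show ?thesis by (intro ev_swap[OF V_submodule assms(2,1)]) (simp add: lspan.zero)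
  qed
next
  case u: (square w)
  from assms(2) show ?thesis
  proof (cases rule: B_cases)
    case basic
    then show ?thesis using cube_zero u assms(3) by (simp add: lspan.zero)
  next
    case (square w')
    then show ?thesis using even_square[OF ev_square_even] u assms(3) by (simp add: lspan.zero)
  qed
qed

text \<open>
  If \<open>v = [w, w]\<close>, then by the Jacobi identity \<open>[u, v]\<close> is governed by \<open>[[u, w], w]\<close>, in which \<open>[u, w]\<close> has
  smaller weight than \<open>[u, v]\<close>.
\<close>

lemma bracket_above_eq:
  assumes u: "u \<in> B" and v: "v \<in> B" and n: "weight u + weight v = n"
    and lt: "lt (root v) (root u)"
    and smaller: "\<And>n'. n' < n \<Longrightarrow> straightens n' (root v)"
    and this_n: "straightens n (root v)"
  shows "bracket L (ev u) (ev v) \<in> U n (root v)"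
  using v
proof (cases rule: B_cases)
  case basic
  then show ?thesis using straightensD[OF this_n u] n lt by simp
next
  case (square w)
  have wB: "w \<in> B" using C_in_B[OF square(2)] .
  have l: "lt w (root u)" using lt square by simp
  let ?m = "weight u + weight w"
  have m: "?m < n" "?m + weight w = n" using square n weight_pos[of w] by auto
  have str: "straightens ?m w" "straightens n w" using smaller[OF m(1)] this_n square by simp_all
  have uw: "bracket L (ev u) (ev w) \<in> U ?m w" by (rule straightensD[OF str(1) u refl l])
  have wu: "bracket L (ev w) (ev u) \<in> U ?m w" by (rule ev_swap[OF U_submodule u wB uw])
  have "bracket L (ev u) (bracket L (ev w) (ev w)) \<in> U n w"
    by (rule ev_jacobi[OF U_submodule u wB wB bracket_straightened bracket_straightened])
      (fact str(2) square(2) m(2) wu uw)+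
  then show ?thesis using square by simp
qed

lemma bracket_above:
  assumes "u \<in> B" "v \<in> B" "weight u + weight v = n" "d \<in> C" "lt d (root u)" "lt d (root v)"
    and smaller: "\<And>n' d. \<lbrakk>n' < n; d \<in> C\<rbrakk> \<Longrightarrow> straightens n' d"
    and this_n: "\<And>e. \<lbrakk>e \<in> C; weight e < n; lt d e\<rbrakk> \<Longrightarrow> straightens n e"
  shows "bracket L (ev u) (ev v) \<in> U n d"
proof -
  have main: "bracket L (ev u) (ev v) \<in> U n d"
    if uv: "u \<in> B" "v \<in> B" "weight u + weight v = n" "lt d (root v)" "lt (root v) (root u)" for u v
  proof -
    have "weight (root v) < n" using weight_root[of v] uv(3) weight_pos[of u] by simp
    then have "bracket L (ev u) (ev v) \<in> U n (root v)"
      by (intro bracket_above_eq[OF uv(1-3,5)] smaller this_n root_C[OF uv(2)] uv(4))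
    then show ?thesis
      using V_le_U[OF assms(4) root_C[OF uv(2)] uv(4)] U_le_V by blast
  qed
  consider "lt (root v) (root u)" | "root u = root v" | "lt (root u) (root v)"
    using lt_total[OF root_C[OF assms(1)] root_C[OF assms(2)]] by blast
  then show ?thesis
  proof cases
    case 1
    then show ?thesis by (intro main assms)
  next
    case 2
    then have "bracket L (ev u) (ev v) \<in> V n (root v)" using bracket_same_root[OF assms(1,2)] assms(3) by simp
    then show ?thesis using V_le_U[OF assms(4) root_C[OF assms(2)] assms(6)] by blast
  next
    case 3
    then have "bracket L (ev v) (ev u) \<in> U n d"
      by (intro main assms(1,2,5)) (simp add: assms(3)[symmetric])
    then show ?thesis by (rule ev_swap[OF U_submodule assms(2,1)])
  qed
qed

text \<open>
  The heart of Hall's argument. If \<open>[u, d]\<close> is not itself basic, then \<open>u = [e, f]\<close> with both \<open>e\<close> and \<open>f\<close>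
  beyond \<open>d\<close>, also when \<open>u\<close> is a square. The Jacobi identity leads to \<open>[e, d]\<close> and \<open>[f, d]\<close>, of
  smaller weight, whose straightened forms are bracketed with \<open>f\<close> and \<open>e\<close>; there both factors lie beyond \<open>d\<close>.
\<close>

lemma straightens_step:
  assumes d: "d \<in> C"
    and smaller: "\<And>n' d. \<lbrakk>n' < n; d \<in> C\<rbrakk> \<Longrightarrow> straightens n' d"
    and this_n: "\<And>e. \<lbrakk>e \<in> C; weight e < n; lt d e\<rbrakk> \<Longrightarrow> straightens n e"
  shows "straightens n d"
  unfolding straightens_def
proof (intro ballI impI)
  fix u assume u: "u \<in> B" "weight u + weight d = n" "lt d (root u)"
  have dB: "d \<in> B" using d C_in_B by auto
  have basic_case: "bracket L (ev u) (ev d) \<in> U n d" if "Br u d \<in> C"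
  proof -
    have "lt d (Br u d)" using lt_weight[OF d that] weight_pos[of u] by simp
    then have "Br u d \<in> above n d"
      using that u root_id[OF that] C_in_B by (simp add: above_def)
    then have "ev (Br u d) \<in> U n d" by (blast intro: lspan.base)
    then show ?thesis by simp
  qed
  have split_case: "bracket L (ev u) (ev d) \<in> U n d"
    if ef: "u = Br e f" "e \<in> B" "f \<in> B" "lt d (root e)" "lt d (root f)" for e f
  proof -
    have w: "weight e + weight d < n" "weight f + weight d < n"
       "weight f + weight d + weight e = n" "weight e + weight d + weight f = n"
      using ef(1) u(2) weight_pos[of e] weight_pos[of f] by auto
    have ed: "bracket L (ev e) (ev d) \<in> U (weight e + weight d) d"
      and fd: "bracket L (ev f) (ev d) \<in> U (weight f + weight d) d"
      by (intro straightensD smaller w d ef refl)+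
    have de: "bracket L (ev d) (ev e) \<in> U (weight e + weight d) d"
      by (rule ev_swap[OF U_submodule ef(2) dB ed])
    have "bracket L (ev e) (bracket L (ev f) (ev d)) \<in> U n d"
    proof (rule bracket_U_mem[OF U_submodule ef(2) fd])
      fix g assume "g \<in> above (weight f + weight d) d"
      then show "bracket L (ev e) (ev g) \<in> U n d"
        by (intro bracket_above[OF ef(2) _ _ d ef(4) _ smaller this_n]) (use w root_above in auto)
    qed
    moreover have "bracket L (ev f) (bracket L (ev d) (ev e)) \<in> U n d"
    proof (rule bracket_U_mem[OF U_submodule ef(3) de])
      fix g assume "g \<in> above (weight e + weight d) d"
      then show "bracket L (ev f) (ev g) \<in> U n d"
        by (intro bracket_above[OF ef(3) _ _ d ef(5) _ smaller this_n]) (use w root_above in auto)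
    qed
    ultimately have "bracket L (ev d) (ev u) \<in> U n d"
      using ev_jacobi[OF U_submodule dB ef(2,3)] ef(1) by auto
    then show ?thesis using ev_swap[OF U_submodule dB u(1)] by auto
  qed
  from u(1) show "bracket L (ev u) (ev d) \<in> U n d"
  proof (cases rule: B_cases)
    case basic
    show ?thesis
    proof (cases "Br u d \<in> C")
      case True
      then show ?thesis by (rule basic_case)
    next
      case False
      then obtain e f where ef: "u = Br e f" "\<not> lt f d" "f \<noteq> d"
        using Br_iff[of u d] basic u(3) d by auto
      then have C: "e \<in> C" "f \<in> C" "lt f e" using Br_iff basic by auto
      then have "lt d f" using lt_total ef d by blast
      moreover then have "lt d e" using lt_trans d C by blast
      ultimately show ?thesis using split_case[OF ef(1)] C C_in_B root_id by auto
    qed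
  next
    case (square w)
    then show ?thesis using split_case[of w w] C_in_B root_id u by auto
  qed
qed

lemma straightens_all:
  assumes "d \<in> C"
  shows "straightens n d"
  using assms
proof (induction n arbitrary: d rule: less_induct)
  case (less n)
  \<comment> \<open>The lower factors that may still occur in total weight \<open>n\<close> after passing beyond \<open>d\<close>.\<close>
  define N where "N d = {e \<in> C. weight e < n \<and> lt d e}" for d
  have fin: "finite (N d)" for d
    by (rule finite_subset[OF _ finite_bounded_brexps[OF finite_A, of n]])
      (auto simp: N_def dest: set_brexp_subset)
  show ?case using less.prems
  proof (induction "card (N d)" arbitrary: d rule: less_induct)
    case inner: less
    show ?case
    proof (rule straightens_step[OF inner.prems])
      show "straightens n' d" if "n' < n" "d \<in> C" for n' d
        using less.IH that by blast
      show "straightens n e" if e: "e \<in> C" "weight e < n" "lt d e" for e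
      proof (rule inner.hyps[OF _ e(1)])
        have "N e \<subset> N d"
          using e inner.prems lt_irrefl lt_trans[of d e] by (auto simp: N_def)
        then show "card (N e) < card (N d)" using fin psubset_card_mono by blast
      qed
    qed
  qed
qed

lemma bracket_basis_in_span:
  assumes "u \<in> B" "v \<in> B"
  shows "bracket L (ev u) (ev v) \<in> lspan R L (ev ` B)"
proof -
  have V: "V n d \<subseteq> lspan R L (ev ` B)" for n d
    by (rule lspan_mono) (auto simp: above_eq_def)
  have main: "bracket L (ev u) (ev v) \<in> lspan R L (ev ` B)"
    if uv: "u \<in> B" "v \<in> B" "lt (root v) (root u)" for u v
    using bracket_above_eq[OF uv(1,2) refl uv(3) straightens_all straightens_all, OF root_C root_C]
      uv(2) U_le_V V by blast
  have "submodule (lspan R L (ev ` B)) R L"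
    by (rule lspan_submodule) (use ev_B_closed in auto)
  then show ?thesis
    using main[OF assms] main[OF assms(2,1)] ev_swap[OF _ assms(2,1)] bracket_same_root[OF assms] V
      lt_total[OF root_C[OF assms(1)] root_C[OF assms(2)]] by blast
qed

end

text \<open>
  The bracket of two basis elements lives over the finitely many letters occurring in them, which
  reduces arbitrary alphabets to finite ones.
\<close>

locale hall_generators = graded_generators R L A p f + hall_set A C lt
  for R :: "('r, 's) ring_scheme" (structure)
    and L :: "('r, 'b, 'c) superalgebra_scheme" (structure)
    and A :: "'a set" and p f C lt
begin

abbreviation "basis_span \<equiv> lspan R L (eval_at L f ` basis_exps C p)"

lemma basis_letters:
  assumes "b \<in> basis_exps C p"
  shows "set_brexp b \<subseteq> A"
proof -
  obtain c where "c \<in> C" "set_brexp b = set_brexp c"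
    using assms unfolding basis_exps_def by force
  then show ?thesis using set_brexp_subset by simp
qed

lemma basis_closed: "eval_at L f ` basis_exps C p \<subseteq> carrier L"
  using eval_closed basis_letters by auto

lemma bracket_basis:
  assumes "u \<in> basis_exps C p" "v \<in> basis_exps C p"
  shows "bracket L (eval_at L f u) (eval_at L f v) \<in> basis_span"
proof -
  let ?S = "set_brexp u \<union> set_brexp v"
  let ?C = "{c \<in> C. set_brexp c \<subseteq> ?S}"
  interpret S: hall_set "A \<inter> ?S" ?C lt by (rule hall_restrict)
  interpret F: finite_hall_generators R L "A \<inter> ?S" p f ?C lt
  proof unfold_locales
    have "finite (set_brexp t)" for t :: "'a brexp" by (induction t) auto
    then show "finite (A \<inter> ?S)" by auto
    show "p \<in> A \<inter> ?S \<rightarrow> {0, 1}" using p_deg by (simp add: Pi_iff)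
    show "f a \<in> homog L (p a)" if "a \<in> A \<inter> ?S" for a using f_homog that by simp
  qed
  have "bracket L (eval_at L f u) (eval_at L f v) \<in> lspan R L (eval_at L f ` basis_exps ?C p)"
    by (rule F.bracket_basis_in_span; rule basis_exps_restrict) (simp_all add: assms)
  moreover have "basis_exps ?C p \<subseteq> basis_exps C p" by (rule basis_exps_mono) blast
  from lspan_mono[OF image_mono[OF this]]
  have "lspan R L (eval_at L f ` basis_exps ?C p) \<subseteq> basis_span" .
  ultimately show ?thesis by (rule rev_subsetD)
qed

lemma bracket_basis_span:
  assumes "x \<in> basis_span" "y \<in> basis_span"
  shows "bracket L x y \<in> basis_span"
  by (rule bracket_lspan[OF assms basis_closed basis_closed lspan_submodule[OF basis_closed]])
    (auto intro: bracket_basis)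

end

section \<open>Noncommutative power series\<close>

text \<open>
  A word has only finitely many factorizations into two words, so arbitrary series can be multiplied.
  The coefficients are real because linear independence, even over the integers, will come from a
  comparison of dimensions.
\<close>

typedef 'a ncfps = "UNIV :: ('a list \<Rightarrow> real) set"
  morphisms coeff_at Ncfps ..

setup_lifting type_definition_ncfps

text \<open>
  The convolution product, by recursion on the word: either the left factor of a factorization is
  empty, or it takes the first letter. This makes associativity a plain induction.
\<close>

primrec conv :: "'a list \<Rightarrow> ('a list \<Rightarrow> real) \<Rightarrow> ('a list \<Rightarrow> real) \<Rightarrow> real" where
  "conv [] f g = f [] * g []"
| "conv (a # w) f g = f [] * g (a # w) + conv w (\<lambda>u. f (a # u)) g"

lemma conv_add_left: "conv w (\<lambda>u. f u + g u) h = conv w f h + conv w g h"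
  by (induction w arbitrary: f g) (auto simp: algebra_simps)

lemma conv_scale_left: "conv w (\<lambda>u. r * f u) h = r * conv w f h"
  by (induction w arbitrary: f) (auto simp: algebra_simps)

lemma conv_add_right: "conv w f (\<lambda>u. g u + h u) = conv w f g + conv w f h"
  by (induction w arbitrary: f) (auto simp: algebra_simps)

lemma conv_scale_right: "conv w f (\<lambda>u. r * h u) = r * conv w f h"
  by (induction w arbitrary: f) (auto simp: algebra_simps)

lemma conv_zero_left: "conv w (\<lambda>u. 0) h = 0"
  by (induction w) auto

lemma conv_assoc: "conv w (\<lambda>u. conv u f g) h = conv w f (\<lambda>v. conv v g h)"
  by (induction w arbitrary: f) (auto simp: conv_add_left conv_scale_left algebra_simps)

lemma conv_one_left: "conv w (\<lambda>u. if u = [] then 1 else 0) f = f w"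
  by (cases w) (auto simp: conv_zero_left)

lemma conv_one_right: "conv w f (\<lambda>u. if u = [] then 1 else 0) = f w"
  by (induction w arbitrary: f) auto

lemma conv_nonzero: "conv w f g \<noteq> 0 \<Longrightarrow> \<exists>u v. w = u @ v \<and> f u \<noteq> 0 \<and> g v \<noteq> 0"
proof (induction w arbitrary: f)
  case (Cons a w)
  show ?case
  proof (cases "f [] * g (a # w) = 0")
    case True
    then have "conv w (\<lambda>u. f (a # u)) g \<noteq> 0" using Cons.prems by (simp only: conv.simps)
    from Cons.IH[OF this] obtain u v where "w = u @ v" "f (a # u) \<noteq> 0" "g v \<noteq> 0" by blast
    then show ?thesis by (metis append_Cons)
  qed (use append_Nil in fastforce)
qed simp

instantiation ncfps :: (type) real_algebra_1
begin

lift_definition zero_ncfps :: "'a ncfps" is "\<lambda>w. 0" .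
lift_definition one_ncfps :: "'a ncfps" is "\<lambda>w. if w = [] then 1 else 0" .
lift_definition plus_ncfps :: "'a ncfps \<Rightarrow> 'a ncfps \<Rightarrow> 'a ncfps" is "\<lambda>f g w. f w + g w" .
lift_definition minus_ncfps :: "'a ncfps \<Rightarrow> 'a ncfps \<Rightarrow> 'a ncfps" is "\<lambda>f g w. f w - g w" .
lift_definition uminus_ncfps :: "'a ncfps \<Rightarrow> 'a ncfps" is "\<lambda>f w. - f w" .
lift_definition times_ncfps :: "'a ncfps \<Rightarrow> 'a ncfps \<Rightarrow> 'a ncfps" is "\<lambda>f g w. conv w f g" .
lift_definition scaleR_ncfps :: "real \<Rightarrow> 'a ncfps \<Rightarrow> 'a ncfps" is "\<lambda>r f w. r * f w" .

instance
proof
  fix a b c :: "'a ncfps" and r s :: real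
  show "(0 :: 'a ncfps) \<noteq> 1" by transfer (metis zero_neq_one)
  show "a * b * c = a * (b * c)" by transfer (simp add: conv_assoc)
  show "(a + b) * c = a * c + b * c" by transfer (simp add: conv_add_left)
  show "a * (b + c) = a * b + a * c" by transfer (simp add: conv_add_right)
  show "1 * a = a" by transfer (simp add: conv_one_left)
  show "a * 1 = a" by transfer (simp add: conv_one_right)
  show "r *\<^sub>R a * b = r *\<^sub>R (a * b)" by transfer (simp add: conv_scale_left)
  show "a * r *\<^sub>R b = r *\<^sub>R (a * b)" by transfer (simp add: conv_scale_right)
qed (transfer, simp add: algebra_simps fun_eq_iff)+

end

lift_definition word :: "'a list \<Rightarrow> 'a ncfps" is "\<lambda>u w. if w = u then 1 else 0" .

lemma word_Nil: "word [] = 1"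
  by transfer simp

lemma word_Cons: "word (a # u) = word [a] * word u"
proof (transfer, rule ext)
  fix a :: 'a and u w
  show "(if w = a # u then 1 else 0) =
      conv w (\<lambda>w. if w = [a] then 1 else 0) (\<lambda>w. if w = u then 1 else (0::real))"
  proof (cases w)
    case (Cons b w')
    show ?thesis
    proof (cases "a = b")
      case True
      have "(\<lambda>v. if b # v = [b] then 1 else (0::real)) = (\<lambda>v. if v = [] then 1 else 0)" by auto
      then show ?thesis using Cons True conv_one_left[of w' "\<lambda>w. if w = u then 1 else 0"] by simp
    qed (use Cons conv_zero_left in auto)
  qed auto
qed

lemma independent_words: "finite W \<Longrightarrow> independent (word ` W)"
  unfolding dependent_def
proof (rule notI, elim bexE)
  fix x assume "x \<in> word ` W" and x: "x \<in> span (word ` W - {x})"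
  then obtain u where u: "x = word u" by blast
  have "subspace {y. coeff_at y u = 0}"
    unfolding subspace_def by (auto simp: zero_ncfps.rep_eq plus_ncfps.rep_eq scaleR_ncfps.rep_eq)
  moreover have "word ` W - {x} \<subseteq> {y. coeff_at y u = 0}"
    using u by (auto simp: word.rep_eq)
  ultimately have "coeff_at x u = 0" using x span_minimal by blast
  then show False using u by (simp add: word.rep_eq)
qed

lemma inj_word: "inj word"
  by (rule injI) (metis word.rep_eq zero_neq_one)

definition word_parity :: "('a \<Rightarrow> nat) \<Rightarrow> 'a list \<Rightarrow> nat" where
  "word_parity p w = sum_list (map p w) mod 2"

definition of_parity :: "('a \<Rightarrow> nat) \<Rightarrow> nat \<Rightarrow> 'a ncfps set" where
  "of_parity p i = {x. \<forall>w. word_parity p w \<noteq> i \<longrightarrow> coeff_at x w = 0}"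

lift_definition odd_comp :: "('a \<Rightarrow> nat) \<Rightarrow> 'a ncfps \<Rightarrow> 'a ncfps"
  is "\<lambda>p f w. if word_parity p w = 1 then f w else 0" .

lemma odd_comp_linear [simp]:
  "odd_comp p (x + y) = odd_comp p x + odd_comp p y"
  "odd_comp p (r *\<^sub>R x) = r *\<^sub>R odd_comp p x"
  by (transfer, auto)+

lemma odd_comp_of_parity:
  "x \<in> of_parity p 0 \<Longrightarrow> odd_comp p x = 0" "x \<in> of_parity p 1 \<Longrightarrow> odd_comp p x = x"
  by (simp_all add: of_parity_def coeff_at_inject[symmetric] odd_comp.rep_eq zero_ncfps.rep_eq fun_eq_iff)

lemma odd_comp_mem: "odd_comp p x \<in> of_parity p 1" "x - odd_comp p x \<in> of_parity p 0"
proof -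
  have "word_parity p w = 1" if "word_parity p w \<noteq> 0" for w
    using that by (simp add: word_parity_def)
  then show "x - odd_comp p x \<in> of_parity p 0"
    unfolding of_parity_def by (simp add: odd_comp.rep_eq minus_ncfps.rep_eq)
qed (simp add: of_parity_def odd_comp.rep_eq)

lemma of_parity_add: "\<lbrakk>x \<in> of_parity p i; y \<in> of_parity p i\<rbrakk> \<Longrightarrow> x + y \<in> of_parity p i"
  and of_parity_diff: "\<lbrakk>x \<in> of_parity p i; y \<in> of_parity p i\<rbrakk> \<Longrightarrow> x - y \<in> of_parity p i"
  and of_parity_uminus: "x \<in> of_parity p i \<Longrightarrow> - x \<in> of_parity p i"
  and of_parity_scale: "x \<in> of_parity p i \<Longrightarrow> r *\<^sub>R x \<in> of_parity p i"
  and of_parity_zero: "0 \<in> of_parity p i"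
  by (simp_all add: of_parity_def plus_ncfps.rep_eq minus_ncfps.rep_eq uminus_ncfps.rep_eq
      scaleR_ncfps.rep_eq zero_ncfps.rep_eq)

lemma of_parity_mult:
  assumes "x \<in> of_parity p i" "y \<in> of_parity p j"
  shows "x * y \<in> of_parity p ((i + j) mod 2)"
proof -
  have "word_parity p w = (i + j) mod 2" if nz: "coeff_at (x * y) w \<noteq> 0" for w
  proof -
    obtain u v where "w = u @ v" "coeff_at x u \<noteq> 0" "coeff_at y v \<noteq> 0"
      using conv_nonzero[OF nz[unfolded times_ncfps.rep_eq]] by blast
    then have w: "w = u @ v" "word_parity p u = i" "word_parity p v = j"
      using assms unfolding of_parity_def by blast+
    have "word_parity p w = (word_parity p u + word_parity p v) mod 2"
      unfolding w(1) word_parity_def by (simp add: mod_add_eq)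
    then show ?thesis unfolding w(2,3) .
  qed
  then show ?thesis unfolding of_parity_def by blast
qed

section \<open>The Lie superring of noncommutative power series\<close>

text \<open>
  On homogeneous series this is \<open>x y - (-1)\<^bsup>|x||y|\<^esup> y x\<close> (\<open>scomm_homog\<close>): only if both are odd does the
  sign differ from that of the ordinary commutator, and the last summand corrects it. In this form the
  bilinearity is evident.
\<close>

definition scomm :: "('a \<Rightarrow> nat) \<Rightarrow> 'a ncfps \<Rightarrow> 'a ncfps \<Rightarrow> 'a ncfps" where
  "scomm p x y = x * y - y * x + 2 * (odd_comp p y * odd_comp p x)"

lemma scomm_homog:
  assumes "i \<in> {0, 1}" "j \<in> {0, 1}" "x \<in> of_parity p i" "y \<in> of_parity p j"
  shows "scomm p x y = x * y - (-1) ^ (i * j) * y * x"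
  using assms by (auto simp: scomm_def odd_comp_of_parity mult_2)

definition series_superalgebra :: "('a \<Rightarrow> nat) \<Rightarrow> (int, 'a ncfps) superalgebra" where
  "series_superalgebra p = \<lparr>carrier = UNIV, monoid.mult = (*), monoid.one = 1, ring.zero = 0, ring.add = (+),
     module.smult = (\<lambda>z x. of_int z * x), bracket = scomm p,
     even_part = of_parity p 0, odd_part = of_parity p 1\<rparr>"

lemma series_superalgebra_simps [simp]:
  "carrier (series_superalgebra p) = UNIV" "\<zero>\<^bsub>series_superalgebra p\<^esub> = 0"
  "x \<oplus>\<^bsub>series_superalgebra p\<^esub> y = x + y" "z \<odot>\<^bsub>series_superalgebra p\<^esub> x = of_int z * x"
  "bracket (series_superalgebra p) = scomm p"
  "even_part (series_superalgebra p) = of_parity p 0"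
  "odd_part (series_superalgebra p) = of_parity p 1"
  by (simp_all add: series_superalgebra_def)

lemma homog_series: "i \<in> {0, 1} \<Longrightarrow> homog (series_superalgebra p) i = of_parity p i"
  by (auto simp: homog_def)

lemma sgn_pow_int: "sgn_pow \<Z> n = (- 1) ^ n"
proof -
  have "x [^]\<^bsub>\<Z>\<^esub> n = x ^ n" for x :: int
    by (induction n) simp_all
  then show ?thesis by (simp add: sgn_pow_def int_a_inv_eq)
qed

lemma of_int_mult_eq_scale: "of_int z * x = real_of_int z *\<^sub>R (x :: 'a ncfps)"
  by (simp add: scaleR_conv_of_real)

lemma scomm_mem:
  assumes "i \<in> {0, 1}" "j \<in> {0, 1}" "x \<in> of_parity p i" "y \<in> of_parity p j"
  shows "scomm p x y \<in> of_parity p ((i + j) mod 2)"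
proof -
  have "y * x \<in> of_parity p ((i + j) mod 2)"
    using of_parity_mult[OF assms(4,3)] by (simp add: add.commute)
  moreover have "(-1) ^ (i * j) * (y * x) = real_of_int ((-1) ^ (i * j)) *\<^sub>R (y * x)"
    by (subst of_int_mult_eq_scale[symmetric]) simp
  ultimately show ?thesis
    unfolding scomm_homog[OF assms]
    using of_parity_mult[OF assms(3,4)] by (metis mult.assoc of_parity_diff of_parity_scale)
qed

lemma series_module: "module \<Z> (series_superalgebra p)"
proof (rule moduleI)
  show "cring \<Z>" by (rule int_is_cring)
  show "abelian_group (series_superalgebra p)"
    by (rule abelian_groupI) (auto simp: algebra_simps intro: exI[of _ "- x" for x])
qed (auto simp: algebra_simps)

lemma series_a_inv [simp]: "\<ominus>\<^bsub>series_superalgebra p\<^esub> x = - x"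
proof -
  interpret module \<Z> "series_superalgebra p" by (rule series_module)
  show ?thesis by (rule M.minus_equality) auto
qed

lemma series_superalgebra: "lie_superalgebra \<Z> (series_superalgebra p)"
proof -
  interpret module \<Z> "series_superalgebra p" by (rule series_module)
  have sub: "submodule (of_parity p i) \<Z> (series_superalgebra p)" for i
    by (rule submoduleI)
      (auto simp: of_parity_zero of_parity_add of_parity_uminus of_int_mult_eq_scale of_parity_scale)
  show ?thesis
  proof (intro lie_superalgebra.intro series_module lie_superalgebra_axioms.intro, goal_cases)
    case 1 show ?case using sub[of 0] by simp
  next
    case 2 show ?case using sub[of 1] by simp
  next
    case 3
    have "x \<in> even_part (series_superalgebra p) <+>\<^bsub>series_superalgebra p\<^esub> odd_part (series_superalgebra p)" for x
      using odd_comp_mem(2)[where p = p and x = x] odd_comp_mem(1)[where p = p and x = x]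
      by (auto simp: set_add_def' intro!: bexI)
    then show ?case by auto
  next
    case 4
    have "x = 0" if "x \<in> of_parity p 0" "x \<in> of_parity p 1" for x
      using odd_comp_of_parity that by metis
    then show ?case by (auto simp: of_parity_zero)
  next
    case (10 i j a b)
    then have "scomm p a b \<in> of_parity p ((i + j) mod 2)"
      by (intro scomm_mem) (simp_all add: homog_series)
    moreover have "(i + j) mod 2 \<in> {0, 1}" by auto
    ultimately show ?case by (simp only: homog_series series_superalgebra_simps)
  next
    case (11 i j a b)
    have "scomm p a b = a * b - (-1) ^ (i * j) * b * a" "scomm p b a = b * a - (-1) ^ (j * i) * a * b"
      by (rule scomm_homog; use 11 in \<open>simp add: homog_series\<close>)+
    note eqs = this
    show ?case
      unfolding series_superalgebra_simps series_a_inv eqs sgn_pow_int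
      using 11(1,2) by (elim insertE emptyE) simp_all
  next
    case (12 i j k a b c)
    have h: "a \<in> of_parity p i" "b \<in> of_parity p j" "c \<in> of_parity p k"
      using 12 by (simp_all add: homog_series)
    have mem: "scomm p b c \<in> of_parity p ((j + k) mod 2)" "scomm p c a \<in> of_parity p ((k + i) mod 2)"
      "scomm p a b \<in> of_parity p ((i + j) mod 2)"
      by (rule scomm_mem; use 12 h in simp)+
    have inner: "scomm p b c = b * c - (-1) ^ (j * k) * c * b" "scomm p c a = c * a - (-1) ^ (k * i) * a * c"
      "scomm p a b = a * b - (-1) ^ (i * j) * b * a"
      by (rule scomm_homog; use 12 h in simp)+
    have outer:
      "scomm p a (scomm p b c) = a * scomm p b c - (-1) ^ (i * ((j + k) mod 2)) * scomm p b c * a"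
      "scomm p b (scomm p c a) = b * scomm p c a - (-1) ^ (j * ((k + i) mod 2)) * scomm p c a * b"
      "scomm p c (scomm p a b) = c * scomm p a b - (-1) ^ (k * ((i + j) mod 2)) * scomm p a b * c"
      by (rule scomm_homog; use 12 h mem in auto)+
    show ?case
      unfolding series_superalgebra_simps sgn_pow_int outer
      unfolding inner
      using 12(1-3) by (elim insertE emptyE) (simp_all add: algebra_simps)
  next
    case (13 a)
    then show ?case using odd_comp_of_parity(1)[of a p] by (simp add: scomm_def)
  next
    case (14 a)
    then have a: "a \<in> of_parity p 1" by simp
    have "scomm p a a \<in> of_parity p 0" using scomm_mem[OF _ _ a a] by simp
    then have "odd_comp p (scomm p a a) = 0" by (rule odd_comp_of_parity)
    then show ?case using odd_comp_of_parity(2)[OF a] by (simp add: scomm_def algebra_simps mult_2)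
  qed (auto simp: scomm_def algebra_simps of_int_mult_eq_scale)
qed

section \<open>Increasing products of basic commutators\<close>

primrec foliage :: "'a brexp \<Rightarrow> 'a list" where
  "foliage (Gen a) = [a]"
| "foliage (Br s t) = foliage s @ foliage t"

lemma length_foliage: "length (foliage t) = weight t"
  by (induction t) auto

lemma set_foliage: "set (foliage t) = set_brexp t"
  by (induction t) auto

abbreviation series_eval :: "('a \<Rightarrow> nat) \<Rightarrow> 'a brexp \<Rightarrow> 'a ncfps" where
  "series_eval p \<equiv> eval_at (series_superalgebra p) (\<lambda>a. word [a])"

abbreviation series_prod :: "('a \<Rightarrow> nat) \<Rightarrow> 'a brexp list \<Rightarrow> 'a ncfps" where
  "series_prod p s \<equiv> prod_list (map (series_eval p) s)"

lemma finite_set_brexp: "finite (set_brexp t)"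
  unfolding set_foliage[symmetric] by (rule finite_set)

lemma series_generators:
  assumes "p \<in> A \<rightarrow> {0, 1}"
  shows "graded_generators \<Z> (series_superalgebra p) A p (\<lambda>a. word [a])"
proof (intro graded_generators.intro series_superalgebra graded_generators_axioms.intro assms)
  fix a assume "a \<in> A"
  then have "p a \<in> {0, 1}" using assms by blast
  moreover from this have "word [a] \<in> of_parity p (p a)"
    by (auto simp: of_parity_def word.rep_eq word_parity_def)
  ultimately show "word [a] \<in> homog (series_superalgebra p) (p a)" by (simp only: homog_series)
qed

lemma mult_span_mem:
  fixes a y :: "'b :: real_algebra_1"
  assumes "y \<in> span (f ` S)" "\<And>s. s \<in> S \<Longrightarrow> a * f s \<in> span T"
  shows "a * y \<in> span T"
proof -
  have "subspace {y. a * y \<in> span T}"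
    by (auto simp: subspace_def span_0 distrib_left span_add span_scale)
  moreover have "f ` S \<subseteq> {y. a * y \<in> span T}" using assms(2) by blast
  ultimately have "span (f ` S) \<subseteq> {y. a * y \<in> span T}" by (rule span_minimal[rotated])
  then show ?thesis using assms(1) by blast
qed

locale hall_series = hall_set A C lt
  for A :: "'a set" and C lt +
  fixes p :: "'a \<Rightarrow> nat"
  assumes p_degree: "p \<in> A \<rightarrow> {0, 1}"
begin

abbreviation "D \<equiv> series_eval p"
abbreviation "P \<equiv> series_prod p"

definition le :: "'a brexp \<Rightarrow> 'a brexp \<Rightarrow> bool" where
  "le x y \<longleftrightarrow> lt x y \<or> x = y"

lemma le_trans: "\<lbrakk>x \<in> C; y \<in> C; z \<in> C; le x y; le y z\<rbrakk> \<Longrightarrow> le x z"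
  unfolding le_def using lt_trans by blast

lemma not_le_iff: "\<lbrakk>x \<in> C; y \<in> C\<rbrakk> \<Longrightarrow> \<not> le x y \<longleftrightarrow> lt y x"
  unfolding le_def using lt_total lt_trans lt_irrefl by blast

definition incr :: "'a brexp list \<Rightarrow> bool" where
  "incr s \<longleftrightarrow> set s \<subseteq> C \<and> sorted_wrt le s"

text \<open>
  For \<open>x = [e, f]\<close> and \<open>y\<close> in \<open>s\<close> with \<open>y < x\<close>, this is the condition under which \<open>[x, y]\<close> is again basic.
\<close>

definition standard :: "'a brexp \<Rightarrow> 'a brexp list \<Rightarrow> bool" where
  "standard x s \<longleftrightarrow> (\<forall>e f. x = Br e f \<longrightarrow> (\<forall>y\<in>set s. le f y))"

definition total :: "'a brexp list \<Rightarrow> nat" where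
  "total s = sum_list (map weight s)"

lemma incr_Cons: "incr (x # s) \<longleftrightarrow> x \<in> C \<and> (\<forall>y\<in>set s. le x y) \<and> incr s"
  by (auto simp: incr_def)

lemma incr_Cons_if_le_hd:
  assumes "x \<in> C" "incr (h # s)" "le x h"
  shows "incr (x # h # s)"
  using assms le_trans[of x h] by (auto simp: incr_def)

lemma Br_in_C: "\<lbrakk>x \<in> C; h \<in> C; lt h x; standard x (h # s)\<rbrakk> \<Longrightarrow> Br x h \<in> C"
  unfolding Br_iff[of x h] standard_def le_def by auto

lemma lt_Br: "Br x h \<in> C \<Longrightarrow> lt h (Br x h)"
  using lt_weight[of h "Br x h"] weight_pos[of x] by (simp add: Br_iff[of x h])

lemma right_factor_lt: "Br e f \<in> C \<Longrightarrow> e \<in> C \<and> f \<in> C \<and> lt f e"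
  by (simp add: Br_iff[of e f])

lemma D_Br:
  assumes "x \<in> C" "y \<in> C"
  shows "D x * D y - (-1) ^ (parity p x * parity p y) * D y * D x = D (Br x y)"
proof -
  interpret graded_generators \<Z> "series_superalgebra p" A p "\<lambda>a. word [a]"
    by (rule series_generators[OF p_degree])
  have d: "parity p x \<in> {0, 1}" "parity p y \<in> {0, 1}"
    using parity_deg set_brexp_subset assms by blast+
  then have "D x \<in> of_parity p (parity p x)" "D y \<in> of_parity p (parity p y)"
    using eval_homog[OF set_brexp_subset[OF assms(1)]] eval_homog[OF set_brexp_subset[OF assms(2)]]
    by (simp_all only: homog_series)
  from scomm_homog[OF d this] show ?thesis by simp
qed

text \<open>
  The lower bounds \<open>M\<close> allow a factor to be put back in front of an already straightened product.
\<close>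

definition incr_over :: "nat \<Rightarrow> 'a brexp set \<Rightarrow> 'a brexp list set" where
  "incr_over n M = {s. incr s \<and> total s = n \<and> (\<forall>m\<in>M. \<forall>y\<in>set s. le m y)}"

text \<open>
  Let \<open>h\<close> be the first factor of the increasing product. If \<open>x \<le> h\<close>, nothing is to be done; otherwise
  \<open>x h = [x, h] +/- h x\<close>. Here \<open>[x, h]\<close> is basic and standard for the rest, and moving \<open>x\<close> into the rest
  only produces factors that are \<open>\<ge> h\<close>, so that \<open>h\<close> can stay in front. Equal factors, odd ones
  included, stay side by side, so the sequences are the same as for ordinary Lie algebras.
\<close>

lemma straighten_product:
  assumes "x \<in> C" "incr s" "standard x s" "M \<subseteq> C" "\<forall>m\<in>M. \<forall>y\<in>set (x # s). le m y"
  shows "D x * P s \<in> span (P ` incr_over (weight x + total s) M)"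
  using assms
proof (induction s arbitrary: x M)
  case Nil
  then have "[x] \<in> incr_over (weight x + total []) M"
    by (auto simp: incr_over_def incr_def total_def)
  then have "P [x] \<in> span (P ` incr_over (weight x + total []) M)" by (intro span_base imageI)
  then show ?case by simp
next
  case (Cons h t)
  have hC: "h \<in> C" and tC: "set t \<subseteq> C" and ht: "\<forall>y\<in>set t. le h y" and it: "incr t"
    using Cons.prems(2) by (auto simp: incr_def)
  have tot: "total (h # t) = weight h + total t" by (simp add: total_def)
  let ?T = "P ` incr_over (weight x + total (h # t)) M"
  show ?case
  proof (cases "le x h")
    case True
    then have "x # h # t \<in> incr_over (weight x + total (h # t)) M"
      using incr_Cons_if_le_hd[OF Cons.prems(1,2)] Cons.prems(5)
      by (simp add: incr_over_def total_def)
    then have "P (x # h # t) \<in> span ?T" by (intro span_base imageI)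
    then show ?thesis by simp
  next
    case False
    then have hx: "lt h x" using not_le_iff Cons.prems(1) hC by blast
    have B: "Br x h \<in> C" by (rule Br_in_C[OF Cons.prems(1) hC hx Cons.prems(3)])
    have le_B: "le m (Br x h)" if "m \<in> M" for m
    proof (rule le_trans[OF _ hC B])
      show "m \<in> C" "le m h" using that Cons.prems(4,5) by auto
      show "le h (Br x h)" using lt_Br[OF B] by (simp add: le_def)
    qed
    have "D (Br x h) * P t \<in> span (P ` incr_over (weight (Br x h) + total t) M)"
    proof (rule Cons.IH[OF B it _ Cons.prems(4)])
      show "standard (Br x h) t" using ht by (simp add: standard_def)
      show "\<forall>m\<in>M. \<forall>y\<in>set (Br x h # t). le m y" using le_B Cons.prems(5) by simp
    qed
    then have 1: "D (Br x h) * P t \<in> span ?T" by (simp add: tot add.assoc)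
    have "D x * P t \<in> span (P ` incr_over (weight x + total t) (insert h M))"
    proof (rule Cons.IH[OF Cons.prems(1) it])
      show "standard x t" using Cons.prems(3) by (simp add: standard_def)
      show "insert h M \<subseteq> C" using hC Cons.prems(4) by simp
      show "\<forall>m\<in>insert h M. \<forall>y\<in>set (x # t). le m y" using Cons.prems(5) ht hx by (simp add: le_def)
    qed
    then have 2: "D h * (D x * P t) \<in> span ?T"
    proof (rule mult_span_mem)
      fix s assume "s \<in> incr_over (weight x + total t) (insert h M)"
      then have "h # s \<in> incr_over (weight x + total (h # t)) M"
        using hC Cons.prems(5) by (simp add: incr_over_def incr_def total_def)
      then have "P (h # s) \<in> span ?T" by (intro span_base imageI)
      then show "D h * P s \<in> span ?T" by simp
    qed
    let ?c = "(-1) ^ (parity p x * parity p h) :: real"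
    have "D x * P (h # t) = (D x * D h) * P t" by (simp add: mult.assoc)
    also have "D x * D h = D (Br x h) + ?c *\<^sub>R (D h * D x)"
      unfolding D_Br[OF Cons.prems(1) hC, symmetric] by (simp add: scaleR_conv_of_real mult.assoc)
    finally have "D x * P (h # t) = D (Br x h) * P t + ?c *\<^sub>R (D h * (D x * P t))"
      by (simp add: distrib_right mult.assoc del: eval_at.simps)
    then show ?thesis using 1 2 by (simp only: span_add span_scale)
  qed
qed

lemma word_in_span: "set w \<subseteq> A \<Longrightarrow> word w \<in> span (P ` incr_over (length w) {})"
proof (induction w)
  case Nil
  have "[] \<in> incr_over 0 {}" by (simp add: incr_over_def incr_def total_def)
  then have "P [] \<in> span (P ` incr_over 0 {})" by (intro span_base imageI)
  then show ?case by (simp add: word_Nil)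
next
  case (Cons a w)
  then have "word w \<in> span (P ` incr_over (length w) {})" by simp
  then have "word [a] * word w \<in> span (P ` incr_over (length (a # w)) {})"
  proof (rule mult_span_mem)
    fix s assume "s \<in> incr_over (length w) {}"
    then have "D (Gen a) * P s \<in> span (P ` incr_over (weight (Gen a) + total s) {})"
      using Cons.prems by (intro straighten_product) (simp_all add: Gen_iff incr_over_def standard_def)
    moreover have "total s = length w" using \<open>s \<in> _\<close> by (simp add: incr_over_def)
    ultimately show "word [a] * P s \<in> span (P ` incr_over (length (a # w)) {})" by simp
  qed
  then show ?case by (simp only: word_Cons[of a w])
qed

text \<open>
  Keeping only the leading term \<open>[x, h]\<close> of \<open>x h = [x, h] +/- h x\<close> turns a word into an increasing
  sequence of basic commutators whose concatenated foliage is that word.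
\<close>

fun absorb :: "'a brexp \<Rightarrow> 'a brexp list \<Rightarrow> 'a brexp list" where
  "absorb x [] = [x]"
| "absorb x (h # s) = (if lt h x then absorb (Br x h) s else x # h # s)"

definition factorize :: "'a list \<Rightarrow> 'a brexp list \<Rightarrow> 'a brexp list" where
  "factorize w s = foldr (\<lambda>a. absorb (Gen a)) w s"

lemma factorize_append: "factorize (u @ v) s = factorize u (factorize v s)"
  by (simp add: factorize_def)

lemma absorb_le: "\<lbrakk>x \<in> C; incr s; \<forall>y\<in>set s. le x y\<rbrakk> \<Longrightarrow> absorb x s = x # s"
  using not_le_iff[of x] by (cases s) (auto simp: incr_def)

text \<open>
  The induction descends into \<open>h = [e, f]\<close>: the foliage of \<open>f\<close> is read first and, as \<open>f \<le> s\<close>, becomes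
  the front element \<open>f\<close>; then the foliage of \<open>e\<close> produces \<open>e\<close>, and \<open>f < e\<close> makes \<open>e\<close> absorb \<open>f\<close>.
\<close>

lemma factorize_foliage:
  assumes "h \<in> C" "incr s" "standard h s"
  shows "factorize (foliage h) s = absorb h s"
  using assms
proof (induction h arbitrary: s)
  case (Gen a)
  then show ?case by (simp add: factorize_def)
next
  case (Br e f)
  have ef: "e \<in> C" "f \<in> C" "lt f e" using right_factor_lt[OF Br.prems(1)] by simp_all
  have fs: "\<forall>y\<in>set s. le f y" using Br.prems(3) by (simp add: standard_def)
  have std: "standard f s"
    unfolding standard_def
  proof (intro allI impI ballI)
    fix e' f' y assume f: "f = Br e' f'" and y: "y \<in> set s"
    have "le f' f" using lt_Br[of e' f'] ef(2) f by (simp add: le_def)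
    then show "le f' y"
      using le_trans[of f' f y] right_factor_lt[of e' f'] ef(2) f y fs Br.prems(2) by (auto simp: incr_def)
  qed
  have "factorize (foliage (Br e f)) s = factorize (foliage e) (factorize (foliage f) s)"
    by (simp add: factorize_append)
  also have "factorize (foliage f) s = f # s"
    using Br.IH(2)[OF ef(2) Br.prems(2) std] absorb_le[OF ef(2) Br.prems(2) fs] by simp
  also have "factorize (foliage e) (f # s) = absorb e (f # s)"
  proof (rule Br.IH(1)[OF ef(1)])
    show fs': "incr (f # s)" using incr_Cons ef(2) fs Br.prems(2) by simp
    show "standard e (f # s)"
      unfolding standard_def
    proof (intro allI impI ballI)
      fix e' f' y assume e: "e = Br e' f'" and y: "y \<in> set (f # s)"
      have "le f' f" using Br.prems(1) e unfolding Br_iff[of e f] le_def by simp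
      moreover have "le f y" using y fs by (auto simp: le_def)
      moreover have "f' \<in> C" using ef(1) e right_factor_lt by blast
      moreover have "y \<in> C" using fs' y by (auto simp: incr_def)
      ultimately show "le f' y" using le_trans ef(2) by blast
    qed
  qed
  also have "\<dots> = absorb (Br e f) s" using ef(3) by simp
  finally show ?case .
qed

lemma factorize_incr: "incr s \<Longrightarrow> factorize (concat (map foliage s)) [] = s"
proof (induction s)
  case Nil
  then show ?case by (simp add: factorize_def)
next
  case (Cons h s)
  have h: "h \<in> C" "\<forall>y\<in>set s. le h y" "incr s" using Cons.prems by (auto simp: incr_Cons)
  have "standard h s"
    unfolding standard_def
  proof (intro allI impI ballI)
    fix e f y assume hf: "h = Br e f" and y: "y \<in> set s"
    have "le f h" using lt_Br[of e f] h(1) hf by (simp add: le_def)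
    then show "le f y"
      using le_trans[of f h y] right_factor_lt[of e f] h hf y by (auto simp: incr_def)
  qed
  then show ?case
    using Cons.IH h factorize_foliage absorb_le by (simp add: factorize_append)
qed

lemma total_length: "length (concat (map foliage s)) = total s"
  by (induction s) (simp_all add: total_def length_foliage)

definition bounded_words :: "nat \<Rightarrow> 'a list set" where
  "bounded_words N = {w. set w \<subseteq> A \<and> length w \<le> N}"

definition bounded_incr :: "nat \<Rightarrow> 'a brexp list set" where
  "bounded_incr N = {s. incr s \<and> total s \<le> N}"

text \<open>
  The products span all words, which are independent, and by \<open>factorize_incr\<close> there are at most as
  many products as words. If one product depended on the others, too few vectors would span the words.
\<close>

lemma product_notin_span:
  assumes "finite A" "s \<in> bounded_incr N"
  shows "P s \<notin> span (P ` (bounded_incr N - {s}))"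
proof
  let ?W = "bounded_words N" and ?I = "bounded_incr N"
  assume dep: "P s \<in> span (P ` (?I - {s}))"
  have W: "finite ?W"
    unfolding bounded_words_def by (rule finite_lists_length_le[OF assms(1)])
  have "?I \<subseteq> (\<lambda>w. factorize w []) ` ?W"
  proof
    fix t assume t: "t \<in> ?I"
    then have "set (concat (map foliage t)) \<subseteq> A" "length (concat (map foliage t)) \<le> N"
      using set_brexp_subset unfolding total_length
      by (auto simp: bounded_incr_def incr_def set_foliage)
    then have "concat (map foliage t) \<in> ?W" by (simp add: bounded_words_def)
    then show "t \<in> (\<lambda>w. factorize w []) ` ?W"
      using factorize_incr[of t] t unfolding bounded_incr_def by force
  qed
  then have I: "finite ?I" "card ?I \<le> card ?W"
    using W by (auto dest: finite_surj surj_card_le)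
  have "P ` ?I \<subseteq> span (P ` (?I - {s}))"
  proof
    fix x assume "x \<in> P ` ?I"
    then obtain t where t: "t \<in> ?I" "x = P t" by blast
    show "x \<in> span (P ` (?I - {s}))"
    proof (cases "t = s")
      case False
      then have "P t \<in> P ` (?I - {s})" using t by blast
      then show ?thesis using t(2) span_base by simp
    qed (use dep t in simp)
  qed
  then have sub: "span (P ` ?I) \<subseteq> span (P ` (?I - {s}))" by (rule span_minimal) (rule subspace_span)
  have "word ` ?W \<subseteq> span (P ` ?I)"
  proof
    fix x assume "x \<in> word ` ?W"
    then obtain w where w: "x = word w" "set w \<subseteq> A" "length w \<le> N" by (auto simp: bounded_words_def)
    have "incr_over (length w) {} \<subseteq> ?I" using w(3) by (auto simp: incr_over_def bounded_incr_def)
    then show "x \<in> span (P ` ?I)"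
      using word_in_span[OF w(2)] span_mono[OF image_mono] w(1) by blast
  qed
  with sub have "card (word ` ?W) \<le> card (P ` (?I - {s}))"
    using independent_span_bound[OF _ independent_words[OF W], of "P ` (?I - {s})"] I(1) by auto
  also have "\<dots> \<le> card (?I - {s})" using I(1) by (intro card_image_le) simp
  also have "\<dots> < card ?I" using I(1) assms(2) by (intro psubset_card_mono) auto
  also have "\<dots> \<le> card ?W" by (rule I(2))
  also have "card ?W = card (word ` ?W)" using inj_word by (metis card_image inj_on_subset subset_UNIV)
  finally show False by simp
qed

text \<open>
  In the associative algebra \<open>[w, w] = 2 w\<^sup>2\<close> for odd \<open>w\<close>, so up to a nonzero factor the family is a
  part of the basis of increasing products: \<open>[w, w]\<close> belongs to the sequence \<open>w, w\<close>.
\<close>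

definition sequence_of :: "'a brexp \<Rightarrow> 'a brexp list" where
  "sequence_of b = (if b \<in> C then [b] else [root b, root b])"

lemma sequence_of_props:
  assumes "b \<in> basis_exps C p"
  shows "incr (sequence_of b)" "total (sequence_of b) = weight b"
    "\<exists>r. r \<noteq> 0 \<and> D b = r *\<^sub>R P (sequence_of b)"
proof -
  consider "b \<in> C" | w where "b = Br w w" "w \<in> C" "parity p w = 1"
    using assms by (auto simp: basis_exps_def)
  then have "incr (sequence_of b) \<and> total (sequence_of b) = weight b \<and>
    (\<exists>r. r \<noteq> 0 \<and> D b = r *\<^sub>R P (sequence_of b))"
  proof cases
    case 1
    then show ?thesis
      by (auto simp: sequence_of_def incr_def total_def intro!: exI[of _ 1])
  next
    case (2 w)
    then have s: "sequence_of b = [w, w]" using Br_self_notin by (simp add: sequence_of_def)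
    have "D b = 2 *\<^sub>R P [w, w]"
      unfolding 2(1) D_Br[OF 2(2,2), symmetric] 2(3) by (simp add: scaleR_2)
    then show ?thesis
      using 2 unfolding s by (auto simp: incr_def total_def le_def intro!: exI[of _ 2])
  qed
  then show "incr (sequence_of b)" "total (sequence_of b) = weight b"
    "\<exists>r. r \<noteq> 0 \<and> D b = r *\<^sub>R P (sequence_of b)" by blast+
qed

lemma sequence_of_inj: "inj_on sequence_of (basis_exps C p)"
proof (rule inj_onI)
  fix b c assume bc: "b \<in> basis_exps C p" "c \<in> basis_exps C p" "sequence_of b = sequence_of c"
  then show "b = c"
    by (auto simp: sequence_of_def basis_exps_def split: if_splits)
qed

lemma finite_series_independent:
  assumes "finite A" and F: "finite F" "F \<subseteq> basis_exps C p"
    and zero: "(\<Sum>b\<in>F. of_int (c b) * D b) = 0" and b: "b \<in> F"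
  shows "c b = (0 :: int)"
proof (rule ccontr)
  assume cb: "c b \<noteq> 0"
  let ?N = "\<Sum>b\<in>F. weight b"
  let ?S = "span (P ` (bounded_incr ?N - {sequence_of b}))"
  have bound: "sequence_of d \<in> bounded_incr ?N" if "d \<in> F" for d
  proof -
    have "weight d \<le> ?N" using that F(1) by (intro member_le_sum) auto
    then show ?thesis using sequence_of_props[of d] F(2) that by (auto simp: bounded_incr_def)
  qed
  have mem: "of_int (c d) * D d \<in> ?S" if "d \<in> F - {b}" for d
  proof -
    have d: "d \<in> basis_exps C p" "b \<in> basis_exps C p" using that F(2) b by auto
    then have "sequence_of d \<noteq> sequence_of b" using inj_onD[OF sequence_of_inj] that by blast
    then have "P (sequence_of d) \<in> ?S" using bound[of d] that by (intro span_base imageI) simp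
    then show ?thesis
      using sequence_of_props(3)[OF d(1)] span_scale by (auto simp: of_int_mult_eq_scale)
  qed
  then have "(\<Sum>d\<in>F - {b}. of_int (c d) * D d) \<in> ?S" by (rule span_sum)
  moreover have "of_int (c b) * D b = - (\<Sum>d\<in>F - {b}. of_int (c d) * D d)"
    using zero sum.remove[OF F(1) b, of "\<lambda>b. of_int (c b) * D b"] by (simp add: eq_neg_iff_add_eq_0)
  ultimately have "of_int (c b) * D b \<in> ?S" by (simp add: span_neg)
  moreover obtain r where "r \<noteq> 0" "D b = r *\<^sub>R P (sequence_of b)"
    using sequence_of_props(3) F(2) b by blast
  ultimately have "(real_of_int (c b) * r) *\<^sub>R P (sequence_of b) \<in> ?S"
    by (simp add: of_int_mult_eq_scale mult.commute)
  then have "inverse (real_of_int (c b) * r) *\<^sub>R (real_of_int (c b) * r) *\<^sub>R P (sequence_of b) \<in> ?S"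
    by (rule span_scale)
  moreover have "inverse q *\<^sub>R q *\<^sub>R x = x" if "q \<noteq> 0" for q :: real and x :: "'a ncfps"
    using that by simp
  moreover have "real_of_int (c b) * r \<noteq> 0" using cb \<open>r \<noteq> 0\<close> by simp
  ultimately have "P (sequence_of b) \<in> ?S" by (simp only: not_False_eq_True)
  then show False using product_notin_span[OF assms(1) bound[OF b]] by blast
qed

lemma series_independent:
  assumes F: "finite F" "F \<subseteq> basis_exps C p"
    and zero: "(\<Sum>b\<in>F. of_int (c b) * D b) = 0" and b: "b \<in> F"
  shows "c b = (0 :: int)"
proof -
  let ?S = "\<Union>b\<in>F. set_brexp b"
  let ?C = "{c \<in> C. set_brexp c \<subseteq> ?S}"
  interpret R: hall_series "A \<inter> ?S" ?C lt p
  proof (intro hall_series.intro hall_restrict hall_series_axioms.intro)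
    show "p \<in> A \<inter> ?S \<rightarrow> {0, 1}" using p_degree by (simp add: Pi_iff)
  qed
  have "F \<subseteq> basis_exps ?C p"
  proof
    fix d assume d: "d \<in> F"
    show "d \<in> basis_exps ?C p"
      by (rule basis_exps_restrict) (use d F(2) in blast)+
  qed
  moreover have "finite (A \<inter> ?S)" using F(1) finite_set_brexp by auto
  ultimately show ?thesis using R.finite_series_independent F(1) zero b by blast
qed

end

section \<open>Free modules and linear combinations\<close>

definition fin_funs :: "('r, 's) ring_scheme \<Rightarrow> 'i set \<Rightarrow> ('i \<Rightarrow> 'r) set" where
  "fin_funs R J = {h. (\<forall>i. h i \<in> carrier R) \<and> (\<forall>i. i \<notin> J \<longrightarrow> h i = \<zero>\<^bsub>R\<^esub>) \<and> finite {i. h i \<noteq> \<zero>\<^bsub>R\<^esub>}}"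

definition delta :: "('r, 's) ring_scheme \<Rightarrow> 'i \<Rightarrow> 'i \<Rightarrow> 'r" where
  "delta R i = (\<lambda>j. if j = i then \<one>\<^bsub>R\<^esub> else \<zero>\<^bsub>R\<^esub>)"

definition lin_comb ::
  "('r, 's) ring_scheme \<Rightarrow> ('r, 'b, 'c) module_scheme \<Rightarrow> ('i \<Rightarrow> 'b) \<Rightarrow> ('i \<Rightarrow> 'r) \<Rightarrow> 'b" where
  "lin_comb R M v h = (\<Oplus>\<^bsub>M\<^esub>i\<in>{i. h i \<noteq> \<zero>\<^bsub>R\<^esub>}. h i \<odot>\<^bsub>M\<^esub> v i)"

lemma fin_funs_support: "h \<in> fin_funs R J \<Longrightarrow> {i. h i \<noteq> \<zero>\<^bsub>R\<^esub>} \<subseteq> J"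
  unfolding fin_funs_def by blast

lemma fin_funs_finite: "h \<in> fin_funs R J \<Longrightarrow> finite {i. h i \<noteq> \<zero>\<^bsub>R\<^esub>}"
  unfolding fin_funs_def by blast

lemma fin_funs_carrier: "h \<in> fin_funs R J \<Longrightarrow> h i \<in> carrier R"
  unfolding fin_funs_def by blast

lemma fin_funs_mono: "J \<subseteq> K \<Longrightarrow> fin_funs R J \<subseteq> fin_funs R K"
  unfolding fin_funs_def by blast

context cring begin

lemma fin_funs_add:
  assumes "h \<in> fin_funs R J" "k \<in> fin_funs R J"
  shows "(\<lambda>i. h i \<oplus> k i) \<in> fin_funs R J"
proof -
  have "finite {i. h i \<oplus> k i \<noteq> \<zero>}"
  proof (rule finite_subset)
    show "{i. h i \<oplus> k i \<noteq> \<zero>} \<subseteq> {i. h i \<noteq> \<zero>} \<union> {i. k i \<noteq> \<zero>}" by auto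
  qed (use assms fin_funs_finite in auto)
  then show ?thesis using assms by (simp add: fin_funs_def)
qed

lemma fin_funs_scale:
  assumes "r \<in> carrier R" "h \<in> fin_funs R J"
  shows "(\<lambda>i. r \<otimes> h i) \<in> fin_funs R J"
proof -
  have "finite {i. r \<otimes> h i \<noteq> \<zero>}"
  proof (rule finite_subset)
    show "{i. r \<otimes> h i \<noteq> \<zero>} \<subseteq> {i. h i \<noteq> \<zero>}" using assms(1) by auto
  qed (use assms fin_funs_finite in auto)
  then show ?thesis using assms by (simp add: fin_funs_def)
qed

lemma fin_funs_zero: "(\<lambda>i. \<zero>) \<in> fin_funs R J"
  by (simp add: fin_funs_def)

lemma delta_mem: "i \<in> J \<Longrightarrow> delta R i \<in> fin_funs R J"
  by (auto simp: fin_funs_def delta_def intro: finite_subset[of _ "{i}"])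

end

context module begin

lemma lin_comb_superset:
  assumes "h \<in> fin_funs R J" "v \<in> J \<rightarrow> carrier M" "finite F" "{i. h i \<noteq> \<zero>} \<subseteq> F" "F \<subseteq> J"
  shows "lin_comb R M v h = (\<Oplus>\<^bsub>M\<^esub>i\<in>F. h i \<odot>\<^bsub>M\<^esub> v i)"
  unfolding lin_comb_def
proof (rule M.add.finprod_mono_neutral_cong_left[OF assms(3,4)])
  have v: "v i \<in> carrier M" if "i \<in> F" for i using that assms(2,5) by blast
  show "h i \<odot>\<^bsub>M\<^esub> v i = \<zero>\<^bsub>M\<^esub>" if "i \<in> F - {i. h i \<noteq> \<zero>}" for i
    using that v by simp
  show "(\<lambda>i. h i \<odot>\<^bsub>M\<^esub> v i) \<in> F \<rightarrow> carrier M"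
    using v fin_funs_carrier[OF assms(1)] by simp
qed simp

lemma lin_comb_mem:
  assumes "submodule T R M" "h \<in> fin_funs R J" "v \<in> J \<rightarrow> T"
  shows "lin_comb R M v h \<in> T"
proof -
  note T = submoduleE[OF assms(1)]
  have T0: "\<zero>\<^bsub>M\<^esub> \<in> T" using subgroup.one_closed[OF submodule.axioms(1)[OF assms(1)]] by simp
  have "(\<Oplus>\<^bsub>M\<^esub>i\<in>F. h i \<odot>\<^bsub>M\<^esub> v i) \<in> T" if "finite F" "F \<subseteq> J" for F
    using that
  proof (induction F)
    case empty
    then show ?case using T0 by simp
  next
    case (insert i F)
    have mem: "h j \<odot>\<^bsub>M\<^esub> v j \<in> T" if "j \<in> J" for j
      using that assms(3) T(4) fin_funs_carrier[OF assms(2)] by blast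
    then have "(\<Oplus>\<^bsub>M\<^esub>i\<in>insert i F. h i \<odot>\<^bsub>M\<^esub> v i) = h i \<odot>\<^bsub>M\<^esub> v i \<oplus>\<^bsub>M\<^esub> (\<Oplus>\<^bsub>M\<^esub>i\<in>F. h i \<odot>\<^bsub>M\<^esub> v i)"
      using insert T(1) by (intro M.finsum_insert) auto
    then show ?case using insert T(5) mem by simp
  qed
  then show ?thesis
    unfolding lin_comb_def using fin_funs_finite[OF assms(2)] fin_funs_support[OF assms(2)] by blast
qed

lemma lin_comb_closed:
  "\<lbrakk>h \<in> fin_funs R J; v \<in> J \<rightarrow> carrier M\<rbrakk> \<Longrightarrow> lin_comb R M v h \<in> carrier M"
  by (rule lin_comb_mem[OF carrier_is_submodule])

lemma lin_comb_add:
  assumes "h \<in> fin_funs R J" "k \<in> fin_funs R J" "v \<in> J \<rightarrow> carrier M"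
  shows "lin_comb R M v (\<lambda>i. h i \<oplus> k i) = lin_comb R M v h \<oplus>\<^bsub>M\<^esub> lin_comb R M v k"
proof -
  let ?F = "{i. h i \<noteq> \<zero>} \<union> {i. k i \<noteq> \<zero>}"
  have F: "finite ?F" "?F \<subseteq> J" using assms fin_funs_finite fin_funs_support by blast+
  have hk: "(\<lambda>i. h i \<oplus> k i) \<in> fin_funs R J" by (rule R.fin_funs_add[OF assms(1,2)])
  have c: "h i \<in> carrier R" "k i \<in> carrier R" for i
    by (rule fin_funs_carrier[OF assms(1)] fin_funs_carrier[OF assms(2)])+
  have v: "v i \<in> carrier M" if "i \<in> ?F" for i using that F(2) assms(3) by blast
  have "lin_comb R M v (\<lambda>i. h i \<oplus> k i) = (\<Oplus>\<^bsub>M\<^esub>i\<in>?F. (h i \<oplus> k i) \<odot>\<^bsub>M\<^esub> v i)"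
    by (rule lin_comb_superset[OF hk assms(3) F(1) _ F(2)]) auto
  also have "\<dots> = (\<Oplus>\<^bsub>M\<^esub>i\<in>?F. h i \<odot>\<^bsub>M\<^esub> v i \<oplus>\<^bsub>M\<^esub> k i \<odot>\<^bsub>M\<^esub> v i)"
    using c v by (intro M.finsum_cong' refl) (simp_all add: smult_l_distr)
  also have "\<dots> = (\<Oplus>\<^bsub>M\<^esub>i\<in>?F. h i \<odot>\<^bsub>M\<^esub> v i) \<oplus>\<^bsub>M\<^esub> (\<Oplus>\<^bsub>M\<^esub>i\<in>?F. k i \<odot>\<^bsub>M\<^esub> v i)"
    using c v by (intro M.finsum_addf) auto
  also have "(\<Oplus>\<^bsub>M\<^esub>i\<in>?F. h i \<odot>\<^bsub>M\<^esub> v i) = lin_comb R M v h"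
    by (rule lin_comb_superset[OF assms(1,3) F(1) _ F(2), symmetric]) auto
  also have "(\<Oplus>\<^bsub>M\<^esub>i\<in>?F. k i \<odot>\<^bsub>M\<^esub> v i) = lin_comb R M v k"
    by (rule lin_comb_superset[OF assms(2,3) F(1) _ F(2), symmetric]) auto
  finally show ?thesis .
qed

lemma lin_comb_scale:
  assumes "r \<in> carrier R" "h \<in> fin_funs R J" "v \<in> J \<rightarrow> carrier M"
  shows "lin_comb R M v (\<lambda>i. r \<otimes> h i) = r \<odot>\<^bsub>M\<^esub> lin_comb R M v h"
proof -
  let ?F = "{i. h i \<noteq> \<zero>}"
  have F: "finite ?F" "?F \<subseteq> J" using assms fin_funs_finite fin_funs_support by blast+
  have c: "h i \<in> carrier R" for i by (rule fin_funs_carrier[OF assms(2)])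
  have v: "v i \<in> carrier M" if "i \<in> ?F" for i using that F(2) assms(3) by blast
  have "lin_comb R M v (\<lambda>i. r \<otimes> h i) = (\<Oplus>\<^bsub>M\<^esub>i\<in>?F. (r \<otimes> h i) \<odot>\<^bsub>M\<^esub> v i)"
    by (rule lin_comb_superset[OF R.fin_funs_scale[OF assms(1,2)] assms(3) F(1) _ F(2)]) (use assms(1) in auto)
  also have "\<dots> = (\<Oplus>\<^bsub>M\<^esub>i\<in>?F. r \<odot>\<^bsub>M\<^esub> (h i \<odot>\<^bsub>M\<^esub> v i))"
    using c v assms(1) by (intro M.finsum_cong' refl) (simp_all add: smult_assoc1)
  also have "\<dots> = r \<odot>\<^bsub>M\<^esub> (\<Oplus>\<^bsub>M\<^esub>i\<in>?F. h i \<odot>\<^bsub>M\<^esub> v i)"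
    by (rule finsum_smult_ldistr[symmetric, OF F(1) assms(1)]) (use c v in auto)
  finally show ?thesis by (simp add: lin_comb_def)
qed

lemma lin_comb_zero: "lin_comb R M v (\<lambda>i. \<zero>) = \<zero>\<^bsub>M\<^esub>"
  by (simp add: lin_comb_def)

lemma lin_comb_delta:
  assumes "v i \<in> carrier M"
  shows "lin_comb R M v (delta R i) = v i"
proof -
  have "lin_comb R M v (delta R i) = (\<Oplus>\<^bsub>M\<^esub>j\<in>{i}. delta R i j \<odot>\<^bsub>M\<^esub> v j)"
    by (rule lin_comb_superset[of _ "{i}"]) (use assms R.delta_mem[of i "{i}"] in \<open>auto simp: delta_def\<close>)
  also have "\<dots> = v i" using assms by (simp add: delta_def)
  finally show ?thesis .
qed

lemma lin_comb_add_family: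
  assumes "h \<in> fin_funs R J" "v \<in> J \<rightarrow> carrier M" "w \<in> J \<rightarrow> carrier M"
  shows "lin_comb R M (\<lambda>i. v i \<oplus>\<^bsub>M\<^esub> w i) h = lin_comb R M v h \<oplus>\<^bsub>M\<^esub> lin_comb R M w h"
proof -
  let ?F = "{i. h i \<noteq> \<zero>}"
  have c: "h i \<in> carrier R" for i by (rule fin_funs_carrier[OF assms(1)])
  have v: "v i \<in> carrier M" "w i \<in> carrier M" if "i \<in> ?F" for i
    using that fin_funs_support[OF assms(1)] assms(2,3) by blast+
  have "lin_comb R M (\<lambda>i. v i \<oplus>\<^bsub>M\<^esub> w i) h = (\<Oplus>\<^bsub>M\<^esub>i\<in>?F. h i \<odot>\<^bsub>M\<^esub> v i \<oplus>\<^bsub>M\<^esub> h i \<odot>\<^bsub>M\<^esub> w i)"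
    unfolding lin_comb_def
    using c v by (intro M.finsum_cong' refl) (simp_all add: smult_r_distr)
  also have "\<dots> = lin_comb R M v h \<oplus>\<^bsub>M\<^esub> lin_comb R M w h"
    unfolding lin_comb_def using c v by (intro M.finsum_addf) auto
  finally show ?thesis .
qed

lemma lin_comb_scale_family:
  assumes "h \<in> fin_funs R J" "v \<in> J \<rightarrow> carrier M" "r \<in> carrier R"
  shows "lin_comb R M (\<lambda>i. r \<odot>\<^bsub>M\<^esub> v i) h = r \<odot>\<^bsub>M\<^esub> lin_comb R M v h"
proof -
  let ?F = "{i. h i \<noteq> \<zero>}"
  have c: "h i \<in> carrier R" for i by (rule fin_funs_carrier[OF assms(1)])
  have v: "v i \<in> carrier M" if "i \<in> ?F" for i
    using that fin_funs_support[OF assms(1)] assms(2) by blast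
  have "lin_comb R M (\<lambda>i. r \<odot>\<^bsub>M\<^esub> v i) h = (\<Oplus>\<^bsub>M\<^esub>i\<in>?F. r \<odot>\<^bsub>M\<^esub> (h i \<odot>\<^bsub>M\<^esub> v i))"
    unfolding lin_comb_def
    using c v assms(3)
    by (intro M.finsum_cong' refl) (simp_all add: smult_assoc1[symmetric] R.m_comm)
  also have "\<dots> = r \<odot>\<^bsub>M\<^esub> lin_comb R M v h"
    unfolding lin_comb_def
    by (rule finsum_smult_ldistr[symmetric, OF fin_funs_finite[OF assms(1)] assms(3)]) (use c v in auto)
  finally show ?thesis .
qed

lemma lspan_eq_lin_combs:
  assumes "v \<in> J \<rightarrow> carrier M"
  shows "lspan R M (v ` J) = lin_comb R M v ` fin_funs R J"
proof
  show "lspan R M (v ` J) \<subseteq> lin_comb R M v ` fin_funs R J"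
  proof
    fix x assume "x \<in> lspan R M (v ` J)"
    then show "x \<in> lin_comb R M v ` fin_funs R J"
    proof induction
      case zero
      show ?case by (rule image_eqI[of _ _ "\<lambda>i. \<zero>"]) (simp_all add: lin_comb_zero R.fin_funs_zero)
    next
      case (base x)
      then obtain i where i: "i \<in> J" "x = v i" by blast
      then have "v i \<in> carrier M" using assms by blast
      then show ?case
        using i lin_comb_delta[of v i] R.delta_mem[of i J] by (intro image_eqI[of _ _ "delta R i"]) simp_all
    next
      case (add x y)
      then show ?case
        using lin_comb_add[OF _ _ assms, symmetric] R.fin_funs_add[of _ J] by (auto intro!: image_eqI)
    next
      case (smult r x)
      then show ?case
        using lin_comb_scale[OF _ _ assms, symmetric] R.fin_funs_scale[of _ _ J] by (auto intro!: image_eqI)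
    qed
  qed
  show "lin_comb R M v ` fin_funs R J \<subseteq> lspan R M (v ` J)"
  proof
    fix x assume "x \<in> lin_comb R M v ` fin_funs R J"
    then obtain h where h: "h \<in> fin_funs R J" "x = lin_comb R M v h" by blast
    have "v ` J \<subseteq> carrier M" using assms by blast
    then show "x \<in> lspan R M (v ` J)"
      unfolding h(2) by (rule lin_comb_mem[OF lspan_submodule h(1)]) (auto intro: lspan.base)
  qed
qed

end

context lie_superalgebra begin

text \<open>
  Padding a finite coefficient family by zeros replaces the quantification over finite index sets by
  one over coefficient functions, which form a module themselves.
\<close>

lemma basis_family_iff:
  fixes v :: "'i \<Rightarrow> 'b"
  shows "basis_family R L J v \<longleftrightarrow> v \<in> J \<rightarrow> carrier L \<and>
     (\<forall>h\<in>fin_funs R J. lin_comb R L v h = \<zero>\<^bsub>L\<^esub> \<longrightarrow> h = (\<lambda>i. \<zero>)) \<and>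
     carrier L \<subseteq> lspan R L (v ` J)"
proof (cases "v \<in> J \<rightarrow> carrier L")
  case v: True
  have mod: "module R L" by (rule module_axioms)
  define pad where "pad F c = (\<lambda>i. if i \<in> F then c i else \<zero>)" for F :: "'i set" and c
  have pad: "pad F c \<in> fin_funs R J" "(\<Oplus>\<^bsub>L\<^esub>i\<in>F. c i \<odot>\<^bsub>L\<^esub> v i) = lin_comb R L v (pad F c)"
    if F: "finite F" "F \<subseteq> J" "c \<in> F \<rightarrow> carrier R" for F c
  proof -
    have sup: "{i. pad F c i \<noteq> \<zero>} \<subseteq> F" by (auto simp: pad_def)
    show p: "pad F c \<in> fin_funs R J"
      using F finite_subset[OF sup F(1)] by (auto simp: fin_funs_def pad_def)
    have "(\<Oplus>\<^bsub>L\<^esub>i\<in>F. c i \<odot>\<^bsub>L\<^esub> v i) = (\<Oplus>\<^bsub>L\<^esub>i\<in>F. pad F c i \<odot>\<^bsub>L\<^esub> v i)"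
    proof (rule M.finsum_cong'[OF refl])
      show "(\<lambda>i. pad F c i \<odot>\<^bsub>L\<^esub> v i) \<in> F \<rightarrow> carrier L"
        using v F(2) fin_funs_carrier[OF p] by (auto simp: Pi_iff subset_iff)
    qed (simp add: pad_def)
    then show "(\<Oplus>\<^bsub>L\<^esub>i\<in>F. c i \<odot>\<^bsub>L\<^esub> v i) = lin_comb R L v (pad F c)"
      using lin_comb_superset[OF p v F(1) sup F(2)] by simp
  qed
  have indep: "(\<forall>F c. finite F \<and> F \<subseteq> J \<and> c \<in> F \<rightarrow> carrier R \<and> (\<Oplus>\<^bsub>L\<^esub>i\<in>F. c i \<odot>\<^bsub>L\<^esub> v i) = \<zero>\<^bsub>L\<^esub> \<longrightarrow>
      (\<forall>i\<in>F. c i = \<zero>)) \<longleftrightarrow>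
      (\<forall>h\<in>fin_funs R J. lin_comb R L v h = \<zero>\<^bsub>L\<^esub> \<longrightarrow> h = (\<lambda>i. \<zero>))" (is "?indep \<longleftrightarrow> ?indep'")
  proof
    assume L: ?indep
    show ?indep'
    proof (intro ballI impI)
      fix h assume h: "h \<in> fin_funs R J" "lin_comb R L v h = \<zero>\<^bsub>L\<^esub>"
      have "\<forall>i\<in>{i. h i \<noteq> \<zero>}. h i = \<zero>"
      proof (rule L[THEN spec, THEN spec, THEN mp], intro conjI)
        show "finite {i. h i \<noteq> \<zero>}" by (rule fin_funs_finite[OF h(1)])
        show "{i. h i \<noteq> \<zero>} \<subseteq> J" by (rule fin_funs_support[OF h(1)])
        show "h \<in> {i. h i \<noteq> \<zero>} \<rightarrow> carrier R" using fin_funs_carrier[OF h(1)] by simp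
        show "(\<Oplus>\<^bsub>L\<^esub>i\<in>{i. h i \<noteq> \<zero>}. h i \<odot>\<^bsub>L\<^esub> v i) = \<zero>\<^bsub>L\<^esub>" using h(2) by (simp only: lin_comb_def)
      qed
      then show "h = (\<lambda>i. \<zero>)" by blast
    qed
  next
    assume L: ?indep'
    show ?indep
    proof (intro allI impI ballI, elim conjE)
      fix F c i assume F: "finite F" "F \<subseteq> J" "c \<in> F \<rightarrow> carrier R" "(\<Oplus>\<^bsub>L\<^esub>i\<in>F. c i \<odot>\<^bsub>L\<^esub> v i) = \<zero>\<^bsub>L\<^esub>"
        and i: "i \<in> F"
      have "pad F c = (\<lambda>i. \<zero>)"
        using L[THEN bspec, OF pad(1)[OF F(1-3)]] pad(2)[OF F(1-3)] F(4) by simp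
      then have "pad F c i = \<zero>" by (rule fun_cong)
      then show "c i = \<zero>" using i by (simp add: pad_def)
    qed
  qed
  have spanning: "(\<forall>x\<in>carrier L. \<exists>F c. finite F \<and> F \<subseteq> J \<and> c \<in> F \<rightarrow> carrier R \<and>
      x = (\<Oplus>\<^bsub>L\<^esub>i\<in>F. c i \<odot>\<^bsub>L\<^esub> v i)) \<longleftrightarrow> carrier L \<subseteq> lspan R L (v ` J)" (is "?span \<longleftrightarrow> ?span'")
  proof
    assume L: ?span
    show ?span'
    proof
      fix x assume "x \<in> carrier L"
      from bspec[OF L this] obtain F c where F: "finite F" "F \<subseteq> J" "c \<in> F \<rightarrow> carrier R"
        "x = (\<Oplus>\<^bsub>L\<^esub>i\<in>F. c i \<odot>\<^bsub>L\<^esub> v i)"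
        by (elim exE conjE)
      show "x \<in> lspan R L (v ` J)"
        unfolding lspan_eq_lin_combs[OF v] F(4) pad(2)[OF F(1-3)] by (intro imageI pad(1) F)
    qed
  next
    assume L: ?span'
    show ?span
    proof
      fix x assume "x \<in> carrier L"
      with L have "x \<in> lin_comb R L v ` fin_funs R J"
        unfolding lspan_eq_lin_combs[OF v] by (rule subsetD)
      then obtain h where h: "h \<in> fin_funs R J" "x = lin_comb R L v h" by (elim imageE)
      show "\<exists>F c. finite F \<and> F \<subseteq> J \<and> c \<in> F \<rightarrow> carrier R \<and> x = (\<Oplus>\<^bsub>L\<^esub>i\<in>F. c i \<odot>\<^bsub>L\<^esub> v i)"
      proof (intro exI conjI)
        show "x = (\<Oplus>\<^bsub>L\<^esub>i\<in>{i. h i \<noteq> \<zero>}. h i \<odot>\<^bsub>L\<^esub> v i)" using h(2) by (simp add: lin_comb_def)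
        show "h \<in> {i. h i \<noteq> \<zero>} \<rightarrow> carrier R" using fin_funs_carrier[OF h(1)] by simp
      qed (rule fin_funs_finite[OF h(1)] fin_funs_support[OF h(1)])+
    qed
  qed
  show ?thesis unfolding basis_family_def by (simp only: mod v indep spanning simp_thms)
qed (simp add: basis_family_def)

end

text \<open>
  The free module on \<open>J\<close>, with basis elements graded by \<open>q\<close>. The bracket \<open>b\<close> is a parameter because it will be
  defined through linear combinations in the underlying module.
\<close>

definition free_super ::
  "('r, 's) ring_scheme \<Rightarrow> 'i set \<Rightarrow> ('i \<Rightarrow> nat) \<Rightarrow> (('i \<Rightarrow> 'r) \<Rightarrow> ('i \<Rightarrow> 'r) \<Rightarrow> ('i \<Rightarrow> 'r))
    \<Rightarrow> ('r, 'i \<Rightarrow> 'r) superalgebra" where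
  "free_super R J q b = \<lparr>carrier = fin_funs R J, monoid.mult = undefined, monoid.one = undefined,
     ring.zero = (\<lambda>i. \<zero>\<^bsub>R\<^esub>), ring.add = (\<lambda>h k i. h i \<oplus>\<^bsub>R\<^esub> k i),
     module.smult = (\<lambda>r h i. r \<otimes>\<^bsub>R\<^esub> h i), bracket = b,
     even_part = fin_funs R {i \<in> J. q i = 0}, odd_part = fin_funs R {i \<in> J. q i = 1}\<rparr>"

lemma free_super_simps [simp]:
  "carrier (free_super R J q b) = fin_funs R J" "\<zero>\<^bsub>free_super R J q b\<^esub> = (\<lambda>i. \<zero>\<^bsub>R\<^esub>)"
  "h \<oplus>\<^bsub>free_super R J q b\<^esub> k = (\<lambda>i. h i \<oplus>\<^bsub>R\<^esub> k i)" "r \<odot>\<^bsub>free_super R J q b\<^esub> h = (\<lambda>i. r \<otimes>\<^bsub>R\<^esub> h i)"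
  "bracket (free_super R J q b) = b"
  by (simp_all add: free_super_def)

lemma free_super_homog: "d \<in> {0, 1} \<Longrightarrow> homog (free_super R J q b) d = fin_funs R {i \<in> J. q i = d}"
  by (auto simp: homog_def free_super_def)

lemma lin_comb_free_super:
  "lin_comb R (free_super R J q b) = lin_comb R (free_super R J q' b')"
  by (simp add: lin_comb_def finsum_def free_super_def fun_eq_iff)

context cring begin

lemma free_super_module: "module R (free_super R J q b)"
proof (rule moduleI)
  show "cring R" by (rule cring_axioms)
  show "abelian_group (free_super R J q b)"
  proof (rule abelian_groupI)
    fix h assume "h \<in> carrier (free_super R J q b)"
    then have h: "h \<in> fin_funs R J" by simp
    then have "(\<lambda>i. \<ominus> \<one> \<otimes> h i) \<in> fin_funs R J" by (intro fin_funs_scale) simp_all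
    moreover have "(\<lambda>i. \<ominus> \<one> \<otimes> h i \<oplus> h i) = (\<lambda>i. \<zero>)"
      using fin_funs_carrier[OF h] by (simp add: l_minus l_neg)
    ultimately show "\<exists>k\<in>carrier (free_super R J q b). k \<oplus>\<^bsub>free_super R J q b\<^esub> h = \<zero>\<^bsub>free_super R J q b\<^esub>"
      by (intro bexI[of _ "\<lambda>i. \<ominus> \<one> \<otimes> h i"]) simp_all
  next
    fix f g h
    assume f: "f \<in> carrier (free_super R J q b)" and g: "g \<in> carrier (free_super R J q b)"
    then have c: "f i \<in> carrier R" "g i \<in> carrier R" for i using fin_funs_carrier by fastforce+
    show "f \<oplus>\<^bsub>free_super R J q b\<^esub> g = g \<oplus>\<^bsub>free_super R J q b\<^esub> f"
      using c by (simp add: a_comm)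
    assume "h \<in> carrier (free_super R J q b)"
    then have d: "h i \<in> carrier R" for i using fin_funs_carrier by fastforce
    show "f \<oplus>\<^bsub>free_super R J q b\<^esub> g \<oplus>\<^bsub>free_super R J q b\<^esub> h = f \<oplus>\<^bsub>free_super R J q b\<^esub> (g \<oplus>\<^bsub>free_super R J q b\<^esub> h)"
      using c d by (simp add: a_assoc)
  next
    fix f assume "f \<in> carrier (free_super R J q b)"
    then have "f i \<in> carrier R" for i using fin_funs_carrier by fastforce
    then show "\<zero>\<^bsub>free_super R J q b\<^esub> \<oplus>\<^bsub>free_super R J q b\<^esub> f = f" by simp
  qed (simp_all add: fin_funs_add fin_funs_zero)
next
  fix r s f assume r: "r \<in> carrier R" and s: "s \<in> carrier R" and "f \<in> carrier (free_super R J q b)"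
  then have f: "f i \<in> carrier R" for i using fin_funs_carrier by fastforce
  show "(r \<oplus> s) \<odot>\<^bsub>free_super R J q b\<^esub> f =
      r \<odot>\<^bsub>free_super R J q b\<^esub> f \<oplus>\<^bsub>free_super R J q b\<^esub> s \<odot>\<^bsub>free_super R J q b\<^esub> f"
    using r s f by (simp add: l_distr)
  show "(r \<otimes> s) \<odot>\<^bsub>free_super R J q b\<^esub> f = r \<odot>\<^bsub>free_super R J q b\<^esub> (s \<odot>\<^bsub>free_super R J q b\<^esub> f)"
    using r s f by (simp add: m_assoc)
next
  fix r f g assume r: "r \<in> carrier R" and "f \<in> carrier (free_super R J q b)" "g \<in> carrier (free_super R J q b)"
  then have f: "f i \<in> carrier R" "g i \<in> carrier R" for i using fin_funs_carrier by fastforce+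
  show "r \<odot>\<^bsub>free_super R J q b\<^esub> (f \<oplus>\<^bsub>free_super R J q b\<^esub> g) =
      r \<odot>\<^bsub>free_super R J q b\<^esub> f \<oplus>\<^bsub>free_super R J q b\<^esub> r \<odot>\<^bsub>free_super R J q b\<^esub> g"
    using r f by (simp add: r_distr)
next
  fix f assume "f \<in> carrier (free_super R J q b)"
  then have f: "f i \<in> carrier R" for i using fin_funs_carrier by fastforce
  show "\<one> \<odot>\<^bsub>free_super R J q b\<^esub> f = f" using f by simp
qed (simp_all add: fin_funs_scale)

lemma free_super_submodule:
  assumes "K \<subseteq> J" shows "submodule (fin_funs R K) R (free_super R J q b)"
proof -
  interpret F: module R "free_super R J q b" by (rule free_super_module)
  show ?thesis
  proof (rule F.submoduleI)
    show "fin_funs R K \<subseteq> carrier (free_super R J q b)" using fin_funs_mono[OF assms] by simp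
    fix h assume h: "h \<in> fin_funs R K"
    then have hJ: "h \<in> carrier (free_super R J q b)" using fin_funs_mono[OF assms] by auto
    have "\<ominus>\<^bsub>free_super R J q b\<^esub> h = \<ominus>\<^bsub>free_super R J q b\<^esub> (\<one> \<odot>\<^bsub>free_super R J q b\<^esub> h)"
      by (simp only: F.smult_one[OF hJ])
    also have "\<dots> = (\<ominus> \<one>) \<odot>\<^bsub>free_super R J q b\<^esub> h"
      by (rule F.smult_l_minus[OF one_closed hJ, symmetric])
    finally show "\<ominus>\<^bsub>free_super R J q b\<^esub> h \<in> fin_funs R K" using fin_funs_scale[OF _ h] by simp
  qed (simp_all add: fin_funs_zero fin_funs_add fin_funs_scale)
qed

lemma lin_comb_delta_id:
  assumes h: "h \<in> fin_funs R J"
  shows "lin_comb R (free_super R J q b) (delta R) h = h"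
proof
  fix j
  let ?M = "free_super R J q b"
  interpret F: module R ?M by (rule free_super_module)
  have eval: "(\<Oplus>\<^bsub>?M\<^esub>i\<in>S. h i \<odot>\<^bsub>?M\<^esub> delta R i) j = (if j \<in> S then h j else \<zero>)"
    if "finite S" "S \<subseteq> J" for S
    using that
  proof (induction S)
    case (insert i S)
    have c: "h k \<odot>\<^bsub>?M\<^esub> delta R k \<in> carrier ?M" if "k \<in> insert i S" for k
      using that insert.prems delta_mem[of k J] fin_funs_carrier[OF h] by (intro F.smult_closed) auto
    have "(\<Oplus>\<^bsub>?M\<^esub>i\<in>insert i S. h i \<odot>\<^bsub>?M\<^esub> delta R i) =
        h i \<odot>\<^bsub>?M\<^esub> delta R i \<oplus>\<^bsub>?M\<^esub> (\<Oplus>\<^bsub>?M\<^esub>i\<in>S. h i \<odot>\<^bsub>?M\<^esub> delta R i)"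
      using insert.hyps c by (intro F.M.finsum_insert) blast+
    then show ?case
      using insert fin_funs_carrier[OF h] by (auto simp: delta_def)
  qed simp
  show "lin_comb R ?M (delta R) h j = h j"
    unfolding lin_comb_def
    using eval[OF fin_funs_finite[OF h] fin_funs_support[OF h]] by simp
qed

definition of_integer :: "int \<Rightarrow> 'a" where
  "of_integer n = add_pow R n \<one>"

lemma of_integer_closed [simp]: "of_integer n \<in> carrier R"
  by (simp add: of_integer_def)

lemma of_integer_add: "of_integer (m + n) = of_integer m \<oplus> of_integer n"
  by (simp add: of_integer_def add.int_pow_mult)

lemma of_integer_0 [simp]: "of_integer 0 = \<zero>"
  using add_pow_int_ge[of 0 R \<one>] by (simp add: of_integer_def)

lemma of_integer_1 [simp]: "of_integer 1 = \<one>"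
  by (simp add: of_integer_def add.int_pow_1)

lemma of_integer_mult: "of_integer (m * n) = of_integer m \<otimes> of_integer n"
proof -
  have "of_integer m \<otimes> of_integer n = add_pow R m (add_pow R n \<one>)"
    unfolding of_integer_def by (subst add_pow_ldistr_int) simp_all
  also have "\<dots> = add_pow R (n * m) \<one>" by (rule add.int_pow_pow) simp
  finally show ?thesis by (simp add: of_integer_def mult.commute)
qed

lemma of_integer_uminus: "of_integer (- n) = \<ominus> of_integer n"
  by (simp add: of_integer_def add.int_pow_neg)

lemma of_integer_sgn_pow: "of_integer (sgn_pow \<Z> n) = sgn_pow R n"
proof (induction n)
  case (Suc n)
  have "sgn_pow \<Z> (Suc n) = - sgn_pow \<Z> n" by (simp add: sgn_pow_int)
  then have "of_integer (sgn_pow \<Z> (Suc n)) = \<ominus> sgn_pow R n" by (simp only: of_integer_uminus Suc)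
  also have "\<dots> = sgn_pow R (Suc n)" by (simp add: sgn_pow_def r_minus)
  finally show ?case .
qed (simp add: sgn_pow_int sgn_pow_def)

end

section \<open>Extension of scalars\<close>

text \<open>
  A Lie superalgebra over the integers that is free as a module on a homogeneous family \<open>v\<close> yields one
  over any commutative ring \<open>R\<close>, with the same structure constants. This is the tensor product with \<open>R\<close>,
  realized on finitely supported functions \<open>J \<Rightarrow> R\<close>.
\<close>

locale scalar_extension = G: lie_superalgebra int_ring G + R: cring R
  for G :: "(int, 'g, 'c) superalgebra_scheme" and R :: "('r, 's) ring_scheme" (structure) +
  fixes J :: "'i set" and v :: "'i \<Rightarrow> 'g" and q :: "'i \<Rightarrow> nat"
  assumes basis: "basis_family \<Z> G J v"
    and q_degree: "q \<in> J \<rightarrow> {0, 1}"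
    and v_homog: "i \<in> J \<Longrightarrow> v i \<in> homog G (q i)"
begin

lemma v_closed: "v \<in> J \<rightarrow> carrier G"
  using basis by (simp add: G.basis_family_iff)

lemma v_closed': "i \<in> J \<Longrightarrow> v i \<in> carrier G"
  using v_closed by blast

abbreviation "comb \<equiv> lin_comb \<Z> G v"

lemma comb_inj:
  assumes h: "h \<in> fin_funs \<Z> J" and k: "k \<in> fin_funs \<Z> J" and eq: "comb h = comb k"
  shows "h = k"
proof -
  have k': "(\<lambda>i. - 1 * k i) \<in> fin_funs \<Z> J"
    using cring.fin_funs_scale[OF int_is_cring _ k, of "- 1"] by simp
  have hk: "(\<lambda>i. h i + - 1 * k i) \<in> fin_funs \<Z> J"
    using cring.fin_funs_add[OF int_is_cring h k'] by simp
  have "comb (\<lambda>i. h i + - 1 * k i) = comb h \<oplus>\<^bsub>G\<^esub> (- 1) \<odot>\<^bsub>G\<^esub> comb k"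
    using G.lin_comb_add[OF h k' v_closed] G.lin_comb_scale[OF _ k v_closed, of "- 1"] by simp
  also have "(- 1) \<odot>\<^bsub>G\<^esub> comb k = \<ominus>\<^bsub>G\<^esub> comb k"
    using G.smult_l_minus[of 1 "comb k"] G.smult_one[of "comb k"] G.lin_comb_closed[OF k v_closed]
    by (simp add: int_a_inv_eq)
  also have "comb h \<oplus>\<^bsub>G\<^esub> \<ominus>\<^bsub>G\<^esub> comb k = \<zero>\<^bsub>G\<^esub>"
    using eq G.lin_comb_closed[OF k v_closed] by (simp add: G.M.r_neg)
  finally have "(\<lambda>i. h i + - 1 * k i) = (\<lambda>i. 0)"
    using basis hk by (simp add: G.basis_family_iff)
  then have "h i + - 1 * k i = 0" for i by (rule fun_cong)
  then show ?thesis by (simp add: fun_eq_iff)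
qed

definition coord :: "'g \<Rightarrow> 'i \<Rightarrow> int" where
  "coord x = (SOME h. h \<in> fin_funs \<Z> J \<and> comb h = x)"

lemma coord:
  assumes "x \<in> carrier G"
  shows "coord x \<in> fin_funs \<Z> J" "comb (coord x) = x"
proof -
  have "\<exists>h. h \<in> fin_funs \<Z> J \<and> comb h = x"
    using assms basis G.lspan_eq_lin_combs[OF v_closed] by (auto simp: G.basis_family_iff)
  from someI_ex[OF this] show "coord x \<in> fin_funs \<Z> J" "comb (coord x) = x"
    by (simp_all add: coord_def)
qed

lemma coord_eqI: "h \<in> fin_funs \<Z> J \<Longrightarrow> comb h = x \<Longrightarrow> coord x = h"
  using coord[of x] G.lin_comb_closed[OF _ v_closed] comb_inj by blast

lemma coord_add: "\<lbrakk>x \<in> carrier G; y \<in> carrier G\<rbrakk> \<Longrightarrow> coord (x \<oplus>\<^bsub>G\<^esub> y) = (\<lambda>i. coord x i + coord y i)"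
  using cring.fin_funs_add[OF int_is_cring, of "coord x" J "coord y"] G.lin_comb_add[of "coord x" J "coord y" v]
  by (intro coord_eqI) (simp_all add: coord v_closed)

lemma coord_scale: "x \<in> carrier G \<Longrightarrow> coord (z \<odot>\<^bsub>G\<^esub> x) = (\<lambda>i. z * coord x i)"
  using cring.fin_funs_scale[OF int_is_cring, of z "coord x" J] G.lin_comb_scale[of z "coord x" J v]
  by (intro coord_eqI) (simp_all add: coord v_closed)

lemma coord_zero: "coord \<zero>\<^bsub>G\<^esub> = (\<lambda>i. 0)"
  using cring.fin_funs_zero[OF int_is_cring, of J] G.lin_comb_zero[of v]
  by (intro coord_eqI) simp_all

lemma coord_basis: "i \<in> J \<Longrightarrow> coord (v i) = delta \<Z> i"
  using cring.delta_mem[OF int_is_cring, of i J] G.lin_comb_delta[of v i]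
  by (intro coord_eqI) (simp_all add: v_closed')

lemma homog_disjoint:
  assumes "d \<in> {0, 1}" "e \<in> {0, 1}" "d \<noteq> e" "x \<in> homog G d" "x \<in> homog G e"
  shows "x = \<zero>\<^bsub>G\<^esub>"
proof -
  have "x \<in> even_part G \<inter> odd_part G"
    using assms by (elim insertE emptyE) (simp_all add: homog_def)
  then show ?thesis unfolding G.parts_disjoint by (rule singletonD)
qed

text \<open>
  Split the linear combination that represents \<open>x\<close> by degree. The part in the wrong degree is homogeneous
  of both degrees, hence zero.
\<close>

lemma coord_homog:
  assumes d: "d \<in> {0, 1}" and x: "x \<in> homog G d"
  shows "coord x \<in> fin_funs \<Z> {i \<in> J. q i = d}"
proof -
  have xc: "x \<in> carrier G" using x G.homog_carrier by blast
  let ?h = "\<lambda>e i. if q i = e then coord x i else 0"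
  have h: "?h e \<in> fin_funs \<Z> {i \<in> J. q i = e}" for e
  proof -
    have "finite {i. ?h e i \<noteq> 0}"
      by (rule finite_subset[OF _ fin_funs_finite[OF coord(1)[OF xc]]]) auto
    then show ?thesis using coord(1)[OF xc] unfolding fin_funs_def by simp
  qed
  have hJ: "?h e \<in> fin_funs \<Z> J" for e using h[of e] fin_funs_mono[of "{i \<in> J. q i = e}" J \<Z>] by blast
  have comb_h: "comb (?h e) \<in> homog G e" if "e \<in> {0, 1}" for e
    by (rule G.lin_comb_mem[OF G.homog_submodule h]) (use v_homog in auto)
  have cc: "comb (?h e) \<in> carrier G" for e by (rule G.lin_comb_closed[OF hJ v_closed])
  let ?e = "1 - d"
  have e: "?e \<in> {0, 1}" "d \<noteq> ?e" using d by auto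
  have "coord x i = ?h d i + ?h ?e i" for i
  proof (cases "i \<in> J")
    case True
    then have "q i = 0 \<or> q i = 1" using q_degree by blast
    then show ?thesis using d by auto
  next
    case False
    then have "coord x i = 0" using coord(1)[OF xc] by (simp add: fin_funs_def)
    then show ?thesis by simp
  qed
  then have "coord x = (\<lambda>i. ?h d i \<oplus>\<^bsub>\<Z>\<^esub> ?h ?e i)" by (simp add: fun_eq_iff)
  then have sum: "x = comb (?h d) \<oplus>\<^bsub>G\<^esub> comb (?h ?e)"
    using coord(2)[OF xc] G.lin_comb_add[OF hJ[of d] hJ[of ?e] v_closed] by simp
  have "b = \<ominus>\<^bsub>G\<^esub> a \<oplus>\<^bsub>G\<^esub> y" if "y = a \<oplus>\<^bsub>G\<^esub> b" "a \<in> carrier G" "b \<in> carrier G" for a b y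
    using that by (simp add: G.M.a_assoc[symmetric] G.M.l_neg)
  from this[OF sum cc cc] have "comb (?h ?e) = \<ominus>\<^bsub>G\<^esub> comb (?h d) \<oplus>\<^bsub>G\<^esub> x" .
  then have "comb (?h ?e) \<in> homog G d"
    using comb_h[OF d] x G.submoduleE(3,5)[OF G.homog_submodule[of d]] by simp
  then have zero: "comb (?h ?e) = \<zero>\<^bsub>G\<^esub>"
    by (rule homog_disjoint[OF d e]) (rule comb_h[OF e(1)])
  have "a = y" if "y = a \<oplus>\<^bsub>G\<^esub> b" "b = \<zero>\<^bsub>G\<^esub>" "a \<in> carrier G" for a b y
    using that by simp
  from coord_eqI[OF hJ this[OF sum zero cc]] have "coord x = ?h d" .
  then show ?thesis using h[of d] by simp
qed

text \<open>
  The canonical map \<open>x \<mapsto> 1 \<otimes> x\<close> into the extended module.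
\<close>

definition base :: "'g \<Rightarrow> 'i \<Rightarrow> 'r" where
  "base x = (\<lambda>i. R.of_integer (coord x i))"

lemma base_mem:
  assumes "x \<in> carrier G" "coord x \<in> fin_funs \<Z> K"
  shows "base x \<in> fin_funs R K"
proof -
  have "finite {i. base x i \<noteq> \<zero>}"
    by (rule finite_subset[OF _ fin_funs_finite[OF assms(2)]]) (auto simp: base_def)
  then show ?thesis using assms(2) by (auto simp: fin_funs_def base_def)
qed

definition struct :: "'i \<Rightarrow> 'i \<Rightarrow> 'i \<Rightarrow> 'r" where
  "struct i j = (if i \<in> J \<and> j \<in> J then base (bracket G (v i) (v j)) else (\<lambda>i. \<zero>))"

text \<open>
  The bilinear extension of the structure constants. The argument \<open>undefined\<close> is a
  placeholder for the bracket that is just being defined; linear combinations depend on the module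
  structure only, so it can afterwards be replaced by \<open>ext_bracket\<close> itself (\<open>ext_bracket_eq\<close>).
\<close>

definition ext_bracket :: "('i \<Rightarrow> 'r) \<Rightarrow> ('i \<Rightarrow> 'r) \<Rightarrow> 'i \<Rightarrow> 'r" where
  "ext_bracket f g = lin_comb R (free_super R J q undefined)
     (\<lambda>i. lin_comb R (free_super R J q undefined) (struct i) g) f"

abbreviation "E \<equiv> free_super R J q ext_bracket"

sublocale E: module R E
  by (rule R.free_super_module)

lemma ext_bracket_eq: "ext_bracket f g = lin_comb R E (\<lambda>i. lin_comb R E (struct i) g) f"
  by (subst ext_bracket_def) (simp only: lin_comb_free_super[of R J q undefined q ext_bracket])

lemma base_hom:
  assumes "x \<in> carrier G"
  shows "y \<in> carrier G \<Longrightarrow> base (x \<oplus>\<^bsub>G\<^esub> y) = base x \<oplus>\<^bsub>E\<^esub> base y"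
    "base (z \<odot>\<^bsub>G\<^esub> x) = R.of_integer z \<odot>\<^bsub>E\<^esub> base x" "base x \<in> carrier E"
  using assms base_mem coord(1)
  by (simp_all add: base_def coord_add coord_scale R.of_integer_add R.of_integer_mult)

lemma base_zero: "base \<zero>\<^bsub>G\<^esub> = \<zero>\<^bsub>E\<^esub>"
  by (simp add: base_def coord_zero)

lemma base_basis: "i \<in> J \<Longrightarrow> base (v i) = delta R i"
  by (auto simp: base_def coord_basis delta_def)

lemma struct_closed: "struct i j \<in> fin_funs R J"
  using base_hom(3)[OF G.bracket_closed[OF v_closed' v_closed'], of i j] R.fin_funs_zero[of J]
  by (simp add: struct_def)

lemma mem_imp_family: "(\<And>i. w i \<in> fin_funs R J) \<Longrightarrow> w \<in> K \<rightarrow> carrier E"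
  by simp

lemma inner_closed: "g \<in> carrier E \<Longrightarrow> lin_comb R E (struct i) g \<in> carrier E"
  by (rule E.lin_comb_closed[of _ J]) (simp_all add: struct_closed)

lemma ext_closed: "\<lbrakk>f \<in> carrier E; g \<in> carrier E\<rbrakk> \<Longrightarrow> ext_bracket f g \<in> carrier E"
  unfolding ext_bracket_eq[of f g] using inner_closed[of g]
  by (intro E.lin_comb_closed[of _ J]) simp_all

lemma ext_add_left:
  assumes "f \<in> carrier E" "f' \<in> carrier E" "g \<in> carrier E"
  shows "ext_bracket (f \<oplus>\<^bsub>E\<^esub> f') g = ext_bracket f g \<oplus>\<^bsub>E\<^esub> ext_bracket f' g"
proof -
  have "(\<lambda>i. lin_comb R E (struct i) g) \<in> J \<rightarrow> carrier E" using inner_closed[OF assms(3)] by blast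
  from E.lin_comb_add[OF _ _ this, of f f'] show ?thesis
    using assms
    unfolding ext_bracket_eq[of f g] ext_bracket_eq[of f' g] ext_bracket_eq[of "f \<oplus>\<^bsub>E\<^esub> f'" g]
    by simp
qed

lemma ext_scale_left:
  assumes "r \<in> carrier R" "f \<in> carrier E" "g \<in> carrier E"
  shows "ext_bracket (r \<odot>\<^bsub>E\<^esub> f) g = r \<odot>\<^bsub>E\<^esub> ext_bracket f g"
proof -
  have "(\<lambda>i. lin_comb R E (struct i) g) \<in> J \<rightarrow> carrier E" using inner_closed[OF assms(3)] by blast
  from E.lin_comb_scale[OF assms(1) _ this, of f] show ?thesis
    using assms unfolding ext_bracket_eq[of f g] ext_bracket_eq[of "r \<odot>\<^bsub>E\<^esub> f" g] by simp
qed

lemma ext_add_right: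
  assumes "f \<in> carrier E" "g \<in> carrier E" "g' \<in> carrier E"
  shows "ext_bracket f (g \<oplus>\<^bsub>E\<^esub> g') = ext_bracket f g \<oplus>\<^bsub>E\<^esub> ext_bracket f g'"
proof -
  have f: "f \<in> fin_funs R J" and gg: "g \<in> fin_funs R J" "g' \<in> fin_funs R J" using assms by simp_all
  have "lin_comb R E (struct i) (g \<oplus>\<^bsub>E\<^esub> g') = lin_comb R E (struct i) g \<oplus>\<^bsub>E\<^esub> lin_comb R E (struct i) g'" for i
    using E.lin_comb_add[OF gg mem_imp_family[OF struct_closed]] by simp
  moreover have "(\<lambda>i. lin_comb R E (struct i) g) \<in> J \<rightarrow> carrier E" "(\<lambda>i. lin_comb R E (struct i) g') \<in> J \<rightarrow> carrier E"
    using inner_closed assms by blast+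
  ultimately show ?thesis
    unfolding ext_bracket_eq[of f g] ext_bracket_eq[of f g'] ext_bracket_eq[of f "g \<oplus>\<^bsub>E\<^esub> g'"]
    by (simp only: E.lin_comb_add_family[OF f])
qed

lemma ext_scale_right:
  assumes "r \<in> carrier R" "f \<in> carrier E" "g \<in> carrier E"
  shows "ext_bracket f (r \<odot>\<^bsub>E\<^esub> g) = r \<odot>\<^bsub>E\<^esub> ext_bracket f g"
proof -
  have f: "f \<in> fin_funs R J" and g: "g \<in> fin_funs R J" using assms by simp_all
  have "lin_comb R E (struct i) (r \<odot>\<^bsub>E\<^esub> g) = r \<odot>\<^bsub>E\<^esub> lin_comb R E (struct i) g" for i
    using E.lin_comb_scale[OF assms(1) g mem_imp_family[OF struct_closed]] by simp
  moreover have "(\<lambda>i. lin_comb R E (struct i) g) \<in> J \<rightarrow> carrier E"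
    using inner_closed assms by blast+
  ultimately show ?thesis
    unfolding ext_bracket_eq[of f g] ext_bracket_eq[of f "r \<odot>\<^bsub>E\<^esub> g"]
    by (simp only: E.lin_comb_scale_family[OF f _ assms(1)])
qed

lemma delta_closed: "i \<in> J \<Longrightarrow> delta R i \<in> carrier E"
  using R.delta_mem[of i J] by simp

lemma ext_delta:
  assumes "i \<in> J" "j \<in> J"
  shows "ext_bracket (delta R i) (delta R j) = base (bracket G (v i) (v j))"
proof -
  have "ext_bracket (delta R i) (delta R j) = lin_comb R E (struct i) (delta R j)"
    unfolding ext_bracket_eq[of "delta R i" "delta R j"]
    by (rule E.lin_comb_delta) (rule inner_closed[OF delta_closed[OF assms(2)]])
  also have "\<dots> = struct i j" by (rule E.lin_comb_delta) (simp add: struct_closed)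
  finally show ?thesis using assms by (simp add: struct_def)
qed

lemma G_induct [consumes 1, case_names zero basis add scale]:
  assumes "x \<in> carrier G" "Q \<zero>\<^bsub>G\<^esub>" "\<And>i. i \<in> J \<Longrightarrow> Q (v i)"
    "\<And>x y. \<lbrakk>x \<in> carrier G; y \<in> carrier G; Q x; Q y\<rbrakk> \<Longrightarrow> Q (x \<oplus>\<^bsub>G\<^esub> y)"
    "\<And>z x. \<lbrakk>x \<in> carrier G; Q x\<rbrakk> \<Longrightarrow> Q (z \<odot>\<^bsub>G\<^esub> x)"
  shows "Q x"
proof -
  have "x \<in> lspan \<Z> G (v ` J)" using basis assms(1) by (auto simp: G.basis_family_iff)
  then have "x \<in> carrier G \<and> Q x"
  proof induction
    case (base x)
    then show ?case using v_closed' assms(3) by blast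
  next
    case (add x y)
    then show ?case using assms(4) by simp
  next
    case (smult r x)
    then show ?case using assms(5) by simp
  qed (simp add: assms(2))
  then show ?thesis ..
qed

lemma ext_zero:
  assumes "f \<in> carrier E"
  shows "ext_bracket \<zero>\<^bsub>E\<^esub> f = \<zero>\<^bsub>E\<^esub>" "ext_bracket f \<zero>\<^bsub>E\<^esub> = \<zero>\<^bsub>E\<^esub>"
  using ext_scale_left[OF R.zero_closed assms assms] ext_scale_right[OF R.zero_closed assms assms]
    E.smult_l_null[OF assms] E.smult_l_null[OF ext_closed[OF assms assms]] by simp_all

text \<open>
  By definition this holds for basis elements, and both sides are biadditive. Iterated brackets of basis
  vectors are thereby images of iterated brackets over the integers, so identities carry over.
\<close>

lemma base_bracket:
  assumes "x \<in> carrier G" "y \<in> carrier G"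
  shows "base (bracket G x y) = ext_bracket (base x) (base y)"
  using assms(1)
proof (induction x rule: G_induct)
  case zero
  show ?case
    by (simp only: base_zero G.bracket_zero(1)[OF assms(2)] ext_zero(1)[OF base_hom(3)[OF assms(2)]])
next
  case (basis i)
  note vi = v_closed'[OF basis]
  note bi = base_hom(3)[OF vi]
  from assms(2) show ?case
  proof (induction y rule: G_induct)
    case zero
    show ?case by (simp only: base_zero G.bracket_zero(2)[OF vi] ext_zero(2)[OF bi])
  next
    case (basis j)
    then show ?case using \<open>i \<in> J\<close> by (simp add: ext_delta base_basis)
  next
    case (add x y)
    then show ?case
      by (simp only: G.bracket_add_right[OF vi] base_hom(1,3) G.bracket_closed[OF vi] ext_add_right[OF bi])
  next
    case (scale z x)
    then show ?case
      by (simp only: G.bracket_smult_right[OF _ vi] int_Zcarr base_hom(2,3) G.bracket_closed[OF vi]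
          ext_scale_right[OF _ bi] R.of_integer_closed)
  qed
next
  case (add x y')
  then show ?case
    using assms(2)
    by (simp only: G.bracket_add_left base_hom(1,3) G.bracket_closed ext_add_left)
next
  case (scale z x)
  then show ?case
    using assms(2)
    by (simp only: G.bracket_smult_left int_Zcarr base_hom(2,3) G.bracket_closed
        ext_scale_left R.of_integer_closed)
qed

text \<open>
  The expressions occurring in multilinear identities are linear in each argument by the closure rules
  below, so the identities follow from their validity on basis vectors (\<open>linear_vanishes\<close>).
\<close>

definition linear :: "(('i \<Rightarrow> 'r) \<Rightarrow> ('i \<Rightarrow> 'r)) \<Rightarrow> bool" where
  "linear T \<longleftrightarrow> (\<forall>x\<in>carrier E. T x \<in> carrier E) \<and>
     (\<forall>x\<in>carrier E. \<forall>y\<in>carrier E. T (x \<oplus>\<^bsub>E\<^esub> y) = T x \<oplus>\<^bsub>E\<^esub> T y) \<and>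
     (\<forall>r\<in>carrier R. \<forall>x\<in>carrier E. T (r \<odot>\<^bsub>E\<^esub> x) = r \<odot>\<^bsub>E\<^esub> T x)"

lemma linear_id: "linear (\<lambda>x. x)"
  by (simp add: linear_def del: free_super_simps)

lemma linear_left: "\<lbrakk>linear T; c \<in> carrier E\<rbrakk> \<Longrightarrow> linear (\<lambda>x. ext_bracket (T x) c)"
  by (simp add: linear_def ext_closed ext_add_left ext_scale_left del: free_super_simps)

lemma linear_right: "\<lbrakk>linear T; c \<in> carrier E\<rbrakk> \<Longrightarrow> linear (\<lambda>x. ext_bracket c (T x))"
  by (simp add: linear_def ext_closed ext_add_right ext_scale_right del: free_super_simps)

lemma linear_add: "\<lbrakk>linear T; linear U\<rbrakk> \<Longrightarrow> linear (\<lambda>x. T x \<oplus>\<^bsub>E\<^esub> U x)"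
  by (simp add: linear_def E.M.a_ac E.smult_r_distr del: free_super_simps)

lemma linear_scale: "\<lbrakk>linear T; s \<in> carrier R\<rbrakk> \<Longrightarrow> linear (\<lambda>x. s \<odot>\<^bsub>E\<^esub> T x)"
  by (simp add: linear_def E.smult_r_distr E.smult_assoc1[symmetric] R.m_comm del: free_super_simps)

lemmas linear_intros = linear_id linear_left linear_right linear_add linear_scale

lemma E_induct [consumes 2, case_names zero basis add scale]:
  assumes "f \<in> fin_funs R K" "K \<subseteq> J" "Q \<zero>\<^bsub>E\<^esub>" "\<And>i. i \<in> K \<Longrightarrow> Q (delta R i)"
    "\<And>x y. \<lbrakk>x \<in> fin_funs R K; y \<in> fin_funs R K; Q x; Q y\<rbrakk> \<Longrightarrow> Q (x \<oplus>\<^bsub>E\<^esub> y)"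
    "\<And>r x. \<lbrakk>r \<in> carrier R; x \<in> fin_funs R K; Q x\<rbrakk> \<Longrightarrow> Q (r \<odot>\<^bsub>E\<^esub> x)"
  shows "Q f"
proof -
  note sub = R.free_super_submodule[OF assms(2), of q ext_bracket]
  note closed = E.submoduleE[OF sub]
  have span: "submodule (lspan R E (delta R ` K)) R E"
    using delta_closed assms(2) by (intro E.lspan_submodule) blast
  have "lin_comb R E (delta R) f \<in> lspan R E (delta R ` K)"
    by (rule E.lin_comb_mem[OF span assms(1)]) (auto intro: lspan.base)
  moreover have "f \<in> fin_funs R J" using assms(1) fin_funs_mono[OF assms(2)] by blast
  ultimately have "f \<in> lspan R E (delta R ` K)" by (simp add: R.lin_comb_delta_id)
  then have "f \<in> fin_funs R K \<and> Q f"
  proof induction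
    case zero
    then show ?case using assms(3) R.fin_funs_zero[of K] by simp
  next
    case (base x)
    then show ?case using assms(4) R.delta_mem[of _ K] by blast
  next
    case (add x y)
    then show ?case using assms(5) closed(5) by blast
  next
    case (smult r x)
    then show ?case using assms(6) closed(4) by blast
  qed
  then show ?thesis ..
qed

lemma linear_vanishes:
  assumes "linear T" "K \<subseteq> J" "\<And>i. i \<in> K \<Longrightarrow> T (delta R i) = \<zero>\<^bsub>E\<^esub>" "f \<in> fin_funs R K"
  shows "T f = \<zero>\<^bsub>E\<^esub>"
proof -
  have K: "x \<in> carrier E" if "x \<in> fin_funs R K" for x using that fin_funs_mono[OF assms(2)] by auto
  have "T (\<zero> \<odot>\<^bsub>E\<^esub> \<zero>\<^bsub>E\<^esub>) = \<zero> \<odot>\<^bsub>E\<^esub> T \<zero>\<^bsub>E\<^esub>" "T \<zero>\<^bsub>E\<^esub> \<in> carrier E"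
    using assms(1) E.M.zero_closed R.zero_closed unfolding linear_def by blast+
  then have T0: "T \<zero>\<^bsub>E\<^esub> = \<zero>\<^bsub>E\<^esub>" by (simp only: E.smult_l_null E.M.zero_closed)
  from assms(4,2) show ?thesis
  proof (induction rule: E_induct)
    case (add x y)
    then have "T (x \<oplus>\<^bsub>E\<^esub> y) = T x \<oplus>\<^bsub>E\<^esub> T y" using assms(1) K unfolding linear_def by blast
    then show ?case by (simp only: add E.M.l_zero E.M.zero_closed)
  next
    case (scale r x)
    then have "T (r \<odot>\<^bsub>E\<^esub> x) = r \<odot>\<^bsub>E\<^esub> T x" using assms(1) K unfolding linear_def by blast
    then show ?case by (simp only: scale E.smult_r_null)
  qed (simp_all only: T0 assms(3))
qed

abbreviation "Jdeg d \<equiv> {i \<in> J. q i = d}"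

lemma deg_sub: "Jdeg d \<subseteq> J"
  by blast

lemma deg_closed: "f \<in> fin_funs R (Jdeg d) \<Longrightarrow> f \<in> carrier E"
  using fin_funs_mono[OF deg_sub, of R d] by auto

lemma deg_submodule: "submodule (fin_funs R (Jdeg d)) R E"
  by (rule R.free_super_submodule[OF deg_sub])

lemma v_deg: "i \<in> Jdeg d \<Longrightarrow> v i \<in> homog G d"
  using v_homog by blast

lemma sgn_pow_closed [simp]: "sgn_pow R n \<in> carrier R"
  by (simp add: sgn_pow_def)

lemma ext_homog:
  assumes ab: "a \<in> {0, 1}" "b \<in> {0, 1}" and f: "f \<in> fin_funs R (Jdeg a)" and g: "g \<in> fin_funs R (Jdeg b)"
  shows "ext_bracket f g \<in> fin_funs R (Jdeg ((a + b) mod 2))"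
proof -
  have d: "(a + b) mod 2 \<in> {0, 1}" by auto
  have "struct i j \<in> fin_funs R (Jdeg ((a + b) mod 2))" if i: "i \<in> Jdeg a" and j: "j \<in> Jdeg b" for i j
  proof -
    have h: "bracket G (v i) (v j) \<in> homog G ((a + b) mod 2)"
      by (rule G.bracket_homog[OF ab v_deg[OF i] v_deg[OF j]])
    then have "bracket G (v i) (v j) \<in> carrier G" using G.homog_carrier by blast
    from base_mem[OF this coord_homog[OF d h]] show ?thesis using i j by (simp add: struct_def)
  qed
  then have "lin_comb R E (struct i) g \<in> fin_funs R (Jdeg ((a + b) mod 2))" if "i \<in> Jdeg a" for i
    using that by (intro E.lin_comb_mem[OF deg_submodule g]) blast
  then show ?thesis
    unfolding ext_bracket_eq[of f g] by (intro E.lin_comb_mem[OF deg_submodule f]) blast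
qed

lemma ext_antisym_sum:
  assumes ab: "a \<in> {0, 1}" "b \<in> {0, 1}" and f: "f \<in> fin_funs R (Jdeg a)" and g: "g \<in> fin_funs R (Jdeg b)"
  shows "ext_bracket g f \<oplus>\<^bsub>E\<^esub> sgn_pow R (a * b) \<odot>\<^bsub>E\<^esub> ext_bracket f g = \<zero>\<^bsub>E\<^esub>"
proof (rule linear_vanishes[OF _ deg_sub _ f])
  show "linear (\<lambda>f. ext_bracket g f \<oplus>\<^bsub>E\<^esub> sgn_pow R (a * b) \<odot>\<^bsub>E\<^esub> ext_bracket f g)"
    by (intro linear_intros deg_closed[OF g] sgn_pow_closed)
  fix i assume i: "i \<in> Jdeg a"
  then have di: "delta R i \<in> carrier E" by (intro delta_closed) simp
  show "ext_bracket g (delta R i) \<oplus>\<^bsub>E\<^esub> sgn_pow R (a * b) \<odot>\<^bsub>E\<^esub> ext_bracket (delta R i) g = \<zero>\<^bsub>E\<^esub>"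
  proof (rule linear_vanishes[OF _ deg_sub _ g])
    show "linear (\<lambda>g. ext_bracket g (delta R i) \<oplus>\<^bsub>E\<^esub> sgn_pow R (a * b) \<odot>\<^bsub>E\<^esub> ext_bracket (delta R i) g)"
      by (intro linear_intros di sgn_pow_closed)
    fix j assume j: "j \<in> Jdeg b"
    have J: "i \<in> J" "j \<in> J" using i j by simp_all
    let ?x = "bracket G (v i) (v j)" and ?y = "bracket G (v j) (v i)" and ?s = "sgn_pow \<Z> (a * b)"
    have c: "?x \<in> carrier G" "?y \<in> carrier G" "?s \<odot>\<^bsub>G\<^esub> ?x \<in> carrier G"
      using G.bracket_closed v_closed' J by simp_all
    have "?y \<oplus>\<^bsub>G\<^esub> ?s \<odot>\<^bsub>G\<^esub> ?x = \<zero>\<^bsub>G\<^esub>"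
      using G.super_antisym[OF ab v_deg[OF i] v_deg[OF j]] c by (simp only: G.M.l_neg)
    then have "base (?y \<oplus>\<^bsub>G\<^esub> ?s \<odot>\<^bsub>G\<^esub> ?x) = \<zero>\<^bsub>E\<^esub>" by (simp only: base_zero)
    then show "ext_bracket (delta R j) (delta R i) \<oplus>\<^bsub>E\<^esub>
        sgn_pow R (a * b) \<odot>\<^bsub>E\<^esub> ext_bracket (delta R i) (delta R j) = \<zero>\<^bsub>E\<^esub>"
      using c J by (simp only: base_hom R.of_integer_sgn_pow ext_delta)
  qed
qed

lemma ext_antisym:
  assumes ab: "a \<in> {0, 1}" "b \<in> {0, 1}" and f: "f \<in> fin_funs R (Jdeg a)" and g: "g \<in> fin_funs R (Jdeg b)"
  shows "ext_bracket g f = \<ominus>\<^bsub>E\<^esub> (sgn_pow R (a * b) \<odot>\<^bsub>E\<^esub> ext_bracket f g)"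
  by (rule E.M.minus_equality[OF ext_antisym_sum[OF assms], symmetric])
    (intro E.smult_closed sgn_pow_closed ext_closed deg_closed[OF f] deg_closed[OF g])+

lemma ext_jacobi:
  assumes abc: "a \<in> {0, 1}" "b \<in> {0, 1}" "c \<in> {0, 1}"
    and f: "f \<in> fin_funs R (Jdeg a)" and g: "g \<in> fin_funs R (Jdeg b)" and h: "h \<in> fin_funs R (Jdeg c)"
  shows "sgn_pow R (a * c) \<odot>\<^bsub>E\<^esub> ext_bracket f (ext_bracket g h)
    \<oplus>\<^bsub>E\<^esub> sgn_pow R (b * a) \<odot>\<^bsub>E\<^esub> ext_bracket g (ext_bracket h f)
    \<oplus>\<^bsub>E\<^esub> sgn_pow R (c * b) \<odot>\<^bsub>E\<^esub> ext_bracket h (ext_bracket f g) = \<zero>\<^bsub>E\<^esub>"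
proof -
  let ?J = "\<lambda>f g h. sgn_pow R (a * c) \<odot>\<^bsub>E\<^esub> ext_bracket f (ext_bracket g h)
    \<oplus>\<^bsub>E\<^esub> sgn_pow R (b * a) \<odot>\<^bsub>E\<^esub> ext_bracket g (ext_bracket h f)
    \<oplus>\<^bsub>E\<^esub> sgn_pow R (c * b) \<odot>\<^bsub>E\<^esub> ext_bracket h (ext_bracket f g)"
  have lin: "linear (\<lambda>f. ?J f g h)" "linear (\<lambda>g. ?J f g h)" "linear (\<lambda>h. ?J f g h)"
    if "f \<in> carrier E" "g \<in> carrier E" "h \<in> carrier E" for f g h
    by (intro linear_intros ext_closed sgn_pow_closed that)+
  have basic: "?J (delta R i) (delta R j) (delta R k) = \<zero>\<^bsub>E\<^esub>"
    if i: "i \<in> Jdeg a" and j: "j \<in> Jdeg b" and k: "k \<in> Jdeg c" for i j k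
  proof -
    have J: "i \<in> J" "j \<in> J" "k \<in> J" using i j k by simp_all
    note v = v_closed'[OF J(1)] v_closed'[OF J(2)] v_closed'[OF J(3)]
    have "base (sgn_pow \<Z> (a * c) \<odot>\<^bsub>G\<^esub> bracket G (v i) (bracket G (v j) (v k))
        \<oplus>\<^bsub>G\<^esub> sgn_pow \<Z> (b * a) \<odot>\<^bsub>G\<^esub> bracket G (v j) (bracket G (v k) (v i))
        \<oplus>\<^bsub>G\<^esub> sgn_pow \<Z> (c * b) \<odot>\<^bsub>G\<^esub> bracket G (v k) (bracket G (v i) (v j))) = \<zero>\<^bsub>E\<^esub>"
      using G.super_jacobi[OF abc v_deg[OF i] v_deg[OF j] v_deg[OF k]] by (simp only: base_zero)
    then show ?thesis
      by (simp only: base_hom G.bracket_closed G.smult_closed int_Zcarr G.M.add.m_closed v base_bracket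
          base_basis J R.of_integer_sgn_pow)
  qed
  note closed = deg_closed[OF f] deg_closed[OF g] deg_closed[OF h]
  have dc: "delta R i \<in> carrier E" if "i \<in> Jdeg d" for i d using that by (intro delta_closed) simp
  show ?thesis
  proof (rule linear_vanishes[OF lin(1)[OF closed] deg_sub _ f])
    fix i assume i: "i \<in> Jdeg a"
    show "?J (delta R i) g h = \<zero>\<^bsub>E\<^esub>"
    proof (rule linear_vanishes[OF lin(2)[OF dc[OF i] closed(2,3)] deg_sub _ g])
      fix j assume j: "j \<in> Jdeg b"
      show "?J (delta R i) (delta R j) h = \<zero>\<^bsub>E\<^esub>"
        by (rule linear_vanishes[OF lin(3)[OF dc[OF i] dc[OF j] closed(3)] deg_sub _ h])
          (rule basic[OF i j])
    qed
  qed
qed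

text \<open>
  The square is not linear, but the mixed terms \<open>[x, y] + [y, x]\<close> of the square of a sum cancel by antisymmetry.
\<close>

lemma ext_even_square:
  assumes "f \<in> fin_funs R (Jdeg 0)"
  shows "ext_bracket f f = \<zero>\<^bsub>E\<^esub>"
  using assms deg_sub
proof (induction rule: E_induct)
  case zero
  show ?case by (rule ext_zero(1)[OF E.M.zero_closed])
next
  case (basis i)
  then have "v i \<in> even_part G" using v_deg[of i 0] by (simp add: homog_def)
  then show ?case using basis by (simp only: ext_delta deg_sub[THEN subsetD] G.even_square base_zero)
next
  case (add x y)
  note x = deg_closed[OF add(1)] and y = deg_closed[OF add(2)]
  have "ext_bracket y x = \<ominus>\<^bsub>E\<^esub> ext_bracket x y"
    using ext_antisym[OF _ _ add(1,2)] E.smult_one[OF ext_closed[OF x y]] by (simp add: sgn_pow_def del: free_super_simps)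
  then have "ext_bracket y x \<oplus>\<^bsub>E\<^esub> ext_bracket x y = \<zero>\<^bsub>E\<^esub>"
    using ext_closed[OF x y] by (simp only: E.M.l_neg)
  then show ?case
    using x y add(3,4) by (simp only: ext_add_left ext_add_right ext_closed E.M.add.m_closed E.M.l_zero E.M.r_zero E.M.zero_closed)
next
  case (scale r x)
  note x = deg_closed[OF scale(2)]
  show ?case
    using scale(1,3) x by (simp only: ext_scale_left ext_scale_right E.smult_closed E.smult_r_null ext_closed)
qed

text \<open>
  The mixed terms of the cube of a sum of two odd elements: their vanishing is the Jacobi identity for
  \<open>f, f, g\<close>, rewritten by antisymmetry with the even elements \<open>[f, f]\<close>, \<open>[f, g]\<close> and \<open>[g, f]\<close>.
\<close>

lemma ext_cube_polar:
  assumes f: "f \<in> fin_funs R (Jdeg 1)" and g: "g \<in> fin_funs R (Jdeg 1)"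
  shows "ext_bracket (ext_bracket f f) g \<oplus>\<^bsub>E\<^esub> ext_bracket (ext_bracket f g) f
    \<oplus>\<^bsub>E\<^esub> ext_bracket (ext_bracket g f) f = \<zero>\<^bsub>E\<^esub>"
proof -
  have swap: "sgn_pow R (1 * 1) \<odot>\<^bsub>E\<^esub> ext_bracket y (ext_bracket w z) = ext_bracket (ext_bracket w z) y"
    if w: "w \<in> fin_funs R (Jdeg 1)" and z: "z \<in> fin_funs R (Jdeg 1)" and y: "y \<in> fin_funs R (Jdeg 1)" for w z y
  proof -
    let ?x = "ext_bracket w z"
    have x: "?x \<in> fin_funs R (Jdeg 0)" using ext_homog[OF _ _ w z] by simp
    have c: "ext_bracket ?x y \<in> carrier E"
      by (intro ext_closed deg_closed[OF w] deg_closed[OF z] deg_closed[OF y])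
    have "ext_bracket y ?x = \<ominus>\<^bsub>E\<^esub> ext_bracket ?x y"
      using ext_antisym[OF _ _ x y] E.smult_one[OF c] by (simp add: sgn_pow_def del: free_super_simps)
    moreover have "sgn_pow R (1 * 1) = \<ominus> \<one>" by (simp add: sgn_pow_def)
    ultimately show ?thesis
      using c by (simp only: E.smult_l_minus[OF R.one_closed] E.smult_one E.M.a_inv_closed E.M.minus_minus)
  qed
  have "ext_bracket (ext_bracket f g) f \<oplus>\<^bsub>E\<^esub> ext_bracket (ext_bracket g f) f
    \<oplus>\<^bsub>E\<^esub> ext_bracket (ext_bracket f f) g = \<zero>\<^bsub>E\<^esub>"
    using ext_jacobi[OF _ _ _ f f g] by (simp only: insert_iff simp_thms swap f g)
  then show ?thesis
    using deg_closed[OF f] deg_closed[OF g] by (simp add: E.M.a_ac ext_closed del: free_super_simps)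
qed

lemma ext_odd_cube:
  assumes "f \<in> fin_funs R (Jdeg 1)"
  shows "ext_bracket (ext_bracket f f) f = \<zero>\<^bsub>E\<^esub>"
  using assms deg_sub
proof (induction rule: E_induct)
  case zero
  show ?case by (simp only: ext_zero E.M.zero_closed)
next
  case (basis i)
  then have "v i \<in> odd_part G" using v_deg[of i 1] by (simp add: homog_def)
  then have "base (bracket G (bracket G (v i) (v i)) (v i)) = \<zero>\<^bsub>E\<^esub>"
    by (simp only: G.odd_cube base_zero)
  moreover have "i \<in> J" "v i \<in> carrier G" using basis v_closed' by simp_all
  ultimately show ?case by (simp only: base_bracket G.bracket_closed base_basis)
next
  case (add x y)
  note x = deg_closed[OF add(1)] and y = deg_closed[OF add(2)]
  let ?b = ext_bracket
  have c: "?b (?b r s) t \<in> carrier E" if "r \<in> carrier E" "s \<in> carrier E" "t \<in> carrier E" for r s t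
    using that by (intro ext_closed)
  have "?b (?b (x \<oplus>\<^bsub>E\<^esub> y) (x \<oplus>\<^bsub>E\<^esub> y)) (x \<oplus>\<^bsub>E\<^esub> y) =
    (?b (?b x x) x \<oplus>\<^bsub>E\<^esub> ?b (?b y y) y) \<oplus>\<^bsub>E\<^esub>
    ((?b (?b x x) y \<oplus>\<^bsub>E\<^esub> ?b (?b x y) x \<oplus>\<^bsub>E\<^esub> ?b (?b y x) x) \<oplus>\<^bsub>E\<^esub>
     (?b (?b y y) x \<oplus>\<^bsub>E\<^esub> ?b (?b y x) y \<oplus>\<^bsub>E\<^esub> ?b (?b x y) y))"
    using x y c by (simp add: ext_add_left ext_add_right ext_closed E.M.a_ac del: free_super_simps)
  then show ?case
    by (simp only: add(3,4) ext_cube_polar[OF add(1,2)] ext_cube_polar[OF add(2,1)] E.M.l_zero E.M.zero_closed)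
next
  case (scale r x)
  note x = deg_closed[OF scale(2)]
  show ?case
    using scale(1,3) x by (simp only: ext_scale_left ext_scale_right E.smult_closed E.smult_r_null ext_closed)
qed

theorem lie_superalgebra: "lie_superalgebra R E"
proof (intro lie_superalgebra.intro lie_superalgebra_axioms.intro R.free_super_module, goal_cases)
  have even: "even_part E = fin_funs R (Jdeg 0)" and odd: "odd_part E = fin_funs R (Jdeg 1)"
    by (simp_all add: free_super_def)
  note hom = free_super_homog[of _ R J q ext_bracket]
  {
    case 1 show ?case unfolding even by (rule deg_submodule)
  next
    case 2 show ?case unfolding odd by (rule deg_submodule)
  next
    case 3
    have "f \<in> even_part E <+>\<^bsub>E\<^esub> odd_part E" if "f \<in> fin_funs R J" for f
    proof -
      let ?h = "\<lambda>d i. if q i = d then f i else \<zero>"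
      have h: "?h d \<in> fin_funs R (Jdeg d)" for d
      proof -
        have "finite {i. ?h d i \<noteq> \<zero>}"
          by (rule finite_subset[OF _ fin_funs_finite[OF that]]) auto
        then show ?thesis using that unfolding fin_funs_def by simp
      qed
      have "f i = ?h 0 i \<oplus> ?h 1 i" for i
      proof (cases "i \<in> J")
        case True
        then have "q i = 0 \<or> q i = 1" using q_degree by blast
        then show ?thesis using fin_funs_carrier[OF that, of i] by auto
      next
        case False
        then have "f i = \<zero>" using that by (simp add: fin_funs_def)
        then show ?thesis by simp
      qed
      then have "f = ?h 0 \<oplus>\<^bsub>E\<^esub> ?h 1" by (simp add: fun_eq_iff)
      then show ?thesis unfolding even odd set_add_def' using h[of 0] h[of 1] by blast
    qed
    moreover have "f \<in> carrier E" if f: "f \<in> even_part E <+>\<^bsub>E\<^esub> odd_part E" for f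
    proof -
      obtain g h where "g \<in> fin_funs R (Jdeg 0)" "h \<in> fin_funs R (Jdeg 1)" "f = g \<oplus>\<^bsub>E\<^esub> h"
        using f unfolding even odd set_add_def' by blast
      then show ?thesis using deg_closed E.M.add.m_closed by blast
    qed
    ultimately show ?case by (intro equalityI subsetI) (simp_all only: free_super_simps(1))
  next
    case 4
    have "f = (\<lambda>i. \<zero>)" if "f \<in> fin_funs R (Jdeg 0)" "f \<in> fin_funs R (Jdeg 1)" for f
    proof
      fix i show "f i = \<zero>" using that unfolding fin_funs_def by (cases "q i = 0") simp_all
    qed
    then have "fin_funs R (Jdeg 0) \<inter> fin_funs R (Jdeg 1) \<subseteq> {\<lambda>i. \<zero>}" by blast
    then show ?case
      unfolding even odd free_super_simps(2)
      using R.fin_funs_zero[of "Jdeg 0"] R.fin_funs_zero[of "Jdeg 1"] by blast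
  next
    case 5 then show ?case using ext_closed by simp
  next
    case 6 then show ?case by (simp only: free_super_simps(5) ext_add_left)
  next
    case 7 then show ?case by (simp only: free_super_simps(5) ext_add_right)
  next
    case 8 then show ?case by (simp only: free_super_simps(5) ext_scale_left)
  next
    case 9 then show ?case by (simp only: free_super_simps(5) ext_scale_right)
  next
    case (10 i j f g)
    have "(i + j) mod 2 \<in> {0, 1}" by auto
    then show ?case using ext_homog[of i j f g] 10 by (simp only: hom free_super_simps(5))
  next
    case (11 i j f g)
    then show ?case using ext_antisym[of i j f g] by (simp only: hom free_super_simps(5))
  next
    case (12 i j k f g h)
    then show ?case using ext_jacobi[of i j k f g h] by (simp only: hom free_super_simps(5))
  next
    case (13 f)
    then show ?case using ext_even_square unfolding even by (simp only: free_super_simps(5))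
  next
    case (14 f)
    then show ?case using ext_odd_cube unfolding odd by (simp only: free_super_simps(5))
  }
qed

lemma ext_homog_delta: "i \<in> J \<Longrightarrow> delta R i \<in> homog E (q i)"
  using free_super_homog[of "q i" R J q ext_bracket] q_degree R.delta_mem[of i "Jdeg (q i)"] by blast

lemma ext_independent: "\<lbrakk>h \<in> fin_funs R J; lin_comb R E (delta R) h = \<zero>\<^bsub>E\<^esub>\<rbrakk> \<Longrightarrow> h = (\<lambda>i. \<zero>)"
  by (simp add: R.lin_comb_delta_id)

lemma ext_delta_eq_delta:
  assumes "i \<in> J" "j \<in> J" "k \<in> J" "bracket G (v i) (v j) = v k"
  shows "ext_bracket (delta R i) (delta R j) = delta R k"
  using assms by (simp only: ext_delta base_basis)

end

section \<open>Subalgebras and transport of structure\<close>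

definition sub_super :: "('r, 'b, 'c) superalgebra_scheme \<Rightarrow> 'b set \<Rightarrow> ('r, 'b, 'c) superalgebra_scheme" where
  "sub_super L S = L\<lparr>carrier := S, even_part := even_part L \<inter> S, odd_part := odd_part L \<inter> S\<rparr>"

lemma sub_super_simps [simp]:
  "carrier (sub_super L S) = S" "\<zero>\<^bsub>sub_super L S\<^esub> = \<zero>\<^bsub>L\<^esub>" "x \<oplus>\<^bsub>sub_super L S\<^esub> y = x \<oplus>\<^bsub>L\<^esub> y"
  "r \<odot>\<^bsub>sub_super L S\<^esub> x = r \<odot>\<^bsub>L\<^esub> x" "bracket (sub_super L S) = bracket L"
  "even_part (sub_super L S) = even_part L \<inter> S" "odd_part (sub_super L S) = odd_part L \<inter> S"
  by (simp_all add: sub_super_def)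

lemma homog_sub_super [simp]: "homog (sub_super L S) i = homog L i \<inter> S"
  by (simp add: homog_def)

lemma lspan_sub_super: "lspan R L H \<subseteq> lspan R (sub_super L S) H"
proof
  fix x assume "x \<in> lspan R L H"
  then show "x \<in> lspan R (sub_super L S) H"
  proof induction
    case zero
    show ?case using lspan.zero[of "sub_super L S" R H] by simp
  next
    case (add x y)
    then show ?case using lspan.add[of x R "sub_super L S" H y] by simp
  next
    case (smult r x)
    then show ?case using lspan.smult[of r R x "sub_super L S" H] by simp
  qed (rule lspan.base)
qed

context lie_superalgebra begin

lemma sub_super_module:
  assumes S: "submodule S R L"
  shows "module R (sub_super L S)"
proof -
  note SE = submoduleE[OF S]
  have S0: "\<zero>\<^bsub>L\<^esub> \<in> S" using subgroup.one_closed[OF submodule.axioms(1)[OF S]] by simp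
  have c: "x \<in> carrier L" if "x \<in> S" for x using SE(1) that by blast
  show ?thesis
  proof (rule moduleI[OF R.cring_axioms])
    show "abelian_group (sub_super L S)"
    proof (rule abelian_groupI)
      fix x assume "x \<in> carrier (sub_super L S)"
      then show "\<exists>y\<in>carrier (sub_super L S). y \<oplus>\<^bsub>sub_super L S\<^esub> x = \<zero>\<^bsub>sub_super L S\<^esub>"
        using SE(3) c by (intro bexI[of _ "\<ominus>\<^bsub>L\<^esub> x"]) (simp_all add: M.l_neg)
    qed (simp_all add: S0 c SE(5) M.a_ac)
  qed (simp_all add: c SE(4) smult_l_distr smult_r_distr smult_assoc1)
qed

lemma sub_super_a_inv:
  assumes S: "submodule S R L" and "x \<in> S"
  shows "\<ominus>\<^bsub>sub_super L S\<^esub> x = \<ominus>\<^bsub>L\<^esub> x"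
proof -
  interpret S: module R "sub_super L S" by (rule sub_super_module[OF S])
  note SE = submoduleE[OF S]
  have "x \<in> carrier L" using assms SE(1) by blast
  then show ?thesis
    using assms SE(3) by (intro S.M.minus_equality) (simp_all add: M.l_neg)
qed

lemma submodule_Int_sub_super:
  assumes S: "submodule S R L" and T: "submodule T R L"
  shows "submodule (T \<inter> S) R (sub_super L S)"
proof -
  interpret S: module R "sub_super L S" by (rule sub_super_module[OF S])
  note SE = submoduleE[OF S] and TE = submoduleE[OF T]
  have "\<zero>\<^bsub>L\<^esub> \<in> S" "\<zero>\<^bsub>L\<^esub> \<in> T"
    using subgroup.one_closed[OF submodule.axioms(1)[OF S]] subgroup.one_closed[OF submodule.axioms(1)[OF T]]
    by simp_all
  then show ?thesis
    by (intro S.submoduleI) (simp_all add: sub_super_a_inv[OF S] SE(3-5) TE(3-5))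
qed

lemma sub_super:
  assumes S: "submodule S R L"
    and br: "\<And>x y. \<lbrakk>x \<in> S; y \<in> S\<rbrakk> \<Longrightarrow> bracket L x y \<in> S"
    and graded: "S \<subseteq> (even_part L \<inter> S) <+>\<^bsub>L\<^esub> (odd_part L \<inter> S)"
  shows "lie_superalgebra R (sub_super L S)"
proof -
  note SE = submoduleE[OF S]
  have S0: "\<zero>\<^bsub>L\<^esub> \<in> S" using subgroup.one_closed[OF submodule.axioms(1)[OF S]] by simp
  have c: "x \<in> carrier L" if "x \<in> S" for x using SE(1) that by blast
  show ?thesis
  proof (intro lie_superalgebra.intro lie_superalgebra_axioms.intro sub_super_module S, goal_cases)
    case 1 show ?case using submodule_Int_sub_super[OF S even_submodule] by simp
  next
    case 2 show ?case using submodule_Int_sub_super[OF S odd_submodule] by simp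
  next
    case 3
    have "(even_part L \<inter> S) <+>\<^bsub>L\<^esub> (odd_part L \<inter> S) \<subseteq> S"
      using SE(5) unfolding set_add_def' by blast
    then show ?case using graded unfolding sub_super_simps set_add_def' by blast
  next
    case 4 show ?case using parts_disjoint S0 unfolding sub_super_simps by blast
  next
    case (10 i j a b)
    then show ?case using bracket_homog[of i j a b] br by simp
  next
    case (11 i j a b)
    then have "sgn_pow R (i * j) \<odot>\<^bsub>L\<^esub> bracket L a b \<in> S" using SE(4) br by simp
    then show ?case using super_antisym[of i j a b] 11 by (simp add: sub_super_a_inv[OF S])
  next
    case (12 i j k a b c)
    then show ?case using super_jacobi[of i j k a b c] by simp
  qed (use br in \<open>simp_all add: c bracket_add_left bracket_add_right bracket_smult_left bracket_smult_right
      even_square odd_cube\<close>)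
qed

text \<open>
  A span of homogeneous elements contains the homogeneous components of its members, which is what makes
  it a graded submodule.
\<close>

lemma lspan_graded:
  assumes H: "H \<subseteq> even_part L \<union> odd_part L"
  shows "lspan R L H \<subseteq> (even_part L \<inter> lspan R L H) <+>\<^bsub>L\<^esub> (odd_part L \<inter> lspan R L H)"
proof
  let ?E = "even_part L \<inter> lspan R L H" and ?O = "odd_part L \<inter> lspan R L H"
  note e = submoduleE[OF even_submodule] and o = submoduleE[OF odd_submodule]
  have e0: "\<zero>\<^bsub>L\<^esub> \<in> even_part L" and o0: "\<zero>\<^bsub>L\<^esub> \<in> odd_part L"
    using subgroup.one_closed[OF submodule.axioms(1)[OF even_submodule]]
      subgroup.one_closed[OF submodule.axioms(1)[OF odd_submodule]] by simp_all
  have intro: "x \<in> ?E <+>\<^bsub>L\<^esub> ?O" if "a \<in> ?E" "b \<in> ?O" "x = a \<oplus>\<^bsub>L\<^esub> b" for x a b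
    unfolding set_add_def' using that by blast
  fix x assume "x \<in> lspan R L H"
  then show "x \<in> ?E <+>\<^bsub>L\<^esub> ?O"
  proof induction
    case zero
    show ?case by (rule intro[of "\<zero>\<^bsub>L\<^esub>" "\<zero>\<^bsub>L\<^esub>"]) (simp_all add: e0 o0 lspan.zero)
  next
    case (base x)
    then consider "x \<in> even_part L" | "x \<in> odd_part L" using H by blast
    then show ?case
    proof cases
      case 1
      then have "x \<in> carrier L" using e(1) by blast
      then show ?thesis using 1 base o0
        by (intro intro[of x "\<zero>\<^bsub>L\<^esub>"]) (simp_all add: lspan.zero lspan.base)
    next
      case 2
      then have "x \<in> carrier L" using o(1) by blast
      then show ?thesis using 2 base e0
        by (intro intro[of "\<zero>\<^bsub>L\<^esub>" x]) (simp_all add: lspan.zero lspan.base)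
    qed
  next
    case (add x y)
    obtain a b where ab: "a \<in> ?E" "b \<in> ?O" "x = a \<oplus>\<^bsub>L\<^esub> b" using add.IH(1) unfolding set_add_def' by blast
    obtain a' b' where ab': "a' \<in> ?E" "b' \<in> ?O" "y = a' \<oplus>\<^bsub>L\<^esub> b'" using add.IH(2) unfolding set_add_def' by blast
    have "a \<in> carrier L" "b \<in> carrier L" "a' \<in> carrier L" "b' \<in> carrier L" using ab ab' e(1) o(1) by blast+
    then have "x \<oplus>\<^bsub>L\<^esub> y = (a \<oplus>\<^bsub>L\<^esub> a') \<oplus>\<^bsub>L\<^esub> (b \<oplus>\<^bsub>L\<^esub> b')" unfolding ab(3) ab'(3) by (simp add: M.a_ac)
    then show ?case
      using ab ab' e(5) o(5) by (intro intro[of "a \<oplus>\<^bsub>L\<^esub> a'" "b \<oplus>\<^bsub>L\<^esub> b'"]) (simp_all add: lspan.add)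
  next
    case (smult r x)
    obtain a b where ab: "a \<in> ?E" "b \<in> ?O" "x = a \<oplus>\<^bsub>L\<^esub> b" using smult.IH unfolding set_add_def' by blast
    have "a \<in> carrier L" "b \<in> carrier L" using ab e(1) o(1) by blast+
    then have "r \<odot>\<^bsub>L\<^esub> x = r \<odot>\<^bsub>L\<^esub> a \<oplus>\<^bsub>L\<^esub> r \<odot>\<^bsub>L\<^esub> b" unfolding ab(3) using smult.hyps by (simp add: smult_r_distr)
    then show ?case
      using ab smult.hyps e(4) o(4) by (intro intro[of "r \<odot>\<^bsub>L\<^esub> a" "r \<odot>\<^bsub>L\<^esub> b"]) (simp_all add: lspan.smult)
  qed
qed

end

text \<open>
  The structure of \<open>L\<close> moved along an injection \<open>j\<close>. Its left inverse \<open>k\<close> is a parameter, so that a subalgebra and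
  the whole algebra are transported by the same operations.
\<close>

definition transport ::
  "('b \<Rightarrow> 'm) \<Rightarrow> ('m \<Rightarrow> 'b) \<Rightarrow> ('r, 'b, 'c) superalgebra_scheme \<Rightarrow> ('r, 'm) superalgebra" where
  "transport j k L = \<lparr>carrier = j ` carrier L, monoid.mult = undefined, monoid.one = undefined,
     ring.zero = j \<zero>\<^bsub>L\<^esub>, ring.add = (\<lambda>x y. j (k x \<oplus>\<^bsub>L\<^esub> k y)), module.smult = (\<lambda>r x. j (r \<odot>\<^bsub>L\<^esub> k x)),
     bracket = (\<lambda>x y. j (bracket L (k x) (k y))), even_part = j ` even_part L, odd_part = j ` odd_part L\<rparr>"

lemma transport_simps [simp]:
  "carrier (transport j k L) = j ` carrier L" "\<zero>\<^bsub>transport j k L\<^esub> = j \<zero>\<^bsub>L\<^esub>"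
  "x \<oplus>\<^bsub>transport j k L\<^esub> y = j (k x \<oplus>\<^bsub>L\<^esub> k y)" "r \<odot>\<^bsub>transport j k L\<^esub> x = j (r \<odot>\<^bsub>L\<^esub> k x)"
  "bracket (transport j k L) x y = j (bracket L (k x) (k y))"
  "even_part (transport j k L) = j ` even_part L" "odd_part (transport j k L) = j ` odd_part L"
  by (simp_all add: transport_def)

lemma homog_transport [simp]: "homog (transport j k L) i = j ` homog L i"
  by (simp add: homog_def)

context lie_superalgebra begin

lemma transport_module:
  assumes k: "\<And>x. k (j x) = x"
  shows "module R (transport j k L)"
proof (rule moduleI[OF R.cring_axioms])
  show "abelian_group (transport j k L)"
  proof (rule abelian_groupI)
    fix x assume "x \<in> carrier (transport j k L)"
    then obtain a where "x = j a" "a \<in> carrier L" by auto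
    then show "\<exists>y\<in>carrier (transport j k L). y \<oplus>\<^bsub>transport j k L\<^esub> x = \<zero>\<^bsub>transport j k L\<^esub>"
      by (intro bexI[of _ "j (\<ominus>\<^bsub>L\<^esub> a)"]) (simp_all add: k M.l_neg)
  qed (auto simp: k M.a_ac)
qed (auto simp: k smult_l_distr smult_r_distr smult_assoc1)

lemma transport_a_inv:
  assumes k: "\<And>x. k (j x) = x" and x: "x \<in> carrier L"
  shows "\<ominus>\<^bsub>transport j k L\<^esub> (j x) = j (\<ominus>\<^bsub>L\<^esub> x)"
proof -
  interpret T: module R "transport j k L" by (rule transport_module[of k j, OF k])
  show ?thesis using x by (intro T.M.minus_equality) (simp_all add: k M.l_neg)
qed

lemma transport_submodule:
  assumes k: "\<And>x. k (j x) = x" and S: "submodule S R L"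
  shows "submodule (j ` S) R (transport j k L)"
proof -
  interpret T: module R "transport j k L" by (rule transport_module[of k j, OF k])
  note SE = submoduleE[OF S]
  have S0: "\<zero>\<^bsub>L\<^esub> \<in> S" using subgroup.one_closed[OF submodule.axioms(1)[OF S]] by simp
  show ?thesis
  proof (rule T.submoduleI)
    show "j ` S \<subseteq> carrier (transport j k L)" using SE(1) by auto
    show "\<zero>\<^bsub>transport j k L\<^esub> \<in> j ` S" using S0 by simp
    fix x assume "x \<in> j ` S"
    then obtain a where a: "x = j a" "a \<in> S" by blast
    then have "a \<in> carrier L" using SE(1) by blast
    then show "\<ominus>\<^bsub>transport j k L\<^esub> x \<in> j ` S" using a SE(3) by (simp add: transport_a_inv[of k j, OF k])
    show "r \<odot>\<^bsub>transport j k L\<^esub> x \<in> j ` S" if "r \<in> carrier R" for r using a SE(4) that by (simp add: k)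
    show "x \<oplus>\<^bsub>transport j k L\<^esub> y \<in> j ` S" if "y \<in> j ` S" for y using a SE(5) that by (auto simp: k)
  qed
qed

lemma transport:
  assumes k: "\<And>x. k (j x) = x"
  shows "lie_superalgebra R (transport j k L)"
proof (intro lie_superalgebra.intro lie_superalgebra_axioms.intro transport_module[of k j, OF k], goal_cases)
  case 1 show ?case using transport_submodule[of k j, OF k even_submodule] by simp
next
  case 2 show ?case using transport_submodule[of k j, OF k odd_submodule] by simp
next
  case 3
  have "j ` even_part L <+>\<^bsub>transport j k L\<^esub> j ` odd_part L = j ` (even_part L <+>\<^bsub>L\<^esub> odd_part L)"
    unfolding set_add_def' transport_simps by (auto simp: k)
  then show ?case by (simp only: transport_simps parts_span)
next
  case 4
  have "inj j" using k by (metis injI)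
  then show ?case by (simp only: transport_simps image_Int[symmetric] parts_disjoint image_insert image_empty)
next
  case (10 i i' a b)
  then obtain x y where "a = j x" "b = j y" "x \<in> homog L i" "y \<in> homog L i'" by auto
  then show ?case using bracket_homog[of i i' x y] 10 by (simp add: k)
next
  case (11 i i' a b)
  then obtain x y where xy: "a = j x" "b = j y" "x \<in> homog L i" "y \<in> homog L i'" by auto
  then have "x \<in> carrier L" "y \<in> carrier L" using homog_carrier by blast+
  then have "sgn_pow R (i * i') \<odot>\<^bsub>L\<^esub> bracket L x y \<in> carrier L" by (simp add: bracket_closed)
  then show ?case using super_antisym[OF 11(1,2) xy(3,4)] xy by (simp add: k transport_a_inv[of k j, OF k])
next
  case (12 i i' i'' a b c)
  then obtain x y z where "a = j x" "b = j y" "c = j z" "x \<in> homog L i" "y \<in> homog L i'" "z \<in> homog L i''"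
    by auto
  then show ?case using super_jacobi[of i i' i'' x y z] 12 by (simp add: k)
qed (auto simp: k bracket_closed bracket_add_left bracket_add_right bracket_smult_left bracket_smult_right
    even_square odd_cube)

end

section \<open>The integral form\<close>

context hall_series begin

sublocale series: hall_generators \<Z> "series_superalgebra p" A p "\<lambda>a. word [a]" C lt
  by (intro hall_generators.intro series_generators[OF p_degree] hall_set_axioms)

abbreviation "integral_form \<equiv> sub_super (series_superalgebra p) series.basis_span"

end

context hall_generators begin

lemma basis_span_super: "lie_superalgebra R (sub_super L basis_span)"
proof (rule sub_super)
  show "submodule basis_span R L" by (rule lspan_submodule[OF basis_closed])
  have "eval_at L f t \<in> even_part L \<union> odd_part L" if "t \<in> basis_exps C p" for t
    using eval_homog[OF basis_letters[OF that]] by (auto simp: homog_def split: if_splits)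
  then show "basis_span \<subseteq> (even_part L \<inter> basis_span) <+>\<^bsub>L\<^esub> (odd_part L \<inter> basis_span)"
    by (intro lspan_graded) blast
qed (rule bracket_basis_span)

lemma basis_in_span: "t \<in> basis_exps C p \<Longrightarrow> eval_at L f t \<in> basis_span"
  by (intro lspan.base) blast

end

context hall_series begin

lemma integral_basis: "basis_family \<Z> integral_form (basis_exps C p) D"
proof -
  interpret I: lie_superalgebra \<Z> integral_form by (rule series.basis_span_super)
  have mem: "D \<in> basis_exps C p \<rightarrow> carrier integral_form" using series.basis_in_span by simp
  have fs: "finsum integral_form g F = sum g F"
    if "finite F" "\<And>b. b \<in> F \<Longrightarrow> g b \<in> carrier integral_form" for g :: "'a brexp \<Rightarrow> 'a ncfps" and F
    using that
  proof (induction F)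
    case (insert x F)
    have "finsum integral_form g (insert x F) = g x \<oplus>\<^bsub>integral_form\<^esub> finsum integral_form g F"
      by (rule I.M.finsum_insert[OF insert.hyps]) (rule Pi_I, rule insert.prems, simp, rule insert.prems, simp)
    also have "finsum integral_form g F = sum g F" by (rule insert.IH) (rule insert.prems, simp)
    finally show ?case using insert.hyps by simp
  qed simp
  have indep: "h = (\<lambda>i. \<zero>\<^bsub>\<Z>\<^esub>)"
    if h: "h \<in> fin_funs \<Z> (basis_exps C p)" and zero: "lin_comb \<Z> integral_form D h = \<zero>\<^bsub>integral_form\<^esub>" for h
  proof -
    let ?F = "{i. h i \<noteq> \<zero>\<^bsub>\<Z>\<^esub>}"
    have F: "finite ?F" "?F \<subseteq> basis_exps C p" by (rule fin_funs_finite[OF h] fin_funs_support[OF h])+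
    have c: "h b \<odot>\<^bsub>integral_form\<^esub> D b \<in> carrier integral_form" if "b \<in> ?F" for b
      by (rule I.smult_closed[OF UNIV_I]) (use that F(2) mem in blast)
    have "(\<Sum>b\<in>?F. of_int (h b) * D b) = 0"
      using fs[OF F(1) c] zero by (simp add: lin_comb_def)
    then have "h b = 0" if "b \<in> ?F" for b
      by (rule series_independent[OF F _ that])
    then have "h b = \<zero>\<^bsub>\<Z>\<^esub>" for b by (cases "b \<in> ?F") simp_all
    then show ?thesis by (rule ext)
  qed
  have "carrier integral_form \<subseteq> lspan \<Z> integral_form (D ` basis_exps C p)"
    using lspan_sub_super by simp
  then show ?thesis
    unfolding I.basis_family_iff
    by (intro conjI ballI impI mem) (use indep in \<open>simp_all only: ring_record_simps\<close>)
qed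

lemma scalar_extension:
  assumes "cring R"
  shows "scalar_extension integral_form R (basis_exps C p) D (parity p)"
proof (intro scalar_extension.intro scalar_extension_axioms.intro series.basis_span_super assms integral_basis)
  show "parity p \<in> basis_exps C p \<rightarrow> {0, 1}"
    using series.parity_deg[OF series.basis_letters] by blast
  fix b assume b: "b \<in> basis_exps C p"
  show "D b \<in> homog integral_form (parity p b)"
    using series.eval_homog[OF series.basis_letters[OF b]] series.basis_in_span[OF b] by simp
qed

end

section \<open>Freeness\<close>

lemma hom_lin_comb:
  assumes L: "module R L" and M: "module R M"
    and \<phi>: "\<phi> \<in> lie_superalgebra_hom R L M" and v: "v \<in> J \<rightarrow> carrier L" and h: "h \<in> fin_funs R J"
  shows "\<phi> (lin_comb R L v h) = lin_comb R M (\<lambda>i. \<phi> (v i)) h"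
proof -
  interpret L: module R L by (rule L)
  interpret M: module R M by (rule M)
  have closed: "\<phi> x \<in> carrier M" if "x \<in> carrier L" for x
    using \<phi> that by (auto simp: lie_superalgebra_hom_def)
  have add: "\<phi> (x \<oplus>\<^bsub>L\<^esub> y) = \<phi> x \<oplus>\<^bsub>M\<^esub> \<phi> y" if "x \<in> carrier L" "y \<in> carrier L" for x y
    using \<phi> that by (auto simp: lie_superalgebra_hom_def)
  have scale: "\<phi> (r \<odot>\<^bsub>L\<^esub> x) = r \<odot>\<^bsub>M\<^esub> \<phi> x" if "r \<in> carrier R" "x \<in> carrier L" for r x
    using \<phi> that by (auto simp: lie_superalgebra_hom_def)
  have zero: "\<phi> \<zero>\<^bsub>L\<^esub> = \<zero>\<^bsub>M\<^esub>"
    using scale[OF L.R.zero_closed L.M.zero_closed] closed[OF L.M.zero_closed] by simp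
  have "\<phi> (\<Oplus>\<^bsub>L\<^esub>i\<in>F. h i \<odot>\<^bsub>L\<^esub> v i) = (\<Oplus>\<^bsub>M\<^esub>i\<in>F. h i \<odot>\<^bsub>M\<^esub> \<phi> (v i))" if "finite F" "F \<subseteq> J" for F
    using that
  proof (induction F)
    case empty
    then show ?case by (simp add: zero)
  next
    case (insert i F)
    have c: "h k \<odot>\<^bsub>L\<^esub> v k \<in> carrier L" if "k \<in> insert i F" for k
      using that insert.prems v fin_funs_carrier[OF h, of k] by (intro L.smult_closed) auto
    have d: "h k \<odot>\<^bsub>M\<^esub> \<phi> (v k) \<in> carrier M" if "k \<in> insert i F" for k
      using that insert.prems v fin_funs_carrier[OF h, of k] by (intro M.smult_closed closed) auto
    have "(\<Oplus>\<^bsub>L\<^esub>i\<in>F. h i \<odot>\<^bsub>L\<^esub> v i) \<in> carrier L" using c by (intro L.M.finsum_closed) blast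
    moreover have "(\<Oplus>\<^bsub>L\<^esub>i\<in>insert i F. h i \<odot>\<^bsub>L\<^esub> v i) = h i \<odot>\<^bsub>L\<^esub> v i \<oplus>\<^bsub>L\<^esub> (\<Oplus>\<^bsub>L\<^esub>i\<in>F. h i \<odot>\<^bsub>L\<^esub> v i)"
      using insert.hyps c by (intro L.M.finsum_insert) blast+
    moreover have "(\<Oplus>\<^bsub>M\<^esub>i\<in>insert i F. h i \<odot>\<^bsub>M\<^esub> \<phi> (v i)) =
        h i \<odot>\<^bsub>M\<^esub> \<phi> (v i) \<oplus>\<^bsub>M\<^esub> (\<Oplus>\<^bsub>M\<^esub>i\<in>F. h i \<odot>\<^bsub>M\<^esub> \<phi> (v i))"
      using insert.hyps d by (intro M.M.finsum_insert) blast+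
    moreover have "\<phi> (h i \<odot>\<^bsub>L\<^esub> v i) = h i \<odot>\<^bsub>M\<^esub> \<phi> (v i)"
      using insert.prems v fin_funs_carrier[OF h, of i] by (intro scale) auto
    ultimately show ?case using add c[of i] insert.IH insert.prems by simp
  qed
  then show ?thesis
    unfolding lin_comb_def using fin_funs_finite[OF h] fin_funs_support[OF h] by blast
qed

lemma hom_eval:
  assumes "lie_superalgebra R L" "\<phi> \<in> lie_superalgebra_hom R L M"
    and "set_brexp t \<subseteq> A" "A \<subseteq> carrier L" "\<And>a. a \<in> A \<Longrightarrow> \<phi> a = f a"
  shows "\<phi> (eval_in L t) = eval_at M f t \<and> eval_in L t \<in> carrier L"
  using assms(3)
proof (induction t)
  case (Gen a)
  then show ?case using assms(4,5) by auto
next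
  case (Br s t)
  then have "eval_in L s \<in> carrier L" "eval_in L t \<in> carrier L" by simp_all
  moreover have "\<phi> (bracket L x y) = bracket M (\<phi> x) (\<phi> y)" if "x \<in> carrier L" "y \<in> carrier L" for x y
    using assms(2) that by (simp add: lie_superalgebra_hom_def)
  ultimately show ?case using Br lie_superalgebra.bracket_closed[OF assms(1)] by simp
qed

lemma universal_onD:
  fixes M :: "('r, 'm) superalgebra"
  assumes "universal_on TYPE('m) R L A p" "lie_superalgebra R M" "\<forall>a\<in>A. f a \<in> homog M (p a)"
  shows "\<exists>!\<phi>. \<phi> \<in> lie_superalgebra_hom R L M \<and> \<phi> \<in> extensional (carrier L) \<and> (\<forall>a\<in>A. \<phi> a = f a)"
  using assms unfolding universal_on_def by simp

lemma freely_generatedD: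
  fixes R :: "('r, 's) ring_scheme" and L :: "('r, 'b, 'c) superalgebra_scheme"
  assumes "freely_generated R L A p"
  shows "lie_superalgebra R L" "p \<in> A \<rightarrow> {0, 1}" "\<And>a. a \<in> A \<Longrightarrow> a \<in> homog L (p a)"
    "universal_on TYPE('b brexp \<Rightarrow> 'r) R L A p"
  using assms unfolding freely_generated_def by simp_all

text \<open>
  Test the universal property on the extension of the integral form to \<open>R\<close>. The generator \<open>a\<close> goes to the
  basis vector of \<open>Gen a\<close>; then every member of the family goes to its own basis vector, because
  \<open>[s, t]\<close> is a basis element of the integral form whenever the expression \<open>Br s t\<close> belongs to the family.
\<close>

lemma free_independent:
  fixes R :: "('r, 's) ring_scheme" and L :: "('r, 'b, 'c) superalgebra_scheme"
  assumes "cring R" and free: "freely_generated R L A p" and hall: "hall_set A C lt"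
    and h: "h \<in> fin_funs R (basis_exps C p)" and zero: "lin_comb R L (eval_in L) h = \<zero>\<^bsub>L\<^esub>"
  shows "h = (\<lambda>i. \<zero>\<^bsub>R\<^esub>)"
proof -
  note L = freely_generatedD(1)[OF free] and p = freely_generatedD(2)[OF free]
    and A = freely_generatedD(3)[OF free] and univ = freely_generatedD(4)[OF free]
  interpret L: lie_superalgebra R L by (rule L)
  interpret H: hall_series A C lt p by (intro hall_series.intro hall hall_series_axioms.intro p)
  interpret X: scalar_extension H.integral_form R "basis_exps C p" H.D "parity p"
    by (rule H.scalar_extension[OF assms(1)])
  have C: "c \<in> basis_exps C p" if "c \<in> C" for c using that by (simp add: basis_exps_def)
  have "\<forall>a\<in>A. delta R (Gen a) \<in> homog X.E (p a)"
  proof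
    fix a assume "a \<in> A"
    then show "delta R (Gen a) \<in> homog X.E (p a)"
      using X.ext_homog_delta[OF C, of "Gen a"] H.Gen_iff by simp
  qed
  from universal_onD[OF univ X.lie_superalgebra this] obtain \<phi> where
    \<phi>: "\<phi> \<in> lie_superalgebra_hom R L X.E" and "\<forall>a\<in>A. \<phi> a = delta R (Gen a)"
    by (elim ex1E conjE)
  then have \<phi>A: "\<phi> a = delta R (Gen a)" if "a \<in> A" for a using that by simp
  have AL: "A \<subseteq> carrier L" using A L.homog_carrier by blast
  have ev: "\<phi> (eval_in L t) = eval_at X.E (\<lambda>a. delta R (Gen a)) t" "eval_in L t \<in> carrier L"
    if "set_brexp t \<subseteq> A" for t
    using hom_eval[OF L \<phi> that AL \<phi>A] by blast+
  have evC: "eval_at X.E (\<lambda>a. delta R (Gen a)) c = delta R c" if "c \<in> C" for c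
    using that
  proof (induction c)
    case (Br s t)
    then have st: "s \<in> C" "t \<in> C" using H.right_factor_lt by blast+
    have "eval_at X.E (\<lambda>a. delta R (Gen a)) (Br s t) = X.ext_bracket (delta R s) (delta R t)"
      using Br.IH st by simp
    also have "\<dots> = delta R (Br s t)"
      by (rule X.ext_delta_eq_delta[OF C[OF st(1)] C[OF st(2)] C[OF Br.prems]]) simp
    finally show ?case .
  qed simp
  have evB: "eval_at X.E (\<lambda>a. delta R (Gen a)) b = delta R b" if b: "b \<in> basis_exps C p" for b
  proof (cases "b \<in> C")
    case False
    then obtain w where w: "b = Br w w" "w \<in> C" using b by (auto simp: basis_exps_def)
    have "eval_at X.E (\<lambda>a. delta R (Gen a)) b = X.ext_bracket (delta R w) (delta R w)"
      using evC[OF w(2)] by (simp add: w(1))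
    also have "\<dots> = delta R b"
      unfolding w(1)
      by (rule X.ext_delta_eq_delta[OF C[OF w(2)] C[OF w(2)]]) (use b w(1) in simp_all)
    finally show ?thesis .
  qed (rule evC)
  have letters: "set_brexp b \<subseteq> A" if "b \<in> basis_exps C p" for b
    by (rule H.series.basis_letters[OF that])
  have evJ: "eval_in L \<in> basis_exps C p \<rightarrow> carrier L" by (rule Pi_I, rule ev(2), rule letters)
  have "\<phi> (lin_comb R L (eval_in L) h) = lin_comb R X.E (\<lambda>i. \<phi> (eval_in L i)) h"
    by (rule hom_lin_comb[OF L.module_axioms X.E.module_axioms \<phi> evJ h])
  also have "\<dots> = lin_comb R X.E (delta R) h"
    unfolding lin_comb_def
  proof (rule X.E.M.finsum_cong'[OF refl])
    show "(\<lambda>i. h i \<odot>\<^bsub>X.E\<^esub> delta R i) \<in> {i. h i \<noteq> \<zero>\<^bsub>R\<^esub>} \<rightarrow> carrier X.E"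
    proof
      fix i assume "i \<in> {i. h i \<noteq> \<zero>\<^bsub>R\<^esub>}"
      then have "i \<in> basis_exps C p" using fin_funs_support[OF h] by blast
      then show "h i \<odot>\<^bsub>X.E\<^esub> delta R i \<in> carrier X.E"
        by (intro X.E.smult_closed fin_funs_carrier[OF h] X.delta_closed)
    qed
    fix i assume "i \<in> {i. h i \<noteq> \<zero>\<^bsub>R\<^esub>}"
    then have "i \<in> basis_exps C p" using fin_funs_support[OF h] by blast
    then show "h i \<odot>\<^bsub>X.E\<^esub> \<phi> (eval_in L i) = h i \<odot>\<^bsub>X.E\<^esub> delta R i"
      by (simp only: ev(1)[OF letters] evB)
  qed
  finally have "lin_comb R X.E (delta R) h = \<phi> \<zero>\<^bsub>L\<^esub>" by (simp only: zero)
  also have "\<phi> \<zero>\<^bsub>L\<^esub> = \<zero>\<^bsub>X.E\<^esub>"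
    using hom_lin_comb[OF L.module_axioms X.E.module_axioms \<phi> evJ L.R.fin_funs_zero]
    by (simp only: L.lin_comb_zero X.E.lin_comb_zero)
  finally show ?thesis by (rule X.ext_independent[OF h])
qed

text \<open>
  Existence for the target \<open>S\<close> gives a homomorphism from \<open>L\<close> into \<open>S\<close> that fixes \<open>A\<close>. Regarded as a map into
  \<open>L\<close>, it must be the identity by uniqueness. Both targets have to be carried by functions
  from expressions to \<open>R\<close>; the indicator functions of generators embed \<open>L\<close> there once \<open>1 \<noteq> 0\<close>.
\<close>

lemma free_spanned:
  fixes R :: "('r, 's) ring_scheme" and L :: "('r, 'b, 'c) superalgebra_scheme"
  assumes free: "freely_generated R L A p" and nontrivial: "\<one>\<^bsub>R\<^esub> \<noteq> \<zero>\<^bsub>R\<^esub>"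
    and S: "submodule S R L" and subalg: "lie_superalgebra R (sub_super L S)" and AS: "A \<subseteq> S"
  shows "carrier L \<subseteq> S"
proof -
  note L = freely_generatedD(1)[OF free] and A = freely_generatedD(3)[OF free]
    and univ = freely_generatedD(4)[OF free]
  interpret L: lie_superalgebra R L by (rule L)
  define j where "j x = delta R (Gen x)" for x :: 'b
  have "inj j"
  proof (rule injI)
    fix x y assume "j x = j y"
    then have "j x (Gen x) = j y (Gen x)" by (rule fun_cong)
    then show "x = y" using nontrivial by (auto simp: j_def delta_def split: if_splits)
  qed
  define k where "k = inv_into UNIV j"
  have k: "k (j x) = x" for x using \<open>inj j\<close> by (simp add: k_def)
  let ?T = "transport j k L" and ?S = "transport j k (sub_super L S)"
  have T: "lie_superalgebra R ?T" by (rule L.transport[of k j, OF k])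
  have ST: "lie_superalgebra R ?S" by (rule lie_superalgebra.transport[OF subalg, of k j, OF k])
  have jS: "\<forall>a\<in>A. j a \<in> homog ?S (p a)"
    using A AS by (simp add: subset_iff)
  from universal_onD[OF univ ST jS] obtain \<phi> where \<phi>: "\<phi> \<in> lie_superalgebra_hom R L ?S"
      "\<phi> \<in> extensional (carrier L)" "\<forall>a\<in>A. \<phi> a = j a"
    by (elim ex1E conjE)
  have SL: "S \<subseteq> carrier L" by (rule L.submoduleE(1)[OF S])
  have \<phi>T: "\<phi> \<in> lie_superalgebra_hom R L ?T"
    using \<phi>(1) unfolding lie_superalgebra_hom_def mem_Collect_eq transport_simps sub_super_simps
  proof (elim conjE, intro conjI)
    assume \<phi>S: "\<phi> \<in> carrier L \<rightarrow> j ` S"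
    show "\<phi> \<in> carrier L \<rightarrow> j ` carrier L"
      by (rule Pi_I, rule subsetD[OF image_mono[OF SL]], rule funcset_mem[OF \<phi>S])
    assume "\<phi> ` even_part L \<subseteq> j ` (even_part L \<inter> S)"
    then show "\<phi> ` even_part L \<subseteq> j ` even_part L" by (rule subset_trans) (rule image_mono, simp)
    assume "\<phi> ` odd_part L \<subseteq> j ` (odd_part L \<inter> S)"
    then show "\<phi> ` odd_part L \<subseteq> j ` odd_part L" by (rule subset_trans) (rule image_mono, simp)
  qed
  let ?j = "restrict j (carrier L)"
  have e: "even_part L \<subseteq> carrier L" "odd_part L \<subseteq> carrier L"
    using L.homog_carrier[of 0] L.homog_carrier[of 1] by (simp_all add: homog_def)
  have jT: "?j \<in> lie_superalgebra_hom R L ?T"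
    unfolding lie_superalgebra_hom_def mem_Collect_eq
  proof (intro conjI ballI)
    show "?j ` even_part L \<subseteq> even_part ?T"
      using e(1) by (intro image_subsetI) (simp add: subset_iff)
    show "?j ` odd_part L \<subseteq> odd_part ?T"
      using e(2) by (intro image_subsetI) (simp add: subset_iff)
  qed (simp_all add: k L.bracket_closed)
  have AL: "A \<subseteq> carrier L" using A L.homog_carrier by blast
  have "\<forall>a\<in>A. j a \<in> homog ?T (p a)" using A by simp
  from universal_onD[OF univ T this]
  have "\<exists>!\<psi>. \<psi> \<in> lie_superalgebra_hom R L ?T \<and> \<psi> \<in> extensional (carrier L) \<and> (\<forall>a\<in>A. \<psi> a = j a)" .
  moreover have "\<phi> \<in> lie_superalgebra_hom R L ?T \<and> \<phi> \<in> extensional (carrier L) \<and> (\<forall>a\<in>A. \<phi> a = j a)"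
    by (intro conjI \<phi>T \<phi>(2,3))
  moreover have "?j \<in> lie_superalgebra_hom R L ?T \<and> ?j \<in> extensional (carrier L) \<and> (\<forall>a\<in>A. ?j a = j a)"
    using AL by (intro conjI jT) (simp_all add: subset_iff)
  moreover have "g = h" if "\<exists>!\<psi>. Q \<psi>" "Q g" "Q h" for Q and g h :: "'b \<Rightarrow> 'b brexp \<Rightarrow> 'r"
    using that by blast
  ultimately have eq: "\<phi> = ?j" by blast
  show ?thesis
  proof
    fix x assume x: "x \<in> carrier L"
    then have "\<phi> x \<in> j ` S" using \<phi>(1) by (auto simp: lie_superalgebra_hom_def)
    then have "j x \<in> j ` S" using x eq by simp
    then show "x \<in> S" using \<open>inj j\<close> by (simp add: inj_image_mem_iff)
  qed
qed

theorem theorem2: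
  fixes R :: "('r, 's) ring_scheme"
    and L :: "('r, 'b, 'c) superalgebra_scheme"
    and A :: "'b set" and ltA :: "'b \<Rightarrow> 'b \<Rightarrow> bool" and p :: "'b \<Rightarrow> nat"
    and C :: "'b brexp set" and lt :: "'b brexp \<Rightarrow> 'b brexp \<Rightarrow> bool"
  assumes "cring R"
    and "strict_total_order_on A ltA"
    and "freely_generated R L A p"
    and "complete_basic_set A ltA C lt"
  shows "basis_family R L (C \<union> {Br w w | w. w \<in> C \<and> parity p w = 1}) (eval_in L)"
proof -
  note L = freely_generatedD(1)[OF assms(3)] and p = freely_generatedD(2)[OF assms(3)]
    and A = freely_generatedD(3)[OF assms(3)]
  interpret L: lie_superalgebra R L by (rule L)
  have hall: "hall_set A C lt" by (rule complete_basic_set_imp_hall_set[OF assms(4)])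
  interpret H: hall_generators R L A p "\<lambda>a. a" C lt
    by (intro hall_generators.intro graded_generators.intro graded_generators_axioms.intro L p A hall)
  have ev: "eval_at L (\<lambda>a. a) = eval_in L" by (rule ext) (rule eval_at_id)
  have mem: "eval_in L \<in> basis_exps C p \<rightarrow> carrier L"
    using H.basis_closed unfolding ev by blast
  have "carrier L \<subseteq> H.basis_span"
    (* If 1 = 0, the indicator functions of generators no longer embed L; but then L is zero. *)
  proof (cases "\<one>\<^bsub>R\<^esub> = \<zero>\<^bsub>R\<^esub>")
    case True
    then have "x = \<zero>\<^bsub>L\<^esub>" if "x \<in> carrier L" for x
      using L.smult_one[OF that] L.smult_l_null[OF that] by simp
    then show ?thesis using lspan.zero[of L R] by blast
  next
    case False
    show ?thesis
    proof (rule free_spanned[OF assms(3) False _ H.basis_span_super])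
      show "submodule H.basis_span R L" by (rule L.lspan_submodule[OF H.basis_closed])
      show "A \<subseteq> H.basis_span"
        using H.basis_in_span[of "Gen a" for a] H.Gen_iff by (auto simp: basis_exps_def)
    qed
  qed
  moreover have "\<forall>h\<in>fin_funs R (basis_exps C p). lin_comb R L (eval_in L) h = \<zero>\<^bsub>L\<^esub> \<longrightarrow> h = (\<lambda>i. \<zero>\<^bsub>R\<^esub>)"
    using free_independent[OF assms(1,3) hall] by blast
  ultimately have "basis_family R L (basis_exps C p) (eval_in L)"
    unfolding L.basis_family_iff using mem unfolding ev by blast
  then show ?thesis unfolding basis_exps_def .
qed

end
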